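(* Let $p\ge 5$ and let $S^2$ be the standard unit 2-sphere with north pole $\mathrm{N}$. Let $u_0\in H^1(S^2)$ be a complex-valued function that is radial about $\mathrm{N}$, i.e. $u_0(x)=u_0(r)$ with $r=\mathrm{dist}(\mathrm{N},x)\in[0,\pi]$, and antisymmetric about $r=\frac{\pi}{2}$, i.e. $u_0(\pi-r)=-u_0(r)$ for all $r$, with $u_0(\frac{\pi}{2})=0$. Assume that the energy $$E_0=\int_{S^2}\Big(|\nabla u_0|^2-\frac{2}{p+1}|u_0|^{p+1}\Big)$$ satisfies $E_0<0$. Let $u$ be the (antisymmetric) solution of $$iu_t=\Delta u+|u|^{p-1}u\ \text{ on } S^2,\qquad u(0)=u_0,$$ with maximal existence time $T\in(0,\infty]$, and assume $$u\in C^1([0,T),L^2(S^2))\cap C([0,T),H^2(S^2)\cap L^{p+1}(S^2)).$$ Then $u$ blows up in finite time, i.e. $T<\infty$.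
   Context: $\Delta$ is the Laplace–Beltrami operator of the round metric on $S^2$, with the sign convention $\Delta u=u''$ on $\mathbb{R}$. $\mathrm{dist}$ is the geodesic distance on $S^2$. Solutions are complex-valued, and $|\nabla u|^2=g(\nabla u,\nabla\bar u)$ where $g$ is extended complex-bilinearly. The antisymmetric solution means that $u(t,\cdot)$ is radial about $\mathrm{N}$ with $u(t,\pi-r)=-u(t,r)$ for all $t\in[0,T)$. "Blows up in finite time" means that the maximal existence time $T$ in the stated regularity class is finite. *)

theory Defs
  imports "HOL-Analysis.Analysis"
begin

section \<open>The round unit 2-sphere\<close>

text \<open>
  The sphere is the unit sphere of \<open>real^3\<close>. A function on it is represented by a function on
  \<open>real^3\<close>, of which only the values on the sphere (in fact, almost everywhere on the sphere)
  matter.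
\<close>

definition north_pole :: "real^3" where
  "north_pole = vector [0, 0, 1]"

definition geodesic_dist :: "real^3 \<Rightarrow> real^3 \<Rightarrow> real" where
  "geodesic_dist x y = arccos (x \<bullet> y)"

text \<open>
  Riemannian area of the round metric \<open>dr\<^sup>2 + sin\<^sup>2 r d\<theta>\<^sup>2\<close>, whose density is \<open>sin r\<close> in the
  geodesic polar coordinates \<open>(r, \<theta>)\<close> about the north pole. As a measure on \<open>real^3\<close> it is
  concentrated on the sphere.
\<close>

definition sphere_area :: "(real^3) measure" where
  "sphere_area =
     distr (density lborel (\<lambda>z. ennreal (indicat_real ({0..pi} \<times> {0..2 * pi}) z * sin (fst z))))
           borel
           (\<lambda>(r, \<theta>). vector [sin r * cos \<theta>, sin r * sin \<theta>, cos r])"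


section \<open>Lebesgue and Sobolev spaces on the sphere\<close>

definition Lspace :: "real \<Rightarrow> (real^3 \<Rightarrow> complex) set" where
  "Lspace q = {u \<in> borel_measurable sphere_area. integrable sphere_area (\<lambda>x. norm (u x) powr q)}"

definition Lnorm :: "real \<Rightarrow> (real^3 \<Rightarrow> complex) \<Rightarrow> real" where
  "Lnorm q u = (\<integral>x. norm (u x) powr q \<partial>sphere_area) powr (1 / q)"

text \<open>
  Tangential derivatives: \<open>D\<^sub>i \<phi>\<close> is the \<open>i\<close>-th Cartesian component of the intrinsic gradient,
  which is the projection \<open>g - (g \<bullet> x) x\<close> of the Euclidean gradient \<open>g\<close> of any extension of \<open>\<phi>\<close>
  to the tangent space at \<open>x\<close>. The weak derivative is defined by the integration by parts formula
  \<open>\<integral> u D\<^sub>i \<phi> = - \<integral> (D\<^sub>i u) \<phi> + \<integral> u \<phi> H \<nu>\<^sub>i\<close> on a closed surface, where for the unit sphere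
  the outer normal is \<open>\<nu> = x\<close> and the mean curvature (sum of the principal curvatures) is \<open>H = 2\<close>.
  The test functions are all \<open>C\<^sup>1\<close> functions on the sphere, given as restrictions of \<open>C\<^sup>1\<close>
  functions on the ambient space.
\<close>

definition weak_tderiv :: "3 \<Rightarrow> (real^3 \<Rightarrow> complex) \<Rightarrow> (real^3 \<Rightarrow> complex) \<Rightarrow> bool" where
  "weak_tderiv i u v \<longleftrightarrow>
     (\<forall>(\<phi> :: real^3 \<Rightarrow> real) g. (\<forall>x. GDERIV \<phi> x :> g x) \<and> continuous_on UNIV g \<longrightarrow>
        (\<integral>x. (g x $ i - (g x \<bullet> x) * x $ i) *\<^sub>R u x \<partial>sphere_area) =
          - (\<integral>x. \<phi> x *\<^sub>R v x \<partial>sphere_area)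
          + (\<integral>x. (2 * x $ i * \<phi> x) *\<^sub>R u x \<partial>sphere_area))"

text \<open>
  A weak derivative is unique up to equality almost everywhere, so the choice made below is
  immaterial for membership in the spaces, norms, and statements holding almost everywhere.
\<close>

definition tderiv :: "3 \<Rightarrow> (real^3 \<Rightarrow> complex) \<Rightarrow> real^3 \<Rightarrow> complex" where
  "tderiv i u = (SOME v. v \<in> Lspace 2 \<and> weak_tderiv i u v)"

text \<open>\<open>sobolev k\<close> is the space \<open>H\<^sup>k\<close> of the sphere.\<close>

primrec sobolev :: "nat \<Rightarrow> (real^3 \<Rightarrow> complex) set" where
  "sobolev 0 = Lspace 2"
| "sobolev (Suc k) =
     {u \<in> Lspace 2. \<forall>i. (\<exists>v \<in> Lspace 2. weak_tderiv i u v) \<and> tderiv i u \<in> sobolev k}"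

primrec sobolev_sqnorm :: "nat \<Rightarrow> (real^3 \<Rightarrow> complex) \<Rightarrow> real" where
  "sobolev_sqnorm 0 u = (Lnorm 2 u)\<^sup>2"
| "sobolev_sqnorm (Suc k) u = (Lnorm 2 u)\<^sup>2 + (\<Sum>i\<in>UNIV. sobolev_sqnorm k (tderiv i u))"

definition sobolev_norm :: "nat \<Rightarrow> (real^3 \<Rightarrow> complex) \<Rightarrow> real" where
  "sobolev_norm k u = sqrt (sobolev_sqnorm k u)"

definition gradient :: "(real^3 \<Rightarrow> complex) \<Rightarrow> real^3 \<Rightarrow> complex^3" where
  "gradient u x = (\<chi> i. tderiv i u x)"

text \<open>The intrinsic divergence of a tangent field \<open>X\<close> is \<open>\<Sum>i. D\<^sub>i X\<^sub>i\<close>; hence:\<close>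

definition laplace_beltrami :: "(real^3 \<Rightarrow> complex) \<Rightarrow> real^3 \<Rightarrow> complex" where
  "laplace_beltrami u x = (\<Sum>i\<in>UNIV. tderiv i (tderiv i u) x)"


section \<open>Symmetry and energy\<close>

text \<open>
  Functions are identified when equal almost everywhere, so radiality asks for a profile \<open>f\<close>
  representing the function; the pointwise conditions are imposed on the profile.
\<close>

definition radial_antisymmetric :: "(real^3 \<Rightarrow> complex) \<Rightarrow> bool" where
  "radial_antisymmetric u \<longleftrightarrow>
     (\<exists>f \<in> borel_measurable borel.
        (AE x in sphere_area. u x = f (geodesic_dist north_pole x)) \<and>
        (\<forall>r \<in> {0..pi}. f (pi - r) = - f r) \<and> f (pi / 2) = 0)"

definition energy :: "real \<Rightarrow> (real^3 \<Rightarrow> complex) \<Rightarrow> real" where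
  "energy p u =
     (\<integral>x. (norm (gradient u x))\<^sup>2 - 2 / (p + 1) * norm (u x) powr (p + 1) \<partial>sphere_area)"


section \<open>Solutions of the Schroedinger equation\<close>

definition time_interval :: "ereal \<Rightarrow> real set" where
  "time_interval T = {t. 0 \<le> t \<and> ereal t < T}"

definition continuous_in_norm ::
  "((real^3 \<Rightarrow> complex) \<Rightarrow> real) \<Rightarrow> real set \<Rightarrow> (real \<Rightarrow> real^3 \<Rightarrow> complex) \<Rightarrow> bool" where
  "continuous_in_norm nrm I u \<longleftrightarrow>
     (\<forall>t\<in>I. ((\<lambda>s. nrm (\<lambda>x. u s x - u t x)) \<longlongrightarrow> 0) (at t within I))"

text \<open>\<open>u\<close> is in \<open>C\<^sup>1(I, L\<^sup>2)\<close> with derivative \<open>u'\<close>.\<close>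

definition C1_L2 ::
  "real set \<Rightarrow> (real \<Rightarrow> real^3 \<Rightarrow> complex) \<Rightarrow> (real \<Rightarrow> real^3 \<Rightarrow> complex) \<Rightarrow> bool" where
  "C1_L2 I u u' \<longleftrightarrow>
     (\<forall>t\<in>I. u t \<in> Lspace 2 \<and> u' t \<in> Lspace 2 \<and>
        ((\<lambda>s. Lnorm 2 (\<lambda>x. (u s x - u t x) /\<^sub>R (s - t) - u' t x)) \<longlongrightarrow> 0) (at t within I)) \<and>
     continuous_in_norm (Lnorm 2) I u'"

text \<open>
  Solutions on \<open>[0, T)\<close> in \<open>C\<^sup>1([0,T), L\<^sup>2) \<inter> C([0,T), H\<^sup>2 \<inter> L\<^sup>p\<^sup>+\<^sup>1)\<close>; the equation holds in \<open>L\<^sup>2\<close>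
  at every time.
\<close>

definition nls_solution ::
  "real \<Rightarrow> (real^3 \<Rightarrow> complex) \<Rightarrow> ereal \<Rightarrow> (real \<Rightarrow> real^3 \<Rightarrow> complex) \<Rightarrow> bool" where
  "nls_solution p u0 T u \<longleftrightarrow>
     (\<forall>t\<in>time_interval T. u t \<in> sobolev 2 \<inter> Lspace (p + 1)) \<and>
     continuous_in_norm (sobolev_norm 2) (time_interval T) u \<and>
     continuous_in_norm (Lnorm (p + 1)) (time_interval T) u \<and>
     (AE x in sphere_area. u 0 x = u0 x) \<and>
     (\<exists>u'. C1_L2 (time_interval T) u u' \<and>
        (\<forall>t\<in>time_interval T. AE x in sphere_area.
           \<i> * u' t x = laplace_beltrami (u t) x + (norm (u t x) powr (p - 1)) *\<^sub>R u t x))"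

text \<open>\<open>T\<close> is the maximal existence time of \<open>u\<close>: no solution in the same class extends \<open>u\<close>.\<close>

definition maximal_nls_solution ::
  "real \<Rightarrow> (real^3 \<Rightarrow> complex) \<Rightarrow> ereal \<Rightarrow> (real \<Rightarrow> real^3 \<Rightarrow> complex) \<Rightarrow> bool" where
  "maximal_nls_solution p u0 T u \<longleftrightarrow>
     nls_solution p u0 T u \<and>
     \<not> (\<exists>T' v. T < T' \<and> nls_solution p u0 T' v \<and>
          (\<forall>t\<in>time_interval T. AE x in sphere_area. v t x = u t x))"

end

theory Submission
  imports Defs
begin

text \<open>
  Suppose the solution were global. In the height coordinate \<open>z = x\<^sub>3\<close> the area of the sphere is
  \<open>2 \<pi> dz\<close> (Archimedes), a radial function is a function \<open>h\<close> of \<open>z \<in> [-1, 1]\<close>, its Dirichlet energy is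
  \<open>2 \<pi> \<integral> (1 - z\<^sup>2) |h'|\<^sup>2 dz\<close> and its Laplacian is \<open>((1 - z\<^sup>2) h')'\<close>. An antisymmetric \<open>h\<close> is odd, hence
  vanishes at the equator \<open>z = 0\<close>, and the flow can be studied on the hemisphere \<open>0 \<le> z \<le> 1\<close> with a
  Dirichlet condition.
  
  On the hemisphere the function \<open>\<phi>(z) = ln 2 - ln (1 + z)\<close> has constant Laplacian 1. This makes it
  the right weight for a virial argument: with
  
  \<open>J = \<integral>\<^sub>0\<^sup>1 \<phi> |h|\<^sup>2\<close>,  \<open>M = \<integral>\<^sub>0\<^sup>1 (1 - z) Im (cnj h h')\<close>,  \<open>E = \<integral>\<^sub>0\<^sup>1 (1 - z\<^sup>2) |h'|\<^sup>2 - 2/(p+1) |h|\<^sup>p\<^sup>+\<^sup>1\<close>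
  
  one has \<open>J' = 2 M\<close> and
  
  \<open>M' = - |h'(0)|\<^sup>2 + \<integral>\<^sub>0\<^sup>1 2 (1 - z) |h'|\<^sup>2 - (p-1)/(p+1) |h|\<^sup>p\<^sup>+\<^sup>1 \<le> 2 E\<close>.
  
  The boundary term at the equator has the good sign, \<open>1 - z \<le> 1 - z\<^sup>2\<close> bounds the gradient term, and
  \<open>p \<ge> 5\<close> enters as \<open>p - 1 \<ge> 4\<close> in the potential term. As \<open>E\<close> is conserved, \<open>J'' \<le> 4 E(0) < 0\<close>, so that
  the nonnegative quantity \<open>J\<close> would become negative in finite time. This is the content of the
  locale \<open>radial_flow\<close> and its theorem \<open>half_energy_nonneg\<close>.
  
  What remains is to justify these computations for solutions that are only \<open>C\<^sup>1\<close> in time with values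
  in \<open>L\<^sup>2\<close> and continuous with values in \<open>H\<^sup>2\<close>.
  
  \<^item> In space, everything is recovered from the Laplacian \<open>l \<in> L\<^sup>2\<close> by two integrations: the flux
    \<open>(1 - z\<^sup>2) h'\<close> is \<open>K(z) = - \<integral>\<^sub>z\<^sup>1 l\<close>, which satisfies \<open>|K(z)| \<le> \<surd>(1 - z) \<parallel>l\<parallel>\<close>, so that
    \<open>h(z) = \<integral>\<^sub>0\<^sup>z K(y) / (1 - y\<^sup>2) dy\<close> is bounded by \<open>2 \<parallel>l\<parallel>\<close>. Hence \<open>h\<close> and \<open>K\<close> are absolutely continuous, and
    all integrations by parts reduce to the product rule \<open>abs_cont_product\<close>.
  \<^item> In time, only the increments of \<open>h\<close> itself are under control. The momentum \<open>M\<close> is differentiable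
    because an integration by parts moves the space derivative away from the increment
    (\<open>momentum_swap\<close>), the Dirichlet energy because the Laplacian is symmetric, and the potential
    energy because \<open>|h|\<^sup>p\<^sup>+\<^sup>1\<close> is convex and lies between its tangents.
  \<^item> On the sphere, averaging over circles of latitude turns the weak derivatives of \<open>u\<close> into weak
    derivatives in \<open>z\<close>. Testing against the coordinate functions shows that the weak gradient is
    tangential; consequently its norm dominates the derivative in \<open>z\<close>, which gives
    \<open>4 \<pi> E \<le> energy p u\<close> (\<open>energy_ge_half_energy\<close>). This inequality is only used at time 0.
\<close>


section \<open>Square-integrable functions\<close>

definition sq_integrable :: "'a measure \<Rightarrow> ('a \<Rightarrow> 'b::euclidean_space) \<Rightarrow> bool" where
  "sq_integrable M f \<longleftrightarrow> f \<in> borel_measurable M \<and> integrable M (\<lambda>x. (norm (f x))\<^sup>2)"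

definition l2norm :: "'a measure \<Rightarrow> ('a \<Rightarrow> 'b::euclidean_space) \<Rightarrow> real" where
  "l2norm M f = sqrt (LINT x|M. (norm (f x))\<^sup>2)"

lemma sq_integrable_measurable [measurable_dest]:
  "sq_integrable M f \<Longrightarrow> f \<in> borel_measurable M"
  by (simp add: sq_integrable_def)

lemma sq_integrable_square: "sq_integrable M f \<Longrightarrow> integrable M (\<lambda>x. (norm (f x))\<^sup>2)"
  by (simp add: sq_integrable_def)

lemma l2norm_nonneg [simp]: "0 \<le> l2norm M f"
  by (simp add: l2norm_def)

lemma l2norm_power2: "(l2norm M f)\<^sup>2 = (LINT x|M. (norm (f x))\<^sup>2)"
  by (simp add: l2norm_def)

lemma sq_integrable_bound:
  assumes "sq_integrable M f" and [measurable]: "g \<in> borel_measurable M"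
    and "AE x in M. norm (g x) \<le> c * norm (f x)"
  shows "sq_integrable M g"
proof -
  have "integrable M (\<lambda>x. (norm (g x))\<^sup>2)"
  proof (rule Bochner_Integration.integrable_bound)
    show "integrable M (\<lambda>x. c\<^sup>2 * (norm (f x))\<^sup>2)"
      using assms by (simp add: sq_integrable_def)
    show "AE x in M. norm ((norm (g x))\<^sup>2) \<le> norm (c\<^sup>2 * (norm (f x))\<^sup>2)"
      using assms(3)
    proof eventually_elim
      case (elim x)
      then have "(norm (g x))\<^sup>2 \<le> (c * norm (f x))\<^sup>2"
        by (intro power_mono) auto
      then show ?case
        by (simp add: power_mult_distrib)
    qed
  qed measurable
  then show ?thesis
    by (simp add: sq_integrable_def)
qed

lemma sq_integrable_norm:
  assumes "sq_integrable M f"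
  shows "sq_integrable M (\<lambda>x. norm (f x))"
  using assms by (auto simp: sq_integrable_def)

lemma sq_integrable_bounded:
  assumes "finite_measure M" and [measurable]: "f \<in> borel_measurable M"
    and "AE x in M. norm (f x) \<le> c"
  shows "sq_integrable M f"
proof -
  interpret finite_measure M by fact
  show ?thesis
    using assms(3) by (intro sq_integrable_bound[of M "\<lambda>_. 1::real" f c]) (auto simp: sq_integrable_def)
qed

lemma sq_integrable_add:
  assumes f: "sq_integrable M f" and g: "sq_integrable M g"
  shows "sq_integrable M (\<lambda>x. f x + g x)"
proof -
  note [measurable] = sq_integrable_measurable[OF f] sq_integrable_measurable[OF g]
  have "integrable M (\<lambda>x. (norm (f x + g x))\<^sup>2)"
  proof (rule Bochner_Integration.integrable_bound)
    show "integrable M (\<lambda>x. 2 * (norm (f x))\<^sup>2 + 2 * (norm (g x))\<^sup>2)"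
      using f g by (simp add: sq_integrable_def)
    show "AE x in M. norm ((norm (f x + g x))\<^sup>2) \<le> norm (2 * (norm (f x))\<^sup>2 + 2 * (norm (g x))\<^sup>2)"
    proof (rule AE_I2)
      fix x
      have "(norm (f x + g x))\<^sup>2 \<le> (norm (f x) + norm (g x))\<^sup>2"
        by (intro power_mono norm_triangle_ineq) auto
      also have "\<dots> \<le> 2 * (norm (f x))\<^sup>2 + 2 * (norm (g x))\<^sup>2"
        using sum_squares_bound[of "norm (f x)" "norm (g x)"] by (simp add: power2_sum)
      finally show "norm ((norm (f x + g x))\<^sup>2) \<le> norm (2 * (norm (f x))\<^sup>2 + 2 * (norm (g x))\<^sup>2)"
        by simp
    qed
  qed measurable
  then show ?thesis
    by (simp add: sq_integrable_def)
qed

lemma sq_integrable_scaleR: "sq_integrable M f \<Longrightarrow> sq_integrable M (\<lambda>x. c *\<^sub>R f x)"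
  by (rule sq_integrable_bound[of M f _ "\<bar>c\<bar>"]) auto

lemma sq_integrable_cmult:
  fixes f :: "'a \<Rightarrow> complex"
  shows "sq_integrable M f \<Longrightarrow> sq_integrable M (\<lambda>x. c * f x)"
  by (rule sq_integrable_bound[of M f _ "norm c"]) (auto simp: norm_mult)

lemma sq_integrable_diff:
  assumes "sq_integrable M f" "sq_integrable M g"
  shows "sq_integrable M (\<lambda>x. f x - g x)"
  using sq_integrable_add[OF assms(1) sq_integrable_scaleR[OF assms(2), of "-1"]] by simp

lemma integrable_inner_sq:
  assumes f: "sq_integrable M f" and g: "sq_integrable M g"
  shows "integrable M (\<lambda>x. f x \<bullet> g x)"
proof (rule Bochner_Integration.integrable_bound)
  note [measurable] = sq_integrable_measurable[OF f] sq_integrable_measurable[OF g]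
  show "(\<lambda>x. f x \<bullet> g x) \<in> borel_measurable M"
    by measurable
  show "integrable M (\<lambda>x. (norm (f x))\<^sup>2 + (norm (g x))\<^sup>2)"
    using f g by (simp add: sq_integrable_def)
  show "AE x in M. norm (f x \<bullet> g x) \<le> norm ((norm (f x))\<^sup>2 + (norm (g x))\<^sup>2)"
  proof (rule AE_I2)
    fix x
    have "\<bar>f x \<bullet> g x\<bar> \<le> norm (f x) * norm (g x)"
      by (rule Cauchy_Schwarz_ineq2)
    also have "\<dots> \<le> (norm (f x))\<^sup>2 + (norm (g x))\<^sup>2"
      using sum_squares_bound[of "norm (f x)" "norm (g x)"] mult_nonneg_nonneg[of "norm (f x)" "norm (g x)"]
        norm_ge_zero[of "f x"] norm_ge_zero[of "g x"] by linarith
    finally show "norm (f x \<bullet> g x) \<le> norm ((norm (f x))\<^sup>2 + (norm (g x))\<^sup>2)"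
      by simp
  qed
qed

lemma integrable_sq_integrable:
  assumes "finite_measure M" and f: "sq_integrable M f"
  shows "integrable M f"
proof (rule Bochner_Integration.integrable_bound)
  interpret finite_measure M by fact
  show "f \<in> borel_measurable M" using f by (rule sq_integrable_measurable)
  show "integrable M (\<lambda>x. 1 + (norm (f x))\<^sup>2)"
    using f by (simp add: sq_integrable_def)
  show "AE x in M. norm (f x) \<le> norm (1 + (norm (f x))\<^sup>2)"
  proof (rule AE_I2)
    fix x
    have "norm (f x) \<le> 1 + (norm (f x))\<^sup>2"
      using sum_squares_bound[of "norm (f x)" 1] norm_ge_zero[of "f x"]
      by (simp only: power_one mult_1_right)
    then show "norm (f x) \<le> norm (1 + (norm (f x))\<^sup>2)"
      unfolding real_norm_def by linarith
  qed
qed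

lemma integral_Cauchy_Schwarz:
  assumes f: "sq_integrable M f" and g: "sq_integrable M g"
  shows "\<bar>LINT x|M. f x \<bullet> g x\<bar> \<le> l2norm M f * l2norm M g"
proof -
  define A B C where "A = (LINT x|M. (norm (f x))\<^sup>2)" and "B = (LINT x|M. (norm (g x))\<^sup>2)"
    and "C = (LINT x|M. f x \<bullet> g x)"
  have AB: "0 \<le> A" "0 \<le> B"
    by (auto simp: A_def B_def)
  have quad: "0 \<le> A - 2 * c * C + c\<^sup>2 * B" for c
  proof -
    have "0 \<le> (LINT x|M. (norm (f x - c *\<^sub>R g x))\<^sup>2)"
      by simp
    also have "\<dots> = (LINT x|M. (norm (f x))\<^sup>2 - 2 * c * (f x \<bullet> g x) + c\<^sup>2 * (norm (g x))\<^sup>2)"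
      by (intro Bochner_Integration.integral_cong refl)
        (simp only: power2_norm_eq_inner, simp add: inner_diff_left inner_diff_right inner_commute
          algebra_simps power2_eq_square)
    also have "\<dots> = A - 2 * c * C + c\<^sup>2 * B"
      using sq_integrable_square[OF f] sq_integrable_square[OF g] integrable_inner_sq[OF f g]
      by (simp add: A_def B_def C_def)
    finally show ?thesis .
  qed
  have "C\<^sup>2 \<le> A * B"
  proof (cases "B = 0")
    case True
    have "C = 0"
    proof (rule ccontr)
      assume "C \<noteq> 0"
      then show False
        using quad[of "(A + 1) / (2 * C)"] True by simp
    qed
    with AB show ?thesis by simp
  next
    case False
    with AB have "0 < B" by simp
    then show ?thesis
      using quad[of "C / B"] by (simp add: field_simps power2_eq_square)
  qed
  then have "\<bar>C\<bar> \<le> sqrt (A * B)"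
    by (rule real_le_rsqrt[of "\<bar>C\<bar>", simplified])
  then show ?thesis
    by (simp add: A_def B_def C_def l2norm_def real_sqrt_mult)
qed

lemma tendsto_integral_inner:
  assumes "sq_integrable M f" "sq_integrable M g"
    and "\<forall>\<^sub>F s in F. sq_integrable M (f' s)" "\<forall>\<^sub>F s in F. sq_integrable M (g' s)"
    and "((\<lambda>s. l2norm M (\<lambda>x. f' s x - f x)) \<longlongrightarrow> 0) F"
    and "((\<lambda>s. l2norm M (\<lambda>x. g' s x - g x)) \<longlongrightarrow> 0) F"
  shows "((\<lambda>s. LINT x|M. f' s x \<bullet> g' s x) \<longlongrightarrow> (LINT x|M. f x \<bullet> g x)) F"
proof -
  define a b where "a = (\<lambda>s. l2norm M (\<lambda>x. f' s x - f x))" and "b = (\<lambda>s. l2norm M (\<lambda>x. g' s x - g x))"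
  have lim: "((\<lambda>s. a s * b s + l2norm M f * b s + a s * l2norm M g) \<longlongrightarrow> 0 * 0 + l2norm M f * 0 + 0 * l2norm M g) F"
    unfolding a_def b_def by (intro tendsto_intros assms)
  have "((\<lambda>s. (LINT x|M. f' s x \<bullet> g' s x) - (LINT x|M. f x \<bullet> g x)) \<longlongrightarrow> 0) F"
  proof (rule Lim_null_comparison[OF _ lim[simplified]])
    show "\<forall>\<^sub>F s in F. norm ((LINT x|M. f' s x \<bullet> g' s x) - (LINT x|M. f x \<bullet> g x))
        \<le> a s * b s + l2norm M f * b s + a s * l2norm M g"
      using assms(3,4)
    proof eventually_elim
      case (elim s)
      note df = sq_integrable_diff[OF elim(1) assms(1)] and dg = sq_integrable_diff[OF elim(2) assms(2)]
      have "(LINT x|M. f' s x \<bullet> g' s x) =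
          (LINT x|M. ((f' s x - f x) \<bullet> (g' s x - g x) + f x \<bullet> (g' s x - g x)) + (f' s x - f x) \<bullet> g x + f x \<bullet> g x)"
        by (intro Bochner_Integration.integral_cong refl) (simp add: algebra_simps)
      also have "\<dots> = (LINT x|M. (f' s x - f x) \<bullet> (g' s x - g x)) + (LINT x|M. f x \<bullet> (g' s x - g x))
          + (LINT x|M. (f' s x - f x) \<bullet> g x) + (LINT x|M. f x \<bullet> g x)"
        using integrable_inner_sq[OF df dg] integrable_inner_sq[OF assms(1) dg]
          integrable_inner_sq[OF df assms(2)] integrable_inner_sq[OF assms(1,2)]
        by simp
      finally show ?case
        using integral_Cauchy_Schwarz[OF df dg] integral_Cauchy_Schwarz[OF assms(1) dg]
          integral_Cauchy_Schwarz[OF df assms(2)]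
        unfolding a_def b_def real_norm_def by linarith
    qed
  qed
  then show ?thesis
    by (rule LIM_zero_cancel)
qed

lemma l2norm_cong_AE:
  assumes "AE x in M. f x = g x" "f \<in> borel_measurable M" "g \<in> borel_measurable M"
  shows "l2norm M f = l2norm M g"
  unfolding l2norm_def
  using assms by (intro arg_cong[where f = sqrt] integral_cong_AE) auto

lemma l2norm_mono:
  assumes "sq_integrable M g" "f \<in> borel_measurable M" "AE x in M. norm (f x) \<le> c * norm (g x)" "0 \<le> c"
  shows "l2norm M f \<le> c * l2norm M g"
proof -
  have f: "sq_integrable M f"
    using assms(1-3) by (rule sq_integrable_bound)
  have "(LINT x|M. (norm (f x))\<^sup>2) \<le> (LINT x|M. c\<^sup>2 * (norm (g x))\<^sup>2)"
  proof (rule integral_mono_AE)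
    show "AE x in M. (norm (f x))\<^sup>2 \<le> c\<^sup>2 * (norm (g x))\<^sup>2"
      using assms(3)
    proof eventually_elim
      case (elim x)
      then have "(norm (f x))\<^sup>2 \<le> (c * norm (g x))\<^sup>2"
        by (intro power_mono) auto
      then show ?case
        by (simp add: power_mult_distrib)
    qed
  qed (use f assms(1) in \<open>auto simp: sq_integrable_def\<close>)
  then have "l2norm M f \<le> sqrt (c\<^sup>2 * (LINT x|M. (norm (g x))\<^sup>2))"
    unfolding l2norm_def by (intro real_sqrt_le_mono) simp
  then show ?thesis
    using assms(4) by (simp add: l2norm_def real_sqrt_mult)
qed

section \<open>Absolutely continuous functions on an interval\<close>

abbreviation interval_lebesgue :: "real \<Rightarrow> real \<Rightarrow> real measure" where
  "interval_lebesgue a b \<equiv> restrict_space lborel {a..b}"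

text \<open>
  \<open>F\<close> is an indefinite integral of \<open>f\<close>. Subintervals are cut out by indicators, so that one fixed
  measure serves all of them.
\<close>

definition abs_cont ::
  "real \<Rightarrow> real \<Rightarrow> (real \<Rightarrow> 'b::euclidean_space) \<Rightarrow> (real \<Rightarrow> 'b) \<Rightarrow> bool" where
  "abs_cont a b F f \<longleftrightarrow> integrable (interval_lebesgue a b) f \<and>
     (\<forall>x\<in>{a..b}. F x = F a + (LINT y|interval_lebesgue a b. indicat_real {..x} y *\<^sub>R f y))"

lemma finite_interval_lebesgue: "finite_measure (interval_lebesgue a b)"
  by (rule finite_measureI)
    (simp add: emeasure_restrict_space space_restrict_space emeasure_lborel_Icc_eq)

lemma borel_measurable_interval_continuous:
  assumes "continuous_on {a..b} f"
  shows "f \<in> borel_measurable (interval_lebesgue a b)"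
proof -
  have "sets (interval_lebesgue a b) = sets (restrict_space borel {a..b})"
    by (simp add: sets_restrict_space)
  from measurable_cong_sets[OF this refl] show ?thesis
    using borel_measurable_continuous_on_restrict[OF assms] by simp
qed

lemma abs_cont_integrable: "abs_cont a b F f \<Longrightarrow> integrable (interval_lebesgue a b) f"
  by (simp add: abs_cont_def)

lemma abs_contD:
  "abs_cont a b F f \<Longrightarrow> x \<in> {a..b} \<Longrightarrow>
    F x = F a + (LINT y|interval_lebesgue a b. indicat_real {..x} y *\<^sub>R f y)"
  unfolding abs_cont_def by blast

lemma abs_cont_integral:
  assumes "abs_cont a b F f" "a \<le> b"
  shows "(LINT y|interval_lebesgue a b. f y) = F b - F a"
proof -
  have "(LINT y|interval_lebesgue a b. f y) = (LINT y|interval_lebesgue a b. indicat_real {..b} y *\<^sub>R f y)"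
    by (rule Bochner_Integration.integral_cong) (auto simp: space_restrict_space indicator_def)
  moreover have "F b = F a + (LINT y|interval_lebesgue a b. indicat_real {..b} y *\<^sub>R f y)"
    by (rule abs_contD) (use assms in auto)
  ultimately show ?thesis
    by simp
qed

lemma integral_interval_indicator:
  fixes f :: "real \<Rightarrow> 'b::euclidean_space"
  assumes "integrable (interval_lebesgue a b) f" "x \<in> {a..b}"
  shows "set_integrable lborel {a..x} f"
    and "(LINT y|interval_lebesgue a b. indicat_real {..x} y *\<^sub>R f y) = integral {a..x} f"
proof -
  have "set_integrable lborel {a..b} f"
    using assms by (simp add: integrable_restrict_space set_integrable_def)
  then show *: "set_integrable lborel {a..x} f"
    by (rule set_integrable_subset) (use assms in auto)
  have "(LINT y|interval_lebesgue a b. indicat_real {..x} y *\<^sub>R f y) = (LINT y : {a..x} | lborel. f y)"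
    using assms by (auto simp: integral_restrict_space set_lebesgue_integral_def indicator_def
        intro!: Bochner_Integration.integral_cong)
  then show "(LINT y|interval_lebesgue a b. indicat_real {..x} y *\<^sub>R f y) = integral {a..x} f"
    using set_borel_integral_eq_integral(2)[OF *] by simp
qed

lemma abs_cont_eq_integral:
  assumes "abs_cont a b F f" "x \<in> {a..b}"
  shows "F a + integral {a..x} f = F x"
  using abs_contD[OF assms] integral_interval_indicator(2)[OF abs_cont_integrable[OF assms(1)] assms(2)]
  by simp

lemma abs_cont_continuous_on:
  assumes "abs_cont a b F f"
  shows "continuous_on {a..b} F"
proof (cases "a \<le> b")
  case True
  have int: "integrable (interval_lebesgue a b) f"
    using assms by (rule abs_cont_integrable)
  have "f integrable_on {a..b}"
    using set_borel_integral_eq_integral(1) integral_interval_indicator(1)[OF int, of b] True by auto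
  then have "continuous_on {a..b} (\<lambda>x. F a + integral {a..x} f)"
    by (intro continuous_intros indefinite_integral_continuous_1)
  then show ?thesis
    by (rule continuous_on_eq) (rule abs_cont_eq_integral[OF assms])
qed auto

lemma abs_cont_derivative:
  assumes F: "abs_cont a b F f" and x: "x \<in> {a<..<b}" and f: "continuous_on {a<..<b} f"
  shows "(F has_vector_derivative f x) (at x)"
proof -
  have int: "integrable (interval_lebesgue a b) f"
    using F by (rule abs_cont_integrable)
  have "f integrable_on {a..b}"
    using set_borel_integral_eq_integral(1) integral_interval_indicator(1)[OF int, of b] x by auto
  moreover have "continuous (at x within ({a..b} - {a,b})) f"
    using f x by (simp add: continuous_on_eq_continuous_within)
      (metis atLeastAtMost_diff_ends greaterThanLessThan_iff)
  ultimately have "((\<lambda>u. integral {a..u} f) has_vector_derivative f x) (at x within ({a..b} - {a,b}))"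
    by (intro integral_has_vector_derivative_continuous_at) (use x in auto)
  then have "((\<lambda>u. F a + integral {a..u} f) has_vector_derivative 0 + f x) (at x within {a<..<b})"
    by (intro derivative_intros) (simp add: atLeastAtMost_diff_ends)
  then have "((\<lambda>u. F a + integral {a..u} f) has_vector_derivative f x) (at x)"
    using x at_within_open[of x "{a<..<b}"] by auto
  then show ?thesis
    by (rule has_vector_derivative_transform_within_open[of _ _ _ "{a<..<b}"])
      (use x in \<open>auto simp: abs_cont_eq_integral[OF F]\<close>)
qed

lemma abs_contI_derivative:
  fixes F f :: "real \<Rightarrow> 'b::euclidean_space"
  assumes F: "continuous_on {a..b} F"
    and d: "\<And>x. x \<in> {a<..<b} \<Longrightarrow> (F has_vector_derivative f x) (at x)"
    and f: "integrable (interval_lebesgue a b) f"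
  shows "abs_cont a b F f"
  unfolding abs_cont_def
proof (intro conjI ballI f)
  fix x assume x: "x \<in> {a..b}"
  have "(f has_integral (F x - F a)) {a..x}"
    by (rule fundamental_theorem_of_calculus_interior)
      (use x d in \<open>auto intro: continuous_on_subset[OF F]\<close>)
  then show "F x = F a + (LINT y|interval_lebesgue a b. indicat_real {..x} y *\<^sub>R f y)"
    using integral_interval_indicator(2)[OF f x] by (simp add: integral_unique)
qed


lemma integrable_interval_indicator:
  fixes f :: "real \<Rightarrow> 'b::euclidean_space"
  assumes f: "integrable (interval_lebesgue a b) f" and S: "S \<in> sets borel"
  shows "integrable (interval_lebesgue a b) (\<lambda>y. indicat_real S y *\<^sub>R f y)"
proof (rule Bochner_Integration.integrable_bound[OF f])
  note [measurable] = borel_measurable_integrable[OF f] S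
  have [measurable]: "indicat_real S \<in> borel_measurable (interval_lebesgue a b)"
    by (intro measurable_restrict_space1) simp
  show "(\<lambda>y. indicat_real S y *\<^sub>R f y) \<in> borel_measurable (interval_lebesgue a b)"
    by measurable
qed (auto split: split_indicator)

text \<open>
  Fubini on the square \<open>[a, x]\<^sup>2\<close>: the product of the increments of \<open>F\<close> and \<open>G\<close> is the double integral of
  \<open>prod (f s) (g t)\<close>, and the two halves of the square below and above the diagonal give the two terms
  of the product rule.
\<close>

lemma abs_cont_product:
  fixes prod :: "'a::euclidean_space \<Rightarrow> 'b::euclidean_space \<Rightarrow> 'c::euclidean_space"
  assumes bil: "bounded_bilinear prod" and F: "abs_cont a b F f" and G: "abs_cont a b G g"
  shows "abs_cont a b (\<lambda>x. prod (F x) (G x)) (\<lambda>x. prod (F x) (g x) + prod (f x) (G x))"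
proof -
  interpret bounded_bilinear prod by fact
  let ?M = "interval_lebesgue a b"
  interpret M: finite_measure ?M by (rule finite_interval_lebesgue)
  interpret MM: pair_sigma_finite ?M ?M ..
  have f[measurable]: "integrable ?M f" and g[measurable]: "integrable ?M g"
    using F G by (auto intro: abs_cont_integrable)
  note [measurable] = borel_measurable_integrable[OF f] borel_measurable_integrable[OF g]
  have Fm[measurable]: "F \<in> borel_measurable ?M" and Gm[measurable]: "G \<in> borel_measurable ?M"
    using abs_cont_continuous_on F G borel_measurable_interval_continuous by blast+
  have pm[measurable]: "(\<lambda>z. prod (u z) (v z)) \<in> borel_measurable N"
    if [measurable]: "u \<in> borel_measurable N" "v \<in> borel_measurable N" for u v and N :: "'n measure"
  proof -
    have "continuous_on UNIV (\<lambda>p. prod (fst p) (snd p))"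
      by (intro continuous_on continuous_intros)
    from borel_measurable_continuous_Pair[OF that this] show ?thesis by simp
  qed
  obtain C where C: "\<And>u v. norm (prod u v) \<le> norm u * norm v * C" "0 \<le> C"
    using nonneg_bounded by (metis mult.commute)
  have bound1: "integrable ?M (\<lambda>x. prod (F x) (g x))"
  proof -
    have "bounded (F ` {a..b})"
      by (intro compact_imp_bounded compact_continuous_image abs_cont_continuous_on[OF F] compact_Icc)
    then obtain B where B: "\<And>x. x \<in> {a..b} \<Longrightarrow> norm (F x) \<le> B"
      unfolding bounded_iff by blast
    show ?thesis
    proof (rule Bochner_Integration.integrable_bound)
      show "integrable ?M (\<lambda>x. (B * C) * norm (g x))"
        using g by simp
      show "AE x in ?M. norm (prod (F x) (g x)) \<le> norm ((B * C) * norm (g x))"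
      proof (rule AE_I2)
        fix x assume "x \<in> space ?M"
        then have x: "x \<in> {a..b}" by (simp add: space_restrict_space)
        have "norm (prod (F x) (g x)) \<le> norm (F x) * norm (g x) * C"
          by (rule C)
        also have "\<dots> \<le> B * norm (g x) * C"
          using B[OF x] C(2) by (intro mult_right_mono) auto
        finally show "norm (prod (F x) (g x)) \<le> norm ((B * C) * norm (g x))"
          by (simp add: ac_simps)
      qed
    qed measurable
  qed
  have bound2: "integrable ?M (\<lambda>x. prod (f x) (G x))"
  proof -
    have "bounded (G ` {a..b})"
      by (intro compact_imp_bounded compact_continuous_image abs_cont_continuous_on[OF G] compact_Icc)
    then obtain B where B: "\<And>x. x \<in> {a..b} \<Longrightarrow> norm (G x) \<le> B"
      unfolding bounded_iff by blast
    show ?thesis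
    proof (rule Bochner_Integration.integrable_bound)
      show "integrable ?M (\<lambda>x. (B * C) * norm (f x))"
        using f by simp
      show "AE x in ?M. norm (prod (f x) (G x)) \<le> norm ((B * C) * norm (f x))"
      proof (rule AE_I2)
        fix x assume "x \<in> space ?M"
        then have x: "x \<in> {a..b}" by (simp add: space_restrict_space)
        have "norm (prod (f x) (G x)) \<le> norm (f x) * norm (G x) * C"
          by (rule C)
        also have "\<dots> \<le> norm (f x) * B * C"
          using B[OF x] C(2) by (intro mult_right_mono mult_left_mono) auto
        finally show "norm (prod (f x) (G x)) \<le> norm ((B * C) * norm (f x))"
          by (simp add: ac_simps)
      qed
    qed measurable
  qed
  have "prod (F x) (G x) = prod (F a) (G a) +
      (LINT y|?M. indicat_real {..x} y *\<^sub>R (prod (F y) (g y) + prod (f y) (G y)))" if x: "x \<in> {a..b}" for x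
  proof -
    define f1 g1 where "f1 = (\<lambda>y. indicat_real {..x} y *\<^sub>R f y)" and "g1 = (\<lambda>y. indicat_real {..x} y *\<^sub>R g y)"
    have f1: "integrable ?M f1" and g1: "integrable ?M g1"
      unfolding f1_def g1_def using integrable_interval_indicator[OF f] integrable_interval_indicator[OF g] by auto
    note [measurable] = borel_measurable_integrable[OF f1] borel_measurable_integrable[OF g1]
    have Fy: "F y = F a + (LINT t|?M. indicat_real {..y} t *\<^sub>R f1 t)" if "y \<in> {a..b}" "y \<le> x" for y
    proof -
      have "(LINT t|?M. indicat_real {..y} t *\<^sub>R f1 t) = (LINT t|?M. indicat_real {..y} t *\<^sub>R f t)"
        using that by (intro Bochner_Integration.integral_cong refl) (auto simp: f1_def indicator_def)
      with abs_contD[OF F that(1)] show ?thesis by simp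
    qed
    have Gy: "G y = G a + (LINT t|?M. indicat_real {..y} t *\<^sub>R g1 t)" if "y \<in> {a..b}" "y \<le> x" for y
    proof -
      have "(LINT t|?M. indicat_real {..y} t *\<^sub>R g1 t) = (LINT t|?M. indicat_real {..y} t *\<^sub>R g t)"
        using that by (intro Bochner_Integration.integral_cong refl) (auto simp: g1_def indicator_def)
      with abs_contD[OF G that(1)] show ?thesis by simp
    qed
    have Fx: "F x = F a + (LINT t|?M. f1 t)" and Gx: "G x = G a + (LINT t|?M. g1 t)"
      using abs_contD[OF F x] abs_contD[OF G x] unfolding f1_def g1_def by blast+
    have ip: "integrable (?M \<Otimes>\<^sub>M ?M) (\<lambda>(s, t). prod (f1 s) (g1 t))"
    proof (rule MM.Fubini_integrable)
      show "(\<lambda>(s, t). prod (f1 s) (g1 t)) \<in> borel_measurable (?M \<Otimes>\<^sub>M ?M)"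
        by measurable
      have "integrable ?M (\<lambda>s. LINT t|?M. norm (f1 s) * norm (g1 t) * C)"
        using f1 g1 by simp
      then show "integrable ?M (\<lambda>s. LINT t|?M. norm (case (s, t) of (s, t) \<Rightarrow> prod (f1 s) (g1 t)))"
      proof (rule Bochner_Integration.integrable_bound)
        show "(\<lambda>s. LINT t|?M. norm (case (s, t) of (s, t) \<Rightarrow> prod (f1 s) (g1 t))) \<in> borel_measurable ?M"
          by measurable
        have "(LINT t|?M. norm (prod (f1 s) (g1 t))) \<le> (LINT t|?M. norm (f1 s) * norm (g1 t) * C)" for s
          using g1 C by (intro integral_mono integrable_norm integrable_bounded_linear[OF bounded_linear_right]) auto
        then show "AE s in ?M. norm (LINT t|?M. norm (case (s, t) of (s, t) \<Rightarrow> prod (f1 s) (g1 t)))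
            \<le> norm (LINT t|?M. norm (f1 s) * norm (g1 t) * C)"
          by (intro AE_I2) (simp, metis (no_types, lifting) abs_ge_self order_trans)
      qed
      show "AE s in ?M. integrable ?M (\<lambda>t. case (s, t) of (s, t) \<Rightarrow> prod (f1 s) (g1 t))"
        using g1 by (auto intro!: integrable_bounded_linear[OF bounded_linear_right])
    qed
    \<comment> \<open>Split the square \<open>{a..x}\<^sup>2\<close> along its diagonal.\<close>
    define lo up where "lo = (\<lambda>(s, t). indicat_real {..s} t *\<^sub>R prod (f1 s) (g1 t))"
      and "up = (\<lambda>(s, t). indicat_real {..<t} s *\<^sub>R prod (f1 s) (g1 t))"
    have lo: "integrable (?M \<Otimes>\<^sub>M ?M) lo" and up: "integrable (?M \<Otimes>\<^sub>M ?M) up"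
    proof -
      have id: "(\<lambda>x. x) \<in> borel_measurable ?M"
        by (intro measurable_restrict_space1) simp
      have [measurable]: "(\<lambda>p. fst p) \<in> borel_measurable (?M \<Otimes>\<^sub>M ?M)"
        "(\<lambda>p. snd p) \<in> borel_measurable (?M \<Otimes>\<^sub>M ?M)"
        by (rule measurable_compose[OF measurable_fst id] measurable_compose[OF measurable_snd id])+
      have [measurable]: "(\<lambda>p. indicat_real {..fst p} (snd p)) \<in> borel_measurable (?M \<Otimes>\<^sub>M ?M)"
        "(\<lambda>p. indicat_real {..<snd p} (fst p)) \<in> borel_measurable (?M \<Otimes>\<^sub>M ?M)"
        unfolding indicator_def of_bool_def atMost_iff lessThan_iff by measurable
      show "integrable (?M \<Otimes>\<^sub>M ?M) lo" unfolding lo_def case_prod_beta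
        by (rule Bochner_Integration.integrable_bound[OF ip]) (auto simp: case_prod_beta indicator_def)
      show "integrable (?M \<Otimes>\<^sub>M ?M) up" unfolding up_def case_prod_beta
        by (rule Bochner_Integration.integrable_bound[OF ip]) (auto simp: case_prod_beta indicator_def)
    qed
    have "prod (LINT s|?M. f1 s) (LINT t|?M. g1 t) = (LINT s|?M. (LINT t|?M. prod (f1 s) (g1 t)))"
      by (simp add: integral_bounded_linear[OF bounded_linear_left f1]
          integral_bounded_linear[OF bounded_linear_right g1])
    also have "\<dots> = (LINT p|(?M \<Otimes>\<^sub>M ?M). (case p of (s, t) \<Rightarrow> prod (f1 s) (g1 t)))"
      using MM.integral_fst'[OF ip] by simp
    also have "\<dots> = (LINT p|(?M \<Otimes>\<^sub>M ?M). lo p + up p)"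
      by (intro Bochner_Integration.integral_cong refl) (auto simp: lo_def up_def indicator_def split: prod.splits)
    also have "\<dots> = (LINT p|(?M \<Otimes>\<^sub>M ?M). lo p) + (LINT p|(?M \<Otimes>\<^sub>M ?M). up p)"
      using lo up by simp
    also have "(LINT p|(?M \<Otimes>\<^sub>M ?M). lo p) = (LINT s|?M. prod (f1 s) (G s - G a))"
    proof -
      have "(LINT p|(?M \<Otimes>\<^sub>M ?M). lo p) = (LINT s|?M. (LINT t|?M. lo (s, t)))"
        using MM.integral_fst'[OF lo] by simp
      also have "\<dots> = (LINT s|?M. prod (f1 s) (G s - G a))"
      proof (intro Bochner_Integration.integral_cong refl)
        fix s assume "s \<in> space ?M"
        then have s: "s \<in> {a..b}" by (simp add: space_restrict_space)
        have "(LINT t|?M. lo (s, t)) = (LINT t|?M. prod (f1 s) (indicat_real {..s} t *\<^sub>R g1 t))"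
          by (intro Bochner_Integration.integral_cong refl) (auto simp: lo_def scaleR_right)
        also have "\<dots> = prod (f1 s) (LINT t|?M. indicat_real {..s} t *\<^sub>R g1 t)"
          using g1 by (intro integral_bounded_linear[OF bounded_linear_right] integrable_interval_indicator) auto
        also have "\<dots> = prod (f1 s) (G s - G a)"
          using Gy[OF s] by (cases "s \<le> x") (auto simp: f1_def zero_left)
        finally show "(LINT t|?M. lo (s, t)) = prod (f1 s) (G s - G a)" .
      qed
      finally show ?thesis .
    qed
    also have "(LINT p|(?M \<Otimes>\<^sub>M ?M). up p) = (LINT t|?M. prod (F t - F a) (g1 t))"
    proof -
      have "(LINT p|(?M \<Otimes>\<^sub>M ?M). up p) = (LINT t|?M. (LINT s|?M. up (s, t)))"
        using MM.integral_snd[of "\<lambda>s t. up (s, t)"] up by simp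
      also have "\<dots> = (LINT t|?M. prod (F t - F a) (g1 t))"
      proof (intro Bochner_Integration.integral_cong refl)
        fix t assume "t \<in> space ?M"
        then have t: "t \<in> {a..b}" by (simp add: space_restrict_space)
        have null: "AE s in ?M. s \<noteq> t"
          using AE_lborel_singleton[of t] by (simp add: AE_restrict_space_iff) (erule AE_mp, simp)
        have meas: "(\<lambda>s. indicat_real S s *\<^sub>R prod (f1 s) (g1 t)) \<in> borel_measurable ?M"
          if "S \<in> sets borel" for S
          by (rule borel_measurable_integrable)
            (intro integrable_interval_indicator integrable_bounded_linear[OF bounded_linear_left f1] that)
        have "(LINT s|?M. up (s, t)) = (LINT s|?M. indicat_real {..<t} s *\<^sub>R prod (f1 s) (g1 t))"
          by (simp add: up_def)
        also have "\<dots> = (LINT s|?M. indicat_real {..t} s *\<^sub>R prod (f1 s) (g1 t))"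
        proof (rule integral_cong_AE)
          show "AE s in ?M. indicat_real {..<t} s *\<^sub>R prod (f1 s) (g1 t) =
              indicat_real {..t} s *\<^sub>R prod (f1 s) (g1 t)"
            using null by eventually_elim (auto simp: indicator_def)
        qed (auto intro: meas)
        also have "\<dots> = (LINT s|?M. prod (indicat_real {..t} s *\<^sub>R f1 s) (g1 t))"
          by (simp add: scaleR_left)
        also have "\<dots> = prod (LINT s|?M. indicat_real {..t} s *\<^sub>R f1 s) (g1 t)"
          using f1 by (intro integral_bounded_linear[OF bounded_linear_left] integrable_interval_indicator) auto
        also have "\<dots> = prod (F t - F a) (g1 t)"
          using Fy[OF t] by (cases "t \<le> x") (auto simp: g1_def zero_right)
        finally show "(LINT s|?M. up (s, t)) = prod (F t - F a) (g1 t)" .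
      qed
      finally show ?thesis .
    qed
    finally have main: "prod (F x - F a) (G x - G a) =
        (LINT s|?M. prod (f1 s) (G s - G a)) + (LINT t|?M. prod (F t - F a) (g1 t))"
      using Fx Gx by simp
    have i1: "integrable ?M (\<lambda>y. prod (f1 y) (G y))" "integrable ?M (\<lambda>y. prod (F y) (g1 y))"
      using integrable_interval_indicator[OF bound2, of "{..x}"]
        integrable_interval_indicator[OF bound1, of "{..x}"]
      by (simp_all add: f1_def g1_def scaleR_left scaleR_right)
    have i2: "integrable ?M (\<lambda>y. prod (f1 y) (G a))" "integrable ?M (\<lambda>y. prod (F a) (g1 y))"
      using f1 g1 by (auto intro: integrable_bounded_linear[OF bounded_linear_left]
          integrable_bounded_linear[OF bounded_linear_right])
    have e1: "(LINT s|?M. prod (f1 s) (G s - G a)) = (LINT s|?M. prod (f1 s) (G s)) - prod (F x - F a) (G a)"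
      using i1 i2 integral_bounded_linear[OF bounded_linear_left f1, of "G a"] Fx by (simp add: diff_right)
    have e2: "(LINT s|?M. prod (F s - F a) (g1 s)) = (LINT s|?M. prod (F s) (g1 s)) - prod (F a) (G x - G a)"
      using i1 i2 integral_bounded_linear[OF bounded_linear_right g1, of "F a"] Gx by (simp add: diff_left)
    have "(LINT y|?M. indicat_real {..x} y *\<^sub>R (prod (F y) (g y) + prod (f y) (G y))) =
       (LINT y|?M. prod (F y) (g1 y) + prod (f1 y) (G y))"
      by (intro Bochner_Integration.integral_cong refl)
        (simp add: f1_def g1_def scaleR_left scaleR_right scaleR_add_right)
    also have "\<dots> = (LINT y|?M. prod (F y) (g1 y)) + (LINT y|?M. prod (f1 y) (G y))"
      using i1 by simp
    finally show ?thesis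
      using main[unfolded e1 e2] by (simp add: diff_left diff_right algebra_simps)
  qed
  then show ?thesis
    unfolding abs_cont_def using Bochner_Integration.integrable_add[OF bound1 bound2] by blast
qed


section \<open>The power nonlinearity\<close>

text \<open>
  The gradient of \<open>|z|\<^sup>q / q\<close>, with \<open>q = p + 1\<close> in the application.
\<close>

definition power_nl :: "real \<Rightarrow> complex \<Rightarrow> complex" where
  "power_nl q z = (norm z powr (q - 2)) *\<^sub>R z"

lemma powr_above_tangent:
  fixes x y q :: real
  assumes "0 \<le> x" "0 \<le> y" "1 < q"
  shows "x powr q + q * x powr (q - 1) * (y - x) \<le> y powr q"
proof -
  consider "x = 0" | "x > 0" "y = 0" | "x > 0" "y > 0"
    using assms by linarith
  then show ?thesis
  proof cases
    case 2
    have "x powr q = x powr (q - 1) * x"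
      using 2 powr_add[of x "q - 1" 1] by simp
    moreover have "0 \<le> (q - 1) * (x powr (q - 1) * x)"
      using assms by simp
    ultimately show ?thesis
      using 2 by (simp add: algebra_simps)
  next
    case 3
    have cvx: "convex_on {0<..} (\<lambda>x. x powr q)"
      by (rule powr_convex) (use assms(3) in linarith)
    have der: "((\<lambda>x. x powr q) has_field_derivative q * x powr (q - 1)) (at x within {0<..})"
      by (rule has_field_derivative_at_within, rule has_real_derivative_powr) (rule 3)
    have "x \<in> interior {0<..}" "y \<in> {0<..}"
      using 3 by (simp_all add: interior_open)
    from convex_on_imp_above_tangent[OF cvx _ this der] show ?thesis
      by simp
  qed (use assms in auto)
qed

lemma power_nl_inner_self:
  assumes "2 \<le> q"
  shows "power_nl q z \<bullet> z = norm z powr q"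
proof (cases "z = 0")
  case False
  have "norm z powr q = norm z powr (q - 2) * norm z powr 2"
    using powr_add[of "norm z" "q - 2" 2] by (simp del: powr_numeral)
  also have "norm z powr 2 = z \<bullet> z"
    using False by (simp add: power2_norm_eq_inner)
  finally show ?thesis
    by (simp add: power_nl_def)
qed (simp add: power_nl_def)

text \<open>
  Convexity of \<open>|z|\<^sup>q\<close>, reduced by the Cauchy-Schwarz inequality to the function \<open>y\<^sup>q\<close> of \<open>y = |z|\<close>.
\<close>

lemma norm_powr_above_tangent:
  assumes "2 \<le> q"
  shows "norm a powr q + q * (power_nl q a \<bullet> (b - a)) \<le> norm b powr q"
proof (cases "a = 0")
  case False
  have eq: "norm a powr (q - 1) = norm a powr (q - 2) * norm a"
    using False powr_add[of "norm a" "q - 2" 1] by simp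
  have "power_nl q a \<bullet> (b - a) = norm a powr (q - 2) * (a \<bullet> b - (norm a)\<^sup>2)"
    by (simp add: power_nl_def inner_diff_right power2_norm_eq_inner right_diff_distrib)
  also have "\<dots> \<le> norm a powr (q - 2) * (norm a * norm b - (norm a)\<^sup>2)"
    using norm_cauchy_schwarz[of a b] by (intro mult_left_mono) auto
  also have "\<dots> = norm a powr (q - 1) * (norm b - norm a)"
    unfolding eq by (simp add: algebra_simps power2_eq_square)
  finally have "q * (power_nl q a \<bullet> (b - a)) \<le> q * norm a powr (q - 1) * (norm b - norm a)"
    using assms by (simp add: mult.assoc)
  moreover have "norm a powr q + q * norm a powr (q - 1) * (norm b - norm a) \<le> norm b powr q"
    using assms by (intro powr_above_tangent) auto
  ultimately show ?thesis by linarith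
qed (simp add: power_nl_def)

lemma norm_powr_below_tangent:
  assumes "2 \<le> q"
  shows "norm b powr q \<le> norm a powr q + q * (power_nl q b \<bullet> (b - a))"
  using norm_powr_above_tangent[OF assms, of b a] by (simp add: algebra_simps)

lemma continuous_on_power_nl:
  assumes "2 < q"
  shows "continuous_on S (power_nl q)"
  unfolding power_nl_def using assms by (intro continuous_intros continuous_on_powr') auto

text \<open>
  By convexity the remainder at \<open>b\<close> lies between 0 and the increment of the gradient times \<open>b - a\<close>.
  This includes \<open>a = 0\<close>, where the norm is not differentiable.
\<close>

lemma norm_powr_has_derivative:
  assumes "2 < q"
  shows "((\<lambda>z::complex. norm z powr q) has_derivative (\<lambda>w. q * (power_nl q a \<bullet> w))) (at a)"
  unfolding has_derivative_iff_norm
proof (intro conjI)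
  show "bounded_linear (\<lambda>w. q * (power_nl q a \<bullet> w))"
    by (intro bounded_linear_const_mult bounded_linear_inner_right)
  have "((\<lambda>b. q * norm (power_nl q b - power_nl q a)) \<longlongrightarrow> q * norm (power_nl q a - power_nl q a)) (at a)"
    using continuous_on_power_nl[OF assms, of UNIV]
    by (intro tendsto_intros) (auto simp: continuous_on_def)
  then have lim: "((\<lambda>b. q * norm (power_nl q b - power_nl q a)) \<longlongrightarrow> 0) (at a)"
    by simp
  show "((\<lambda>b. norm (norm b powr q - norm a powr q - q * (power_nl q a \<bullet> (b - a))) / norm (b - a)) \<longlongrightarrow> 0) (at a)"
  proof (rule Lim_null_comparison[OF _ lim])
    have "norm (norm (norm b powr q - norm a powr q - q * (power_nl q a \<bullet> (b - a))) / norm (b - a))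
        \<le> q * norm (power_nl q b - power_nl q a)" if "b \<noteq> a" for b
    proof -
      let ?r = "norm b powr q - norm a powr q - q * (power_nl q a \<bullet> (b - a))"
      have "0 \<le> ?r"
        using norm_powr_above_tangent[of q a b] assms by simp
      moreover have "?r \<le> q * ((power_nl q b - power_nl q a) \<bullet> (b - a))"
        using norm_powr_below_tangent[of q b a] assms by (simp add: inner_diff_left algebra_simps)
      moreover have "q * ((power_nl q b - power_nl q a) \<bullet> (b - a)) \<le> q * (norm (power_nl q b - power_nl q a) * norm (b - a))"
        using assms by (intro mult_left_mono norm_cauchy_schwarz) auto
      ultimately show ?thesis
        using that by (simp add: divide_le_eq mult.assoc)
    qed
    then show "\<forall>\<^sub>F b in at a. norm (norm (norm b powr q - norm a powr q - q * (power_nl q a \<bullet> (b - a))) / norm (b - a))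
        \<le> q * norm (power_nl q b - power_nl q a)"
      by (auto simp: eventually_at_filter)
  qed
qed

section \<open>Radial profiles on a hemisphere\<close>

text \<open>
  The coordinate is the height \<open>z \<in> [0, 1]\<close>, with the equator at 0 and the pole at 1. Everything is
  expressed through the Laplacian \<open>l\<close> of the profile: \<open>flux l\<close> is \<open>(1 - z\<^sup>2) h'\<close> normalised to vanish at the
  pole, \<open>profile l\<close> is the solution \<open>h\<close> of the Dirichlet problem on the hemisphere, and \<open>virial_field l\<close> is
  \<open>(1 - z) h'\<close>, the derivative of the profile along the field generated by the virial weight.
\<close>

abbreviation hemi :: "real measure" where
  "hemi \<equiv> interval_lebesgue 0 1"

definition flux :: "(real \<Rightarrow> complex) \<Rightarrow> real \<Rightarrow> complex" where
  "flux l z = - (LINT y|hemi. indicat_real {z<..} y *\<^sub>R l y)"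

definition profile_deriv :: "(real \<Rightarrow> complex) \<Rightarrow> real \<Rightarrow> complex" where
  "profile_deriv l z = flux l z /\<^sub>R (1 - z\<^sup>2)"

definition profile :: "(real \<Rightarrow> complex) \<Rightarrow> real \<Rightarrow> complex" where
  "profile l z = (LINT y|hemi. indicat_real {..z} y *\<^sub>R profile_deriv l y)"

definition virial_field :: "(real \<Rightarrow> complex) \<Rightarrow> real \<Rightarrow> complex" where
  "virial_field l z = flux l z /\<^sub>R (1 + z)"

lemma space_hemi [simp]: "space hemi = {0..1}"
  by (simp add: space_restrict_space)

lemma AE_interval_lebesgue_neq: "AE y in interval_lebesgue a b. y \<noteq> c"
  using AE_lborel_singleton[of c] by (subst AE_restrict_space_iff) (auto elim: eventually_mono)

lemma integral_unit_initial_point: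
  "(LINT y|hemi. indicat_real {..0} y *\<^sub>R (f y :: 'b::euclidean_space)) = 0"
proof (rule integral_eq_zero_AE)
  show "AE y in hemi. indicat_real {..0} y *\<^sub>R f y = 0"
    using AE_interval_lebesgue_neq[of 0 0 1] AE_space[of hemi]
    by eventually_elim (auto simp: indicator_def)
qed

lemma sq_integrable_imp_integrable: "sq_integrable (interval_lebesgue a b) f \<Longrightarrow> integrable (interval_lebesgue a b) f"
  by (rule integrable_sq_integrable[OF finite_interval_lebesgue])

lemma abs_cont_flux:
  assumes "sq_integrable hemi l"
  shows "abs_cont 0 1 (flux l) l"
  unfolding abs_cont_def
proof (intro conjI ballI)
  show l: "integrable hemi l"
    using assms by (rule sq_integrable_imp_integrable)
  have split: "(LINT y|hemi. indicat_real {..x} y *\<^sub>R l y) = (LINT y|hemi. l y) + flux l x" for x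
  proof -
    have "(LINT y|hemi. l y) =
        (LINT y|hemi. indicat_real {..x} y *\<^sub>R l y + indicat_real {x<..} y *\<^sub>R l y)"
      by (rule Bochner_Integration.integral_cong) (auto simp: indicator_def)
    also have "\<dots> = (LINT y|hemi. indicat_real {..x} y *\<^sub>R l y) - flux l x"
      unfolding flux_def by (simp add: integrable_interval_indicator[OF l])
    finally show ?thesis by simp
  qed
  fix x
  show "flux l x = flux l 0 + (LINT y|hemi. indicat_real {..x} y *\<^sub>R l y)"
    using split[of x] split[of 0] integral_unit_initial_point[of l] by (simp add: add.commute)
qed

lemma flux_1 [simp]: "flux l 1 = 0"
proof -
  have "(LINT y|hemi. indicat_real {1<..} y *\<^sub>R l y) = (LINT y|hemi. 0)"
    by (rule Bochner_Integration.integral_cong) (auto simp: indicator_def)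
  then show ?thesis by (simp add: flux_def)
qed

text \<open>
  Cauchy-Schwarz on \<open>(z, 1]\<close>. The decay at the pole compensates the degeneracy of \<open>1 - z\<^sup>2\<close> there and
  makes the derivative of the profile integrable.
\<close>

lemma flux_bound:
  assumes l: "sq_integrable hemi l" and z: "z \<in> {0..1}"
  shows "norm (flux l z) \<le> sqrt (1 - z) * l2norm hemi l"
proof -
  have ind: "indicat_real {z<..} \<in> borel_measurable hemi"
    by (intro measurable_restrict_space1) simp
  have sq: "sq_integrable hemi (indicat_real {z<..})"
    by (rule sq_integrable_bounded[OF finite_interval_lebesgue ind, of 1]) (auto split: split_indicator)
  have "l2norm hemi (indicat_real {z<..}) = sqrt (1 - z)"
  proof -
    have "(LINT y|hemi. (norm (indicat_real {z<..} y))\<^sup>2) = (LINT y|lborel. indicat_real {z<..1} y)"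
      by (subst integral_restrict_space, simp, rule Bochner_Integration.integral_cong)
        (use z in \<open>auto simp: indicator_def\<close>)
    also have "\<dots> = 1 - z"
      using z by simp
    finally show ?thesis by (simp add: l2norm_def)
  qed
  moreover have "norm (flux l z) \<le> (LINT y|hemi. norm (indicat_real {z<..} y *\<^sub>R l y))"
    unfolding flux_def norm_minus_cancel by (rule integral_norm_bound)
  moreover have "\<dots> = (LINT y|hemi. indicat_real {z<..} y \<bullet> norm (l y))"
    by simp
  moreover have "\<dots> \<le> l2norm hemi (indicat_real {z<..}) * l2norm hemi (\<lambda>y. norm (l y))"
    using integral_Cauchy_Schwarz[OF sq sq_integrable_norm[OF l]] by linarith
  moreover have "l2norm hemi (\<lambda>y. norm (l y)) = l2norm hemi l"
    by (simp add: l2norm_def)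
  ultimately show ?thesis by simp
qed

lemma profile_deriv_bound:
  assumes l: "sq_integrable hemi l" and z: "z \<in> {0..<1}"
  shows "norm (profile_deriv l z) \<le> l2norm hemi l * (1 / sqrt (1 - z))"
proof -
  have pos: "0 < 1 - z" "0 < sqrt (1 - z)" "1 - z \<le> 1 - z\<^sup>2"
    using z by (auto simp: power2_eq_square mult_left_le)
  have "norm (profile_deriv l z) = norm (flux l z) / (1 - z\<^sup>2)"
    using pos by (simp add: profile_deriv_def divide_inverse_commute)
  also have "\<dots> \<le> (sqrt (1 - z) * l2norm hemi l) / (1 - z)"
    using flux_bound[OF l, of z] z pos by (intro frac_le) auto
  also have "\<dots> = l2norm hemi l * (1 / sqrt (1 - z))"
    using sqrt_divide_self_eq[of "1 - z"] pos by (simp add: divide_inverse)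
  finally show ?thesis .
qed

lemma integrable_inverse_sqrt:
  "integrable hemi (\<lambda>z. 1 / sqrt (1 - z))"
  "(LINT z|hemi. 1 / sqrt (1 - z)) = 2"
proof -
  have lim: "((\<lambda>z. - 2 * sqrt (1 - z)) \<longlongrightarrow> - 2 * sqrt (1 - c)) F" if "((\<lambda>z. z) \<longlongrightarrow> c) F" for c :: real and F
    by (intro tendsto_intros that)
  have "set_integrable lborel (einterval 0 1) (\<lambda>z. 1 / sqrt (1 - z))"
  proof (rule interval_integral_FTC_nonneg(1)[where F = "\<lambda>z. - 2 * sqrt (1 - z)" and A = "-2" and B = 0])
    show "DERIV (\<lambda>z. - 2 * sqrt (1 - z)) x :> 1 / sqrt (1 - x)" if "0 < ereal x" "ereal x < 1" for x
      using that by (auto intro!: derivative_eq_intros simp: one_ereal_def divide_simps)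
    show "isCont (\<lambda>z. 1 / sqrt (1 - z)) x" if "0 < ereal x" "ereal x < 1" for x
      using that by (auto intro!: continuous_intros simp: one_ereal_def)
    show "(((\<lambda>z. - 2 * sqrt (1 - z)) \<circ> real_of_ereal) \<longlongrightarrow> - 2) (at_right 0)"
      using lim[of 0 "at_right 0"] by (simp add: zero_ereal_def ereal_tendsto_simps)
    show "(((\<lambda>z. - 2 * sqrt (1 - z)) \<circ> real_of_ereal) \<longlongrightarrow> 0) (at_left 1)"
      using lim[of 1 "at_left 1"] by (simp add: one_ereal_def ereal_tendsto_simps)
  qed (auto simp: one_ereal_def)
  then have "set_integrable lborel {0<..<1} (\<lambda>z. 1 / sqrt (1 - z))"
    by (simp add: zero_ereal_def one_ereal_def)
  then have "set_integrable lborel {0..1} (\<lambda>z. 1 / sqrt (1 - z))"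
    by (subst set_integrable_discrete_difference[where X = "{0, 1}" and B = "{0<..<1}"]) auto
  then show int: "integrable hemi (\<lambda>z. 1 / sqrt (1 - z))"
    by (simp add: integrable_restrict_space set_integrable_def)
  have "abs_cont 0 1 (\<lambda>z. - 2 * sqrt (1 - z)) (\<lambda>z. 1 / sqrt (1 - z))"
    by (rule abs_contI_derivative[OF _ _ int])
      (auto intro!: continuous_intros derivative_eq_intros
        simp: has_real_derivative_iff_has_vector_derivative[symmetric] divide_simps)
  then show "(LINT z|hemi. 1 / sqrt (1 - z)) = 2"
    using abs_cont_integral by fastforce
qed

lemma abs_cont_continuous_flux:
  "sq_integrable hemi l \<Longrightarrow> continuous_on {0..1} (flux l)"
  using abs_cont_continuous_on[OF abs_cont_flux] .

lemma one_minus_square_pos: "0 \<le> z \<Longrightarrow> z < 1 \<Longrightarrow> 0 < 1 - z\<^sup>2" for z :: real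
  by (simp add: power_less_one_iff abs_square_less_1)

lemma borel_measurable_profile_deriv:
  assumes "sq_integrable hemi l"
  shows "profile_deriv l \<in> borel_measurable hemi"
proof -
  note [measurable] = borel_measurable_interval_continuous[OF abs_cont_continuous_flux[OF assms]]
  have [measurable]: "(\<lambda>z. 1 - z\<^sup>2) \<in> borel_measurable hemi"
    by (intro borel_measurable_interval_continuous continuous_intros)
  show ?thesis
    unfolding profile_deriv_def by measurable
qed

lemma integrable_profile_deriv:
  assumes l: "sq_integrable hemi l"
  shows "integrable hemi (profile_deriv l)"
proof (rule Bochner_Integration.integrable_bound)
  show "integrable hemi (\<lambda>z. l2norm hemi l * (1 / sqrt (1 - z)))"
    by (intro integrable_mult_right integrable_inverse_sqrt)
  show "profile_deriv l \<in> borel_measurable hemi"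
    by (rule borel_measurable_profile_deriv[OF l])
  show "AE z in hemi. norm (profile_deriv l z) \<le> norm (l2norm hemi l * (1 / sqrt (1 - z)))"
    using AE_interval_lebesgue_neq[of 1 0 1] AE_space[of hemi]
  proof eventually_elim
    case (elim z)
    then have "norm (profile_deriv l z) \<le> l2norm hemi l * (1 / sqrt (1 - z))"
      by (intro profile_deriv_bound[OF l]) auto
    also have "\<dots> \<le> norm (l2norm hemi l * (1 / sqrt (1 - z)))"
      by (simp only: real_norm_def abs_ge_self)
    finally show ?case .
  qed
qed

lemma profile_0 [simp]: "profile l 0 = 0"
  by (simp add: profile_def integral_unit_initial_point)

lemma abs_cont_profile:
  assumes "sq_integrable hemi l"
  shows "abs_cont 0 1 (profile l) (profile_deriv l)"
  unfolding abs_cont_def using integrable_profile_deriv[OF assms] by (simp add: profile_def[symmetric])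

lemma continuous_on_profile:
  "sq_integrable hemi l \<Longrightarrow> continuous_on {0..1} (profile l)"
  using abs_cont_continuous_on[OF abs_cont_profile] .

lemma profile_bound:
  assumes l: "sq_integrable hemi l"
  shows "norm (profile l z) \<le> 2 * l2norm hemi l"
proof -
  have "norm (profile l z) \<le> (LINT y|hemi. norm (indicat_real {..z} y *\<^sub>R profile_deriv l y))"
    unfolding profile_def by (rule integral_norm_bound)
  also have "\<dots> \<le> (LINT y|hemi. l2norm hemi l * (1 / sqrt (1 - y)))"
  proof (rule integral_mono_AE)
    show "integrable hemi (\<lambda>y. norm (indicat_real {..z} y *\<^sub>R profile_deriv l y))"
      by (intro integrable_norm integrable_interval_indicator integrable_profile_deriv l) simp
    show "integrable hemi (\<lambda>z. l2norm hemi l * (1 / sqrt (1 - z)))"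
      by (intro integrable_mult_right integrable_inverse_sqrt)
    show "AE y in hemi. norm (indicat_real {..z} y *\<^sub>R profile_deriv l y)
        \<le> l2norm hemi l * (1 / sqrt (1 - y))"
      using AE_interval_lebesgue_neq[of 1 0 1] AE_space[of hemi]
    proof eventually_elim
      case (elim y)
      then have y: "y \<in> {0..<1}" by auto
      have "norm (indicat_real {..z} y *\<^sub>R profile_deriv l y) \<le> norm (profile_deriv l y)"
        by (auto split: split_indicator)
      also have "\<dots> \<le> l2norm hemi l * (1 / sqrt (1 - y))"
        by (rule profile_deriv_bound[OF l y])
      finally show ?case .
    qed
  qed
  also have "\<dots> = 2 * l2norm hemi l"
    using integrable_inverse_sqrt(2) by (subst integral_mult_right_zero) simp
  finally show ?thesis .
qed

lemma flux_diff:
  assumes "sq_integrable hemi l" "sq_integrable hemi m"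
  shows "flux (\<lambda>y. l y - m y) z = flux l z - flux m z"
  unfolding flux_def
  using integrable_interval_indicator[OF sq_integrable_imp_integrable[OF assms(1)], of "{z<..}"]
    integrable_interval_indicator[OF sq_integrable_imp_integrable[OF assms(2)], of "{z<..}"]
  by (simp add: scaleR_diff_right)

lemma profile_deriv_diff:
  assumes "sq_integrable hemi l" "sq_integrable hemi m"
  shows "profile_deriv (\<lambda>y. l y - m y) z = profile_deriv l z - profile_deriv m z"
  unfolding profile_deriv_def flux_diff[OF assms] by (simp add: scaleR_diff_right)

lemma profile_diff:
  assumes "sq_integrable hemi l" "sq_integrable hemi m"
  shows "profile (\<lambda>y. l y - m y) z = profile l z - profile m z"
  unfolding profile_def profile_deriv_diff[OF assms]
  using integrable_interval_indicator[OF integrable_profile_deriv[OF assms(1)], of "{..z}"]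
    integrable_interval_indicator[OF integrable_profile_deriv[OF assms(2)], of "{..z}"]
  by (simp add: scaleR_diff_right)

lemma virial_field_diff:
  assumes "sq_integrable hemi l" "sq_integrable hemi m"
  shows "virial_field (\<lambda>y. l y - m y) z = virial_field l z - virial_field m z"
  unfolding virial_field_def flux_diff[OF assms] by (simp add: scaleR_diff_right)

text \<open>
  Uniform bounds by the norm of \<open>l\<close>, applied to differences, turn continuity in time of the Laplacian
  into uniform convergence of the fields.
\<close>

lemma virial_field_bound:
  assumes l: "sq_integrable hemi l" and z: "z \<in> {0..1}"
  shows "norm (virial_field l z) \<le> l2norm hemi l"
proof -
  have "norm (virial_field l z) = norm (flux l z) / (1 + z)"
    using z by (simp add: virial_field_def divide_inverse_commute)
  also have "\<dots> \<le> norm (flux l z) / 1"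
    using z by (intro divide_left_mono) auto
  also have "\<dots> \<le> sqrt (1 - z) * l2norm hemi l"
    using flux_bound[OF l z] by simp
  also have "\<dots> \<le> 1 * l2norm hemi l"
    using z by (intro mult_right_mono) auto
  finally show ?thesis by simp
qed

lemma virial_field_eq:
  assumes "z \<in> {0..1}"
  shows "virial_field l z = (1 - z) *\<^sub>R profile_deriv l z"
proof (cases "z = 1")
  case False
  then have "(1 - z) / (1 - z\<^sup>2) = 1 / (1 + z)"
    using assms one_minus_square_pos[of z] by (simp add: field_simps power2_eq_square)
  then show ?thesis
    by (simp add: virial_field_def profile_deriv_def divide_inverse)
qed (simp add: virial_field_def)

lemma sq_integrable_continuous:
  fixes f :: "real \<Rightarrow> 'b::euclidean_space"
  assumes "continuous_on {a..b} f"
  shows "sq_integrable (interval_lebesgue a b) f"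
proof -
  have "bounded (f ` {a..b})"
    by (intro compact_imp_bounded compact_continuous_image assms compact_Icc)
  then obtain B where "\<And>x. x \<in> {a..b} \<Longrightarrow> norm (f x) \<le> B"
    unfolding bounded_iff by blast
  then show ?thesis
    by (intro sq_integrable_bounded[OF finite_interval_lebesgue borel_measurable_interval_continuous[OF assms], of B])
      (auto intro!: AE_I2 simp: space_restrict_space)
qed

lemma continuous_on_virial_field:
  assumes "sq_integrable hemi l"
  shows "continuous_on {0..1} (virial_field l)"
  unfolding virial_field_def using abs_cont_continuous_flux[OF assms]
  by (intro continuous_intros) auto

lemmas sq_integrable_profile = sq_integrable_continuous[OF continuous_on_profile]
  and sq_integrable_virial_field = sq_integrable_continuous[OF continuous_on_virial_field]


section \<open>Integral identities for radial profiles\<close>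

lemma bounded_bilinear_imaginary_inner: "bounded_bilinear (\<lambda>x y :: complex. (\<i> * x) \<bullet> y)"
  using bounded_bilinear.comp1[OF bounded_bilinear_inner bounded_linear_mult_right[of \<i>]] .

text \<open>
  For complex numbers \<open>a \<bullet> b = Re (cnj a b)\<close> and \<open>(\<i> a) \<bullet> b = Im (cnj a b)\<close>.
\<close>

lemma imaginary_inner_self [simp]: "(\<i> * a) \<bullet> (a :: complex) = 0"
  by (simp add: inner_complex_def)

lemma imaginary_inner_swap: "(\<i> * a) \<bullet> b = - ((\<i> * b) \<bullet> (a :: complex))"
  by (simp add: inner_complex_def)

lemma abs_contI_C1:
  fixes F f :: "real \<Rightarrow> 'b::euclidean_space"
  assumes "\<And>x. x \<in> {a..b} \<Longrightarrow> (F has_vector_derivative f x) (at x)" and f: "continuous_on {a..b} f"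
  shows "abs_cont a b F f"
proof (rule abs_contI_derivative)
  show "continuous_on {a..b} F"
    using assms(1) has_vector_derivative_continuous continuous_at_imp_continuous_on by blast
  show "integrable (interval_lebesgue a b) f"
    by (intro sq_integrable_imp_integrable sq_integrable_continuous f)
qed (use assms in auto)

text \<open>
  Integration by parts: once one of the two terms of a product rule is known to be integrable, so is
  the other one.
\<close>

lemma abs_cont_integral_split:
  assumes "abs_cont a b F f" "a \<le> b"
    and "\<And>x. x \<in> {a..b} \<Longrightarrow> f x = g x + h x" and g: "integrable (interval_lebesgue a b) g"
  shows "integrable (interval_lebesgue a b) h"
    and "F b - F a = (LINT x|interval_lebesgue a b. g x) + (LINT x|interval_lebesgue a b. h x)"
proof -
  have f: "integrable (interval_lebesgue a b) f"
    using assms(1) by (rule abs_cont_integrable)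
  have "integrable (interval_lebesgue a b) (\<lambda>x. f x - g x)"
    using f g by simp
  then show h: "integrable (interval_lebesgue a b) h"
    by (rule Bochner_Integration.integrable_cong[OF refl, THEN iffD1, rotated])
      (simp add: assms(3) space_restrict_space)
  have "F b - F a = (LINT x|interval_lebesgue a b. f x)"
    using abs_cont_integral[OF assms(1,2)] by simp
  also have "\<dots> = (LINT x|interval_lebesgue a b. g x + h x)"
    by (rule Bochner_Integration.integral_cong) (auto simp: assms(3) space_restrict_space)
  also have "\<dots> = (LINT x|interval_lebesgue a b. g x) + (LINT x|interval_lebesgue a b. h x)"
    using g h by simp
  finally show "F b - F a = (LINT x|interval_lebesgue a b. g x) + (LINT x|interval_lebesgue a b. h x)" .
qed

definition dirichlet_energy :: "(real \<Rightarrow> complex) \<Rightarrow> real" where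
  "dirichlet_energy l = (LINT z|hemi. flux l z \<bullet> profile_deriv l z)"

text \<open>
  There are no boundary terms: the flux vanishes at the pole and the profile at the equator.
\<close>

lemma green_identity:
  assumes l: "sq_integrable hemi l" and m: "sq_integrable hemi m"
  shows "integrable hemi (\<lambda>z. flux l z \<bullet> profile_deriv m z)"
    and "(LINT z|hemi. l z \<bullet> profile m z) = - (LINT z|hemi. flux l z \<bullet> profile_deriv m z)"
proof -
  have ac: "abs_cont 0 1 (\<lambda>z. flux l z \<bullet> profile m z)
      (\<lambda>z. flux l z \<bullet> profile_deriv m z + l z \<bullet> profile m z)"
    by (rule abs_cont_product[OF bounded_bilinear_inner abs_cont_flux[OF l] abs_cont_profile[OF m]])
  note split = abs_cont_integral_split[OF ac, of "\<lambda>z. l z \<bullet> profile m z" "\<lambda>z. flux l z \<bullet> profile_deriv m z"]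
  note int = integrable_inner_sq[OF l sq_integrable_profile[OF m]]
  show "integrable hemi (\<lambda>z. flux l z \<bullet> profile_deriv m z)"
    using int by (intro split) auto
  show "(LINT z|hemi. l z \<bullet> profile m z) = - (LINT z|hemi. flux l z \<bullet> profile_deriv m z)"
    using split(2) int by simp
qed

lemma integral_laplacian_profile:
  assumes "sq_integrable hemi l"
  shows "(LINT z|hemi. l z \<bullet> profile l z) = - dirichlet_energy l"
  using green_identity(2)[OF assms assms] by (simp add: dirichlet_energy_def)

lemma green_symmetric:
  assumes l: "sq_integrable hemi l" and m: "sq_integrable hemi m"
  shows "(LINT z|hemi. l z \<bullet> profile m z) = (LINT z|hemi. m z \<bullet> profile l z)"
  unfolding green_identity(2)[OF l m] green_identity(2)[OF m l]
  by (simp add: profile_deriv_def inner_commute)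

text \<open>
  The radial function with Laplacian 1 that is smooth at the pole: \<open>(1 - z\<^sup>2) \<phi>' = - (1 - z)\<close>.
\<close>

definition virial_weight :: "real \<Rightarrow> real" where
  "virial_weight z = ln 2 - ln (1 + z)"

lemma abs_cont_virial_weight: "abs_cont 0 1 virial_weight (\<lambda>z. - inverse (1 + z))"
proof (rule abs_contI_C1)
  fix x :: real assume "x \<in> {0..1}"
  then show "(virial_weight has_vector_derivative - inverse (1 + x)) (at x)"
    unfolding virial_weight_def has_real_derivative_iff_has_vector_derivative[symmetric]
    by (auto intro!: derivative_eq_intros simp: divide_simps)
qed (auto intro!: continuous_intros)

lemma virial_weight_bounds:
  assumes "z \<in> {0..1}"
  shows "0 \<le> virial_weight z" "virial_weight z \<le> ln 2"
  using assms by (auto simp: virial_weight_def)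

text \<open>
  Half the time derivative of the weighted mass: the term with \<open>\<phi> h'\<close> drops out, because \<open>h'\<close> is a real
  multiple of the flux, and only \<open>\<phi>' = - 1 / (1 + z)\<close> survives.
\<close>

lemma mass_flux_identity:
  assumes l: "sq_integrable hemi l"
  shows "(LINT z|hemi. (virial_weight z *\<^sub>R (\<i> * profile l z)) \<bullet> l z) =
    (LINT z|hemi. (\<i> * profile l z) \<bullet> virial_field l z)"
proof -
  note wp = abs_cont_product[OF bounded_bilinear_scaleR abs_cont_virial_weight abs_cont_profile[OF l]]
  note ac = abs_cont_product[OF bounded_bilinear_imaginary_inner wp abs_cont_flux[OF l]]
  have field: "(\<i> * (virial_weight z *\<^sub>R profile_deriv l z + - inverse (1 + z) *\<^sub>R profile l z)) \<bullet> flux l z =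
      - ((\<i> * profile l z) \<bullet> virial_field l z)" for z
    by (simp add: profile_deriv_def virial_field_def ring_distribs inner_add_left inner_diff_left)
  have sq: "sq_integrable hemi (\<lambda>z. - (\<i> * profile l z))"
    using sq_integrable_cmult[OF sq_integrable_profile[OF l], of "-\<i>"] by simp
  have "(\<i> * (virial_weight 1 *\<^sub>R profile l 1)) \<bullet> flux l 1 - (\<i> * (virial_weight 0 *\<^sub>R profile l 0)) \<bullet> flux l 0 =
      (LINT z|hemi. - (\<i> * profile l z) \<bullet> virial_field l z)
      + (LINT z|hemi. (virial_weight z *\<^sub>R (\<i> * profile l z)) \<bullet> l z)"
    by (rule abs_cont_integral_split(2)[OF ac])
      (use integrable_inner_sq[OF sq sq_integrable_virial_field[OF l]] field in \<open>auto simp: ac_simps\<close>)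
  then show ?thesis
    by simp
qed

lemma abs_cont_one_minus: "abs_cont 0 1 (\<lambda>z. 1 - z) (\<lambda>z. - 1 :: real)"
  by (rule abs_contI_C1)
    (auto intro!: derivative_eq_intros simp: has_real_derivative_iff_has_vector_derivative[symmetric])

text \<open>
  Integrating \<open>((1 - z) Im (cnj h w))'\<close> exchanges the roles of \<open>h\<close> and \<open>w\<close>. With \<open>w\<close> the increment of \<open>h\<close> in
  time, the right-hand side involves \<open>w\<close> only in \<open>L\<^sup>2\<close>, which makes the momentum differentiable in time.
\<close>

lemma momentum_swap:
  assumes l: "sq_integrable hemi l" and m: "sq_integrable hemi m"
  shows "(LINT z|hemi. (\<i> * profile l z) \<bullet> virial_field m z) =
    (LINT z|hemi. (\<i> * profile m z) \<bullet> virial_field l z)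
    + (LINT z|hemi. (\<i> * profile l z) \<bullet> profile m z)"
proof -
  note wp = abs_cont_product[OF bounded_bilinear_scaleR abs_cont_one_minus abs_cont_profile[OF l]]
  note ac = abs_cont_product[OF bounded_bilinear_imaginary_inner wp abs_cont_profile[OF m]]
  note sq = sq_integrable_cmult[OF sq_integrable_profile, of _ \<i>]
  have int: "integrable hemi (\<lambda>z. (\<i> * profile l z) \<bullet> virial_field m z)"
    "integrable hemi (\<lambda>z. (\<i> * profile m z) \<bullet> virial_field l z)"
    "integrable hemi (\<lambda>z. (\<i> * profile l z) \<bullet> profile m z)"
    using l m by (auto intro!: integrable_inner_sq sq sq_integrable_virial_field sq_integrable_profile)
  have pointwise: "(\<i> * ((1 - z) *\<^sub>R profile l z)) \<bullet> profile_deriv m z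
      + (\<i> * ((1 - z) *\<^sub>R profile_deriv l z + (- 1) *\<^sub>R profile l z)) \<bullet> profile m z
      = (\<i> * profile l z) \<bullet> virial_field m z
        + (- ((\<i> * profile m z) \<bullet> virial_field l z) - (\<i> * profile l z) \<bullet> profile m z)"
    if "z \<in> {0..1}" for z
    using imaginary_inner_swap[of "profile_deriv l z" "profile m z"]
    by (simp add: virial_field_eq[OF that] ring_distribs inner_add_left inner_diff_left)
  have "(\<i> * ((1 - 1) *\<^sub>R profile l 1)) \<bullet> profile m 1 - (\<i> * ((1 - 0) *\<^sub>R profile l 0)) \<bullet> profile m 0 =
      (LINT z|hemi. (\<i> * profile l z) \<bullet> virial_field m z)
      + (LINT z|hemi. - ((\<i> * profile m z) \<bullet> virial_field l z) - (\<i> * profile l z) \<bullet> profile m z)"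
    by (rule abs_cont_integral_split(2)[OF ac]) (use int pointwise in auto)
  then show ?thesis
    using int by simp
qed

text \<open>
  The integral of the derivative of \<open>|K|\<^sup>2 / (1 + z)\<close>, where \<open>K\<close> is the flux. The boundary term at the
  equator has a sign.
\<close>

lemma pohozaev_laplacian:
  assumes l: "sq_integrable hemi l"
  shows "2 * (LINT z|hemi. l z \<bullet> virial_field l z) =
    (LINT z|hemi. (norm (virial_field l z))\<^sup>2) - (norm (flux l 0))\<^sup>2"
proof -
  have inv: "abs_cont 0 1 (\<lambda>z. inverse (1 + z)) (\<lambda>z :: real. - (inverse (1 + z))\<^sup>2)"
  proof (rule abs_contI_C1)
    fix x :: real assume "x \<in> {0..1}"
    then show "((\<lambda>z. inverse (1 + z)) has_vector_derivative - (inverse (1 + x))\<^sup>2) (at x)"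
      unfolding has_real_derivative_iff_has_vector_derivative[symmetric]
      by (auto intro!: derivative_eq_intros simp: power2_eq_square)
  qed (auto intro!: continuous_intros)
  note wp = abs_cont_product[OF bounded_bilinear_scaleR inv abs_cont_flux[OF l]]
  note ac = abs_cont_product[OF bounded_bilinear_inner abs_cont_flux[OF l] wp]
  have "flux l 1 \<bullet> (inverse (1 + 1) *\<^sub>R flux l 1) - flux l 0 \<bullet> (inverse (1 + 0) *\<^sub>R flux l 0) =
     (LINT z|hemi. 2 * (l z \<bullet> virial_field l z))
     + (LINT z|hemi. - (norm (virial_field l z))\<^sup>2)"
  proof (rule abs_cont_integral_split(2)[OF ac])
    show "integrable hemi (\<lambda>z. 2 * (l z \<bullet> virial_field l z))"
      by (intro integrable_mult_right integrable_inner_sq l sq_integrable_virial_field)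
    show "flux l z \<bullet> (inverse (1 + z) *\<^sub>R l z + - (inverse (1 + z))\<^sup>2 *\<^sub>R flux l z)
        + l z \<bullet> (inverse (1 + z) *\<^sub>R flux l z) =
        2 * (l z \<bullet> virial_field l z) + - (norm (virial_field l z))\<^sup>2" for z
      by (simp only: power2_norm_eq_inner)
        (simp add: virial_field_def inner_diff_right inner_commute power2_eq_square)
  qed simp
  then show ?thesis
    by (simp add: power2_norm_eq_inner)
qed

lemma abs_cont_norm_powr_profile:
  assumes l: "sq_integrable hemi l" and q: "2 < q"
  shows "abs_cont 0 1 (\<lambda>z. norm (profile l z) powr q)
    (\<lambda>z. q * (power_nl q (profile l z) \<bullet> profile_deriv l z))"
proof (rule abs_contI_derivative)
  note cont = continuous_on_profile[OF l]
  have nl: "continuous_on {0..1} (\<lambda>z. power_nl q (profile l z))"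
    using continuous_on_compose2[OF continuous_on_power_nl[OF q, of UNIV] cont] by simp
  show "continuous_on {0..1} (\<lambda>z. norm (profile l z) powr q)"
    using q by (intro continuous_on_powr' continuous_intros cont) auto
  have "bounded ((\<lambda>z. power_nl q (profile l z)) ` {0..1})"
    by (intro compact_imp_bounded compact_continuous_image nl compact_Icc)
  then obtain B where B: "\<And>z. z \<in> {0..1} \<Longrightarrow> norm (power_nl q (profile l z)) \<le> B"
    unfolding bounded_iff by blast
  note [measurable] = borel_measurable_interval_continuous[OF nl] borel_measurable_profile_deriv[OF l]
  have "integrable hemi (\<lambda>z. power_nl q (profile l z) \<bullet> profile_deriv l z)"
  proof (rule Bochner_Integration.integrable_bound)
    show "integrable hemi (\<lambda>z. B * norm (profile_deriv l z))"
      by (intro integrable_mult_right integrable_norm integrable_profile_deriv l)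
    show "AE z in hemi. norm (power_nl q (profile l z) \<bullet> profile_deriv l z)
        \<le> norm (B * norm (profile_deriv l z))"
    proof (rule AE_I2)
      fix z :: real assume "z \<in> space hemi"
      then have "norm (power_nl q (profile l z)) \<le> B"
        by (intro B) simp
      then have "norm (power_nl q (profile l z)) * norm (profile_deriv l z) \<le> B * norm (profile_deriv l z)"
        by (intro mult_right_mono) auto
      then show "norm (power_nl q (profile l z) \<bullet> profile_deriv l z) \<le> norm (B * norm (profile_deriv l z))"
        using Cauchy_Schwarz_ineq2[of "power_nl q (profile l z)" "profile_deriv l z"]
        unfolding real_norm_def by linarith
    qed
  qed measurable
  then show "integrable hemi (\<lambda>z. q * (power_nl q (profile l z) \<bullet> profile_deriv l z))"
    by (rule integrable_mult_right)
  fix z :: real assume z: "z \<in> {0<..<1}"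
  have "continuous_on {0<..<1} (profile_deriv l)"
    unfolding profile_deriv_def
  proof (intro continuous_intros ballI)
    show "continuous_on {0<..<1} (flux l)"
      using abs_cont_continuous_flux[OF l] by (rule continuous_on_subset) auto
    show "1 - z\<^sup>2 \<noteq> 0" if "z \<in> {0<..<1}" for z :: real
      using one_minus_square_pos[of z] that by auto
  qed
  then have "(profile l has_vector_derivative profile_deriv l z) (at z)"
    by (rule abs_cont_derivative[OF abs_cont_profile[OF l] z])
  then have "(profile l has_derivative (\<lambda>h. h *\<^sub>R profile_deriv l z)) (at z)"
    by (simp add: has_vector_derivative_def)
  from has_derivative_compose[OF this norm_powr_has_derivative[OF q]]
  show "((\<lambda>z. norm (profile l z) powr q) has_vector_derivative
      q * (power_nl q (profile l z) \<bullet> profile_deriv l z)) (at z)"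
    by (simp add: has_vector_derivative_def mult.left_commute)
qed

text \<open>
  The integral of the derivative of \<open>(1 - z) |h|\<^sup>q\<close>, which vanishes at both ends.
\<close>

lemma pohozaev_nonlinear:
  assumes l: "sq_integrable hemi l" and q: "2 < q"
  shows "q * (LINT z|hemi. power_nl q (profile l z) \<bullet> virial_field l z) =
    (LINT z|hemi. norm (profile l z) powr q)"
proof -
  note ac = abs_cont_product[OF bounded_bilinear_mult abs_cont_one_minus abs_cont_norm_powr_profile[OF l q]]
  have cont: "continuous_on {0..1} (\<lambda>z. norm (profile l z) powr q)"
    by (rule abs_cont_continuous_on[OF abs_cont_norm_powr_profile[OF l q]])
  have "(1 - 1) * norm (profile l 1) powr q - (1 - 0) * norm (profile l 0) powr q =
     (LINT z|hemi. - (norm (profile l z) powr q))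
     + (LINT z|hemi. q * (power_nl q (profile l z) \<bullet> virial_field l z))"
    by (rule abs_cont_integral_split(2)[OF ac])
      (auto simp: virial_field_eq intro!: sq_integrable_imp_integrable sq_integrable_continuous cont)
  then show ?thesis
    by simp
qed

lemma continuous_on_power_nl_profile:
  assumes "sq_integrable hemi l" "2 < q"
  shows "continuous_on {0..1} (\<lambda>z. power_nl q (profile l z))"
  using continuous_on_compose2[OF continuous_on_power_nl[OF assms(2), of UNIV] continuous_on_profile[OF assms(1)]]
  by simp

lemma virial_field_norm_le_dirichlet:
  assumes l: "sq_integrable hemi l"
  shows "(LINT z|hemi. (norm (virial_field l z))\<^sup>2) \<le> dirichlet_energy l"
  unfolding dirichlet_energy_def
proof (rule integral_mono)
  show "integrable hemi (\<lambda>z. (norm (virial_field l z))\<^sup>2)"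
    by (intro sq_integrable_square sq_integrable_virial_field l)
  show "integrable hemi (\<lambda>z. flux l z \<bullet> profile_deriv l z)"
    by (rule green_identity(1)[OF l l])
  fix z :: real assume "z \<in> space hemi"
  then have z: "z \<in> {0..1}" by simp
  show "(norm (virial_field l z))\<^sup>2 \<le> flux l z \<bullet> profile_deriv l z"
  proof (cases "z = 1")
    case False
    then have pos: "0 < 1 - z\<^sup>2"
      using z one_minus_square_pos by auto
    have "(norm (virial_field l z))\<^sup>2 = (norm (flux l z))\<^sup>2 / (1 + z)\<^sup>2"
      using z by (simp add: virial_field_def power_mult_distrib divide_inverse_commute power_inverse)
    also have "\<dots> \<le> (norm (flux l z))\<^sup>2 / (1 - z\<^sup>2)"
    proof (rule divide_left_mono)
      show "1 - z\<^sup>2 \<le> (1 + z)\<^sup>2"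
        using z by (simp add: power2_sum)
      show "0 < (1 + z)\<^sup>2 * (1 - z\<^sup>2)"
        using z pos by (intro mult_pos_pos) auto
    qed simp
    also have "\<dots> = flux l z \<bullet> profile_deriv l z"
      by (simp add: profile_deriv_def power2_norm_eq_inner divide_inverse_commute)
    finally show ?thesis .
  qed (simp add: virial_field_def)
qed

text \<open>
  The energy of the hemisphere, up to the factor \<open>2 \<pi>\<close> from the longitude.
\<close>

definition half_energy :: "real \<Rightarrow> (real \<Rightarrow> complex) \<Rightarrow> real" where
  "half_energy q l = dirichlet_energy l - 2 / q * (LINT z|hemi. norm (profile l z) powr q)"

text \<open>
  The left-hand side is the time derivative of the momentum when \<open>F\<close> is the right-hand side of the
  equation. By the two Pohozaev identities it equals
  \<open>- |K(0)|\<^sup>2 + \<integral> |virial_field|\<^sup>2 + D - (1 - 2/q) P\<close> with the Dirichlet energy \<open>D\<close> and \<open>P = \<integral> |h|\<^sup>q\<close>, and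
  \<open>1 - 2/q \<ge> 4/q\<close> precisely for \<open>q \<ge> 6\<close>.
\<close>

lemma virial_inequality:
  assumes l: "sq_integrable hemi l" and q: "6 \<le> q"
  defines "F \<equiv> (\<lambda>z. l z + power_nl q (profile l z))"
  shows "2 * (LINT z|hemi. F z \<bullet> virial_field l z) - (LINT z|hemi. F z \<bullet> profile l z)
    \<le> 2 * half_energy q l"
proof -
  let ?P = "LINT z|hemi. norm (profile l z) powr q"
  note vf = sq_integrable_virial_field[OF l] and pf = sq_integrable_profile[OF l]
  have nl: "sq_integrable hemi (\<lambda>z. power_nl q (profile l z))"
    using q by (intro sq_integrable_continuous continuous_on_power_nl_profile l) auto
  have "(LINT z|hemi. F z \<bullet> virial_field l z) =
      (LINT z|hemi. l z \<bullet> virial_field l z) + (LINT z|hemi. power_nl q (profile l z) \<bullet> virial_field l z)"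
    unfolding F_def inner_add_left using integrable_inner_sq[OF l vf] integrable_inner_sq[OF nl vf] by simp
  moreover have "(LINT z|hemi. F z \<bullet> profile l z) = - dirichlet_energy l + ?P"
    unfolding F_def inner_add_left using integrable_inner_sq[OF l pf] integrable_inner_sq[OF nl pf]
      integral_laplacian_profile[OF l] q by (simp add: power_nl_inner_self)
  moreover have "(LINT z|hemi. power_nl q (profile l z) \<bullet> virial_field l z) = ?P / q"
    using pohozaev_nonlinear[OF l, of q] q by (simp add: field_simps)
  moreover have "(norm (flux l 0))\<^sup>2 \<ge> 0"
    by simp
  moreover have "2 * (?P / q) - ?P \<le> - (4 / q * ?P)"
  proof -
    have "(2 / q - 1) * ?P \<le> - (4 / q) * ?P"
      using q by (intro mult_right_mono) (auto simp: field_simps)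
    then show ?thesis by (simp add: algebra_simps)
  qed
  moreover have "2 * half_energy q l = 2 * dirichlet_energy l - 4 / q * ?P"
    by (simp add: half_energy_def)
  ultimately show ?thesis
    using pohozaev_laplacian[OF l] virial_field_norm_le_dirichlet[OF l] by linarith
qed


section \<open>The virial argument\<close>

lemma eventually_within_nonneg: "\<forall>\<^sub>F s in at t within {0::real..}. 0 \<le> s \<and> s \<noteq> t"
  by (auto simp: eventually_at_filter)

lemma nonpos_derivative_imp_le:
  fixes f :: "real \<Rightarrow> real"
  assumes d: "\<And>t. 0 \<le> t \<Longrightarrow> (f has_real_derivative f' t) (at t within {0..})"
    and le: "\<And>t. 0 \<le> t \<Longrightarrow> f' t \<le> 0" and t: "0 \<le> t"
  shows "f t \<le> f 0"
proof (cases "t = 0")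
  case False
  have "\<exists>x\<in>{0<..<t}. f t - f 0 = (\<lambda>h. f' x * h) (t - 0)"
  proof (rule mvt_simple)
    fix x assume "0 \<le> x" "x \<le> t"
    then show "(f has_derivative (\<lambda>h. f' x * h)) (at x within {0..t})"
      using has_derivative_subset[OF d[of x, unfolded has_field_derivative_def], of "{0..t}"] by auto
  qed (use False t in auto)
  then obtain x where x: "x \<in> {0<..<t}" "f t - f 0 = f' x * t"
    by auto
  then have "f' x * t \<le> 0"
    using le[of x] t by (intro mult_nonpos_nonneg) auto
  with x show ?thesis by simp
qed auto

lemma l2norm_unit_bound:
  assumes "f \<in> borel_measurable hemi" "\<And>z. z \<in> {0..1} \<Longrightarrow> norm (f z) \<le> c"
  shows "l2norm hemi f \<le> c"
proof -
  have c: "0 \<le> c"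
    using assms(2)[of 0] norm_ge_zero[of "f 0"] by (simp only: atLeastAtMost_iff) linarith
  have one: "sq_integrable hemi (\<lambda>_. 1 :: real)"
    by (rule sq_integrable_continuous) simp
  have "l2norm hemi f \<le> c * l2norm hemi (\<lambda>_. 1 :: real)"
    by (rule l2norm_mono[OF one assms(1) _ c]) (use assms(2) in \<open>auto intro!: AE_I2\<close>)
  moreover have "l2norm hemi (\<lambda>_. 1 :: real) = 1"
    by (simp add: l2norm_def measure_restrict_space)
  ultimately show ?thesis by simp
qed

text \<open>
  A global solution in the height coordinate on the hemisphere: \<open>l t\<close> is the Laplacian of the solution
  at time \<open>t\<close>, which determines the solution as \<open>profile (l t)\<close>, \<open>d t\<close> is the time derivative in \<open>L\<^sup>2\<close>, and
  \<open>q = p + 1\<close>.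
\<close>

locale radial_flow =
  fixes q :: real and l d :: "real \<Rightarrow> real \<Rightarrow> complex"
  assumes q: "6 \<le> q"
    and l_sq: "\<And>t. 0 \<le> t \<Longrightarrow> sq_integrable hemi (l t)"
    and d_sq: "\<And>t. 0 \<le> t \<Longrightarrow> sq_integrable hemi (d t)"
    and equation: "\<And>t. 0 \<le> t \<Longrightarrow>
      AE z in hemi. \<i> * d t z = l t z + power_nl q (profile (l t) z)"
    and laplacian_continuous: "\<And>t. 0 \<le> t \<Longrightarrow>
      ((\<lambda>s. l2norm hemi (\<lambda>z. l s z - l t z)) \<longlongrightarrow> 0) (at t within {0..})"
    and profile_differentiable: "\<And>t. 0 \<le> t \<Longrightarrow>
      ((\<lambda>s. l2norm hemi (\<lambda>z. (profile (l s) z - profile (l t) z) /\<^sub>R (s - t) - d t z)) \<longlongrightarrow> 0)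
        (at t within {0..})"
begin

abbreviation "h t \<equiv> profile (l t)"
abbreviation "g t \<equiv> virial_field (l t)"
abbreviation "N t z \<equiv> power_nl q (h t z)"

lemma h_sq: "0 \<le> t \<Longrightarrow> sq_integrable hemi (h t)"
  and g_sq: "0 \<le> t \<Longrightarrow> sq_integrable hemi (g t)"
  by (simp_all add: sq_integrable_profile sq_integrable_virial_field l_sq)

lemma N_sq: "0 \<le> t \<Longrightarrow> sq_integrable hemi (N t)"
  using q by (intro sq_integrable_continuous continuous_on_power_nl_profile l_sq) auto

lemma h_diff_bound:
  assumes "0 \<le> s" "0 \<le> t"
  shows "norm (h s z - h t z) \<le> 2 * l2norm hemi (\<lambda>z. l s z - l t z)"
  using profile_bound[OF sq_integrable_diff[OF l_sq l_sq], OF assms, of z]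
  by (simp add: profile_diff l_sq assms)

lemma h_continuous:
  assumes "0 \<le> t"
  shows "((\<lambda>s. l2norm hemi (\<lambda>z. h s z - h t z)) \<longlongrightarrow> 0) (at t within {0..})"
proof (rule Lim_null_comparison)
  show "((\<lambda>s. 2 * l2norm hemi (\<lambda>z. l s z - l t z)) \<longlongrightarrow> 0) (at t within {0..})"
    using tendsto_mult_right_zero[OF laplacian_continuous[OF assms]] .
  show "\<forall>\<^sub>F s in at t within {0..}. norm (l2norm hemi (\<lambda>z. h s z - h t z))
      \<le> 2 * l2norm hemi (\<lambda>z. l s z - l t z)"
    using eventually_within_nonneg
  proof eventually_elim
    case (elim s)
    then show ?case
      using l2norm_unit_bound[OF sq_integrable_measurable[OF sq_integrable_diff[OF h_sq h_sq]] h_diff_bound] assms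
      by simp
  qed
qed

lemma g_diff_bound:
  assumes "0 \<le> s" "0 \<le> t" "z \<in> {0..1}"
  shows "norm (g s z - g t z) \<le> l2norm hemi (\<lambda>z. l s z - l t z)"
  using virial_field_bound[OF sq_integrable_diff[OF l_sq l_sq], OF assms]
  by (simp add: virial_field_diff l_sq assms)

text \<open>
  Profiles converge uniformly and stay in a fixed ball, where the nonlinearity is uniformly
  continuous.
\<close>

lemma N_continuous:
  assumes t: "0 \<le> t"
  shows "((\<lambda>s. l2norm hemi (\<lambda>z. N s z - N t z)) \<longlongrightarrow> 0) (at t within {0..})"
proof (rule tendstoI)
  fix e :: real assume e: "0 < e"
  define R where "R = 2 * l2norm hemi (l t) + 1"
  have "uniformly_continuous_on (cball 0 R) (power_nl q)"
    using q by (intro compact_uniformly_continuous continuous_on_power_nl) auto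
  then obtain \<delta> where \<delta>: "0 < \<delta>"
    "\<And>a b. a \<in> cball 0 R \<Longrightarrow> b \<in> cball 0 R \<Longrightarrow> dist b a < \<delta> \<Longrightarrow> dist (power_nl q b) (power_nl q a) < e / 2"
    using e unfolding uniformly_continuous_on_def by (metis half_gt_zero)
  have "((\<lambda>s. 2 * l2norm hemi (\<lambda>z. l s z - l t z)) \<longlongrightarrow> 0) (at t within {0..})"
    using tendsto_mult_right_zero[OF laplacian_continuous[OF t]] .
  then have "\<forall>\<^sub>F s in at t within {0..}. 2 * l2norm hemi (\<lambda>z. l s z - l t z) < min \<delta> 1"
    using \<delta>(1) by (intro order_tendstoD) auto
  then show "\<forall>\<^sub>F s in at t within {0..}. dist (l2norm hemi (\<lambda>z. N s z - N t z)) 0 < e"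
    using eventually_within_nonneg
  proof eventually_elim
    case (elim s)
    have "norm (N s z - N t z) \<le> e / 2" for z
    proof -
      have d: "norm (h s z - h t z) < min \<delta> 1"
        using h_diff_bound[of s t z] elim t by linarith
      have ht: "norm (h t z) \<le> R - 1"
        using profile_bound[OF l_sq[OF t], of z] by (simp add: R_def)
      then have "norm (h s z) \<le> R"
        using d norm_triangle_sub[of "h s z" "h t z"] by linarith
      then have "dist (N s z) (N t z) < e / 2"
        using ht d by (intro \<delta>(2)) (auto simp: dist_norm)
      then show ?thesis by (simp add: dist_norm)
    qed
    then have "l2norm hemi (\<lambda>z. N s z - N t z) \<le> e / 2"
      using elim t by (intro l2norm_unit_bound sq_integrable_measurable sq_integrable_diff N_sq) auto
    then show ?case
      using e by simp
  qed
qed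

lemma quotient_limit:
  assumes t: "0 \<le> t" and "sq_integrable hemi a"
    and "\<And>s. 0 \<le> s \<Longrightarrow> sq_integrable hemi (a' s)"
    and "((\<lambda>s. l2norm hemi (\<lambda>z. a' s z - a z)) \<longlongrightarrow> 0) (at t within {0..})"
  shows "((\<lambda>s. LINT z|hemi. a' s z \<bullet> ((h s z - h t z) /\<^sub>R (s - t))) \<longlongrightarrow>
    (LINT z|hemi. a z \<bullet> d t z)) (at t within {0..})"
proof (rule tendsto_integral_inner[OF assms(2) d_sq[OF t]])
  show "\<forall>\<^sub>F s in at t within {0..}. sq_integrable hemi (a' s)"
    using eventually_within_nonneg by eventually_elim (simp add: assms(3))
  show "\<forall>\<^sub>F s in at t within {0..}. sq_integrable hemi (\<lambda>z. (h s z - h t z) /\<^sub>R (s - t))"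
    using eventually_within_nonneg
    by eventually_elim (intro sq_integrable_scaleR sq_integrable_diff h_sq, auto simp: t)
qed (use assms(4) profile_differentiable[OF t] in auto)

text \<open>
  All time derivatives have this form: the increment of the functional is paired with the increment
  of the profile, whose difference quotient converges in \<open>L\<^sup>2\<close>.
\<close>

lemma derivative_via_quotient:
  assumes t: "0 \<le> t" and "sq_integrable hemi a"
    and "\<And>s. 0 \<le> s \<Longrightarrow> sq_integrable hemi (a' s)"
    and "((\<lambda>s. l2norm hemi (\<lambda>z. a' s z - a z)) \<longlongrightarrow> 0) (at t within {0..})"
    and eq: "\<And>s. 0 \<le> s \<Longrightarrow> f s - f t = (LINT z|hemi. a' s z \<bullet> (h s z - h t z))"
  shows "(f has_real_derivative (LINT z|hemi. a z \<bullet> d t z)) (at t within {0..})"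
  unfolding has_field_derivative_iff
proof (rule Lim_transform_eventually[OF quotient_limit[OF assms(1-4)]])
  show "\<forall>\<^sub>F s in at t within {0..}.
      (LINT z|hemi. a' s z \<bullet> ((h s z - h t z) /\<^sub>R (s - t))) = (f s - f t) / (s - t)"
    using eventually_within_nonneg
    by eventually_elim (simp add: eq divide_inverse mult.commute)
qed

definition "virial_mass t = (LINT z|hemi. virial_weight z * (norm (h t z))\<^sup>2)"
definition "momentum t = (LINT z|hemi. (\<i> * h t z) \<bullet> g t z)"
definition "potential t = (LINT z|hemi. norm (h t z) powr q)"

lemma equation':
  assumes "0 \<le> t"
  shows "AE z in hemi. d t z = - \<i> * (l t z + N t z)"
  using equation[OF assms]
proof eventually_elim
  case (elim z)
  have "d t z = - \<i> * (\<i> * d t z)" by simp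
  then show ?case unfolding elim .
qed

lemma weight_sq:
  assumes "sq_integrable hemi f"
  shows "sq_integrable hemi (\<lambda>z. virial_weight z *\<^sub>R f z)"
    and "l2norm hemi (\<lambda>z. virial_weight z *\<^sub>R f z) \<le> ln 2 * l2norm hemi f"
proof -
  note [measurable] = sq_integrable_measurable[OF assms]
    borel_measurable_interval_continuous[OF abs_cont_continuous_on[OF abs_cont_virial_weight]]
  have le: "AE z in hemi. norm (virial_weight z *\<^sub>R f z) \<le> ln 2 * norm (f z)"
    using virial_weight_bounds by (auto intro!: AE_I2 mult_right_mono)
  show "sq_integrable hemi (\<lambda>z. virial_weight z *\<^sub>R f z)"
    by (rule sq_integrable_bound[OF assms _ le]) measurable
  show "l2norm hemi (\<lambda>z. virial_weight z *\<^sub>R f z) \<le> ln 2 * l2norm hemi f"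
    by (rule l2norm_mono[OF assms _ le]) simp_all
qed

text \<open>
  The nonlinear part of the equation does not change the mass density, being a real multiple of \<open>h\<close>.
\<close>

lemma virial_mass_derivative:
  assumes t: "0 \<le> t"
  shows "(virial_mass has_real_derivative 2 * momentum t) (at t within {0..})"
proof -
  define a where "a s z = virial_weight z *\<^sub>R (h s z + h t z)" for s z
  have asq: "sq_integrable hemi (a s)" if "0 \<le> s" for s
    unfolding a_def using that t by (intro weight_sq sq_integrable_add h_sq)
  have "((\<lambda>s. l2norm hemi (\<lambda>z. a s z - a t z)) \<longlongrightarrow> 0) (at t within {0..})"
  proof (rule Lim_null_comparison)
    show "((\<lambda>s. ln 2 * l2norm hemi (\<lambda>z. h s z - h t z)) \<longlongrightarrow> 0) (at t within {0..})"
      using tendsto_mult_right_zero[OF h_continuous[OF t]] .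
    show "\<forall>\<^sub>F s in at t within {0..}. norm (l2norm hemi (\<lambda>z. a s z - a t z))
        \<le> ln 2 * l2norm hemi (\<lambda>z. h s z - h t z)"
      using eventually_within_nonneg
    proof eventually_elim
      case (elim s)
      then show ?case
        using weight_sq(2)[OF sq_integrable_diff[OF h_sq h_sq], of s t] t
        by (simp add: a_def scaleR_diff_right[symmetric])
    qed
  qed
  moreover have "virial_mass s - virial_mass t = (LINT z|hemi. a s z \<bullet> (h s z - h t z))" if s: "0 \<le> s" for s
  proof -
    have int: "integrable hemi (\<lambda>z. virial_weight z * (norm (h r z))\<^sup>2)" if "0 \<le> r" for r
      using integrable_inner_sq[OF weight_sq(1)[OF h_sq] h_sq, OF that that]
      by (simp add: power2_norm_eq_inner)
    show ?thesis
      unfolding virial_mass_def Bochner_Integration.integral_diff[OF int[OF s] int[OF t], symmetric]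
      by (rule Bochner_Integration.integral_cong)
        (simp_all only: a_def power2_norm_eq_inner, simp add: inner_add_left inner_diff_right inner_commute algebra_simps)
  qed
  ultimately have "(virial_mass has_real_derivative (LINT z|hemi. a t z \<bullet> d t z)) (at t within {0..})"
    by (intro derivative_via_quotient[where a = "a t" and a' = a]) (simp_all add: asq t)
  also have "(LINT z|hemi. a t z \<bullet> d t z) =
      (LINT z|hemi. 2 * ((virial_weight z *\<^sub>R (\<i> * h t z)) \<bullet> l t z))"
  proof (rule integral_cong_AE)
    show "AE z in hemi. a t z \<bullet> d t z = 2 * ((virial_weight z *\<^sub>R (\<i> * h t z)) \<bullet> l t z)"
      using equation'[OF t]
      by eventually_elim
        (simp only: a_def power_nl_def inner_complex_def, simp add: algebra_simps)
    show "(\<lambda>z. a t z \<bullet> d t z) \<in> borel_measurable hemi"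
      using integrable_inner_sq[OF asq[OF t] d_sq[OF t]] by simp
    show "(\<lambda>z. 2 * ((virial_weight z *\<^sub>R (\<i> * h t z)) \<bullet> l t z)) \<in> borel_measurable hemi"
      using integrable_inner_sq[OF weight_sq(1)[OF sq_integrable_cmult[OF h_sq[OF t], of \<i>]] l_sq[OF t]]
      by simp
  qed
  also have "\<dots> = 2 * momentum t"
    by (simp only: integral_mult_right_zero mass_flux_identity[OF l_sq[OF t]] momentum_def)
  finally show ?thesis .
qed

text \<open>
  The increment of the bilinear momentum is rewritten with \<open>momentum_swap\<close> as a pairing with the
  increment of the profile.
\<close>

lemma momentum_derivative:
  assumes t: "0 \<le> t"
  obtains D where "(momentum has_real_derivative D) (at t within {0..})" "D \<le> 2 * half_energy q (l t)"
proof -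
  define a where "a s z = \<i> * (h s z - (g s z + g t z))" for s z
  have asq: "sq_integrable hemi (a s)" if "0 \<le> s" for s
    unfolding a_def using that t by (intro sq_integrable_cmult sq_integrable_diff sq_integrable_add h_sq g_sq)
  have "((\<lambda>s. l2norm hemi (\<lambda>z. a s z - a t z)) \<longlongrightarrow> 0) (at t within {0..})"
  proof (rule Lim_null_comparison)
    show "((\<lambda>s. 3 * l2norm hemi (\<lambda>z. l s z - l t z)) \<longlongrightarrow> 0) (at t within {0..})"
      using tendsto_mult_right_zero[OF laplacian_continuous[OF t]] .
    show "\<forall>\<^sub>F s in at t within {0..}. norm (l2norm hemi (\<lambda>z. a s z - a t z))
        \<le> 3 * l2norm hemi (\<lambda>z. l s z - l t z)"
      using eventually_within_nonneg
    proof eventually_elim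
      case (elim s)
      have "norm (a s z - a t z) \<le> 3 * l2norm hemi (\<lambda>z. l s z - l t z)" if "z \<in> {0..1}" for z
      proof -
        have "a s z - a t z = \<i> * ((h s z - h t z) - (g s z - g t z))"
          by (simp add: a_def algebra_simps)
        then have "norm (a s z - a t z) \<le> norm (h s z - h t z) + norm (g s z - g t z)"
          by (simp add: norm_mult norm_triangle_ineq4)
        then show ?thesis
          using h_diff_bound[of s t z] g_diff_bound[of s t z] that elim t by linarith
      qed
      then show ?case
        using l2norm_unit_bound[OF sq_integrable_measurable[OF sq_integrable_diff[OF asq asq]]] elim t
        by simp
    qed
  qed
  moreover have "momentum s - momentum t = (LINT z|hemi. a s z \<bullet> (h s z - h t z))" if s: "0 \<le> s" for s
  proof -
    note ih = sq_integrable_cmult[OF h_sq, of _ \<i>] and ig = sq_integrable_cmult[OF g_sq, of _ \<i>]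
    note w = sq_integrable_diff[OF h_sq[OF s] h_sq[OF t]]
    have lst: "sq_integrable hemi (\<lambda>z. l s z - l t z)"
      by (intro sq_integrable_diff l_sq s t)
    have swap: "(LINT z|hemi. (\<i> * h s z) \<bullet> (g s z - g t z)) =
        (LINT z|hemi. (\<i> * (h s z - h t z)) \<bullet> g s z)
        + (LINT z|hemi. (\<i> * h s z) \<bullet> (h s z - h t z))"
      using momentum_swap[OF l_sq[OF s] lst] by (simp add: profile_diff virial_field_diff l_sq s t)
    have "momentum s - momentum t =
        (LINT z|hemi. (\<i> * h s z) \<bullet> (g s z - g t z) + (\<i> * (h s z - h t z)) \<bullet> g t z)"
      unfolding momentum_def
      by (subst Bochner_Integration.integral_diff[symmetric])
        (auto intro!: integrable_inner_sq ih g_sq s t simp: algebra_simps inner_diff_left)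
    also have "\<dots> = (LINT z|hemi. (\<i> * h s z) \<bullet> (g s z - g t z))
        + (LINT z|hemi. (\<i> * (h s z - h t z)) \<bullet> g t z)"
      by (intro Bochner_Integration.integral_add integrable_inner_sq ih sq_integrable_diff
          sq_integrable_cmult g_sq h_sq s t)
    also have "\<dots> = (LINT z|hemi. (\<i> * (h s z - h t z)) \<bullet> g s z + (\<i> * h s z) \<bullet> (h s z - h t z)
        + (\<i> * (h s z - h t z)) \<bullet> g t z)"
      unfolding swap
      by (subst Bochner_Integration.integral_add Bochner_Integration.integrable_add,
          (intro Bochner_Integration.integrable_add integrable_inner_sq ih sq_integrable_diff
          sq_integrable_cmult g_sq h_sq s t)+)+ simp
    also have "\<dots> = (LINT z|hemi. a s z \<bullet> (h s z - h t z))"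
      by (rule Bochner_Integration.integral_cong)
        (auto simp: a_def inner_complex_def algebra_simps)
    finally show ?thesis .
  qed
  ultimately have der: "(momentum has_real_derivative (LINT z|hemi. a t z \<bullet> d t z)) (at t within {0..})"
    by (intro derivative_via_quotient[where a = "a t" and a' = a]) (simp_all add: asq t)
  let ?F = "\<lambda>z. l t z + N t z"
  have F: "sq_integrable hemi ?F"
    by (intro sq_integrable_add l_sq N_sq t)
  have "(LINT z|hemi. a t z \<bullet> d t z) = (LINT z|hemi. 2 * (?F z \<bullet> g t z) - ?F z \<bullet> h t z)"
  proof (rule integral_cong_AE)
    show "AE z in hemi. a t z \<bullet> d t z = 2 * (?F z \<bullet> g t z) - ?F z \<bullet> h t z"
      using equation'[OF t]
      by eventually_elim (simp only: a_def inner_complex_def, simp add: algebra_simps)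
    show "(\<lambda>z. a t z \<bullet> d t z) \<in> borel_measurable hemi"
      using integrable_inner_sq[OF asq[OF t] d_sq[OF t]] by simp
    show "(\<lambda>z. 2 * (?F z \<bullet> g t z) - ?F z \<bullet> h t z) \<in> borel_measurable hemi"
      using borel_measurable_integrable[OF integrable_inner_sq[OF F g_sq[OF t]]]
        borel_measurable_integrable[OF integrable_inner_sq[OF F h_sq[OF t]]] by simp
  qed
  also have "\<dots> = 2 * (LINT z|hemi. ?F z \<bullet> g t z) - (LINT z|hemi. ?F z \<bullet> h t z)"
    using integrable_inner_sq[OF F g_sq[OF t]] integrable_inner_sq[OF F h_sq[OF t]] by simp
  also have "\<dots> \<le> 2 * half_energy q (l t)"
    by (rule virial_inequality[OF l_sq[OF t] q])
  finally show thesis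
    using der that by blast
qed

lemma dirichlet_derivative:
  assumes t: "0 \<le> t"
  shows "((\<lambda>t. dirichlet_energy (l t)) has_real_derivative - 2 * (LINT z|hemi. l t z \<bullet> d t z))
    (at t within {0..})"
proof -
  define a where "a s z = - (l s z + l t z)" for s z
  have asq: "sq_integrable hemi (a s)" if "0 \<le> s" for s
    unfolding a_def using sq_integrable_scaleR[OF sq_integrable_add[OF l_sq l_sq], of s t "-1"] that t
    by simp
  have "(\<lambda>s. l2norm hemi (\<lambda>z. a s z - a t z)) = (\<lambda>s. l2norm hemi (\<lambda>z. l s z - l t z))"
    by (simp add: a_def l2norm_def norm_minus_commute)
  then have "((\<lambda>s. l2norm hemi (\<lambda>z. a s z - a t z)) \<longlongrightarrow> 0) (at t within {0..})"
    using laplacian_continuous[OF t] by simp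
  moreover have "dirichlet_energy (l s) - dirichlet_energy (l t) =
      (LINT z|hemi. a s z \<bullet> (h s z - h t z))" if s: "0 \<le> s" for s
  proof -
    note int = integrable_inner_sq[OF l_sq h_sq]
    have "(LINT z|hemi. a s z \<bullet> (h s z - h t z)) =
        (LINT z|hemi. l t z \<bullet> h t z - l s z \<bullet> h s z + (l s z \<bullet> h t z - l t z \<bullet> h s z))"
      by (rule Bochner_Integration.integral_cong) (auto simp: a_def algebra_simps inner_add_left inner_diff_right)
    also have "\<dots> = (LINT z|hemi. l t z \<bullet> h t z) - (LINT z|hemi. l s z \<bullet> h s z)
        + ((LINT z|hemi. l s z \<bullet> h t z) - (LINT z|hemi. l t z \<bullet> h s z))"
      using int[OF s s] int[OF s t] int[OF t s] int[OF t t] by simp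
    finally show ?thesis
      using green_symmetric[OF l_sq[OF s] l_sq[OF t]] by (simp add: integral_laplacian_profile l_sq s t)
  qed
  ultimately have "((\<lambda>t. dirichlet_energy (l t)) has_real_derivative (LINT z|hemi. a t z \<bullet> d t z)) (at t within {0..})"
    by (intro derivative_via_quotient[where a = "a t" and a' = a]) (simp_all add: asq t)
  also have "(LINT z|hemi. a t z \<bullet> d t z) = (LINT z|hemi. (- 2) * (l t z \<bullet> d t z))"
  proof (rule Bochner_Integration.integral_cong)
    show "a t z \<bullet> d t z = (- 2) * (l t z \<bullet> d t z)" for z
    proof -
      have "a t z = (- 2) *\<^sub>R l t z"
        unfolding a_def by (simp add: scaleR_conv_of_real)
      then show ?thesis by simp
    qed
  qed simp
  also have "\<dots> = - 2 * (LINT z|hemi. l t z \<bullet> d t z)"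
    by (rule integral_mult_right_zero)
  finally show ?thesis .
qed

text \<open>
  By convexity the increment of \<open>|h|\<^sup>q\<close> lies between the linearisations at the old and at the new time,
  whose difference is of lower order.
\<close>

lemma potential_derivative:
  assumes t: "0 \<le> t"
  shows "(potential has_real_derivative q * (LINT z|hemi. N t z \<bullet> d t z)) (at t within {0..})"
  unfolding has_field_derivative_iff
proof -
  let ?w = "\<lambda>s z. (h s z - h t z) /\<^sub>R (s - t)"
  let ?Q = "\<lambda>s r. LINT z|hemi. N r z \<bullet> ?w s z"
  have lim_t: "((\<lambda>s. ?Q s t) \<longlongrightarrow> (LINT z|hemi. N t z \<bullet> d t z)) (at t within {0..})"
    using N_sq by (intro quotient_limit t) (auto simp: l2norm_def t)
  have lim_s: "((\<lambda>s. ?Q s s) \<longlongrightarrow> (LINT z|hemi. N t z \<bullet> d t z)) (at t within {0..})"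
    by (intro quotient_limit t N_sq N_continuous)
  have "((\<lambda>s. q * (?Q s s - ?Q s t)) \<longlongrightarrow>
      q * ((LINT z|hemi. N t z \<bullet> d t z) - (LINT z|hemi. N t z \<bullet> d t z))) (at t within {0..})"
    by (intro tendsto_intros lim_t lim_s)
  then have lim0: "((\<lambda>s. \<bar>q * (?Q s s - ?Q s t)\<bar>) \<longlongrightarrow> 0) (at t within {0..})"
    by (simp add: tendsto_rabs_zero_iff)
  have "((\<lambda>s. (potential s - potential t) / (s - t) - q * ?Q s t) \<longlongrightarrow> 0) (at t within {0..})"
  proof (rule Lim_null_comparison[OF _ lim0])
    show "\<forall>\<^sub>F s in at t within {0..}. norm ((potential s - potential t) / (s - t) - q * ?Q s t)
        \<le> \<bar>q * (?Q s s - ?Q s t)\<bar>"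
      using eventually_within_nonneg
    proof eventually_elim
      case (elim s)
      then have s: "0 \<le> s" "s \<noteq> t" by auto
      have q2: "2 \<le> q" using q by simp
      have w: "sq_integrable hemi (\<lambda>z. h s z - h t z)"
        by (intro sq_integrable_diff h_sq s t)
      have I: "integrable hemi (\<lambda>z. norm (h r z) powr q)" if "0 \<le> r" for r
        using integrable_inner_sq[OF N_sq h_sq, OF that that] q2 by (simp add: power_nl_inner_self)
      note Is = integrable_inner_sq[OF N_sq[OF s(1)] w] and It = integrable_inner_sq[OF N_sq[OF t] w]
      let ?B = "\<lambda>r. LINT z|hemi. N r z \<bullet> (h s z - h t z)"
      have Q: "?Q s r = ?B r / (s - t)" for r
        by (simp add: divide_inverse mult.commute)
      have "potential t + q * ?B t = (LINT z|hemi. norm (h t z) powr q + q * (N t z \<bullet> (h s z - h t z)))"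
        using I[OF t] It by (simp add: potential_def)
      also have "\<dots> \<le> potential s"
        unfolding potential_def using I[OF t] I[OF s(1)] It norm_powr_above_tangent[OF q2]
        by (intro integral_mono) auto
      finally have lower: "0 \<le> potential s - potential t - q * ?B t" by simp
      have "potential s \<le> (LINT z|hemi. norm (h t z) powr q + q * (N s z \<bullet> (h s z - h t z)))"
        unfolding potential_def using I[OF t] I[OF s(1)] Is norm_powr_below_tangent[OF q2]
        by (intro integral_mono) auto
      also have "\<dots> = potential t + q * ?B s"
        using I[OF t] Is by (simp add: potential_def)
      finally have upper: "potential s - potential t - q * ?B t \<le> q * (?B s - ?B t)"
        by (simp add: algebra_simps)
      have "(potential s - potential t) / (s - t) - q * ?Q s t = (potential s - potential t - q * ?B t) / (s - t)"
        "q * (?Q s s - ?Q s t) = q * (?B s - ?B t) / (s - t)"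
        unfolding Q by (simp_all add: diff_divide_distrib right_diff_distrib)
      then show ?case
        using lower upper by (simp add: abs_divide divide_right_mono)
    qed
  qed
  from tendsto_add[OF this tendsto_mult_left[OF lim_t, of q]]
  show "((\<lambda>s. (potential s - potential t) / (s - t)) \<longlongrightarrow>
      q * (LINT z|hemi. N t z \<bullet> d t z)) (at t within {0..})"
    by simp
qed

text \<open>
  The derivative of the energy is \<open>- 2 Re \<integral> cnj (l + N) d\<close>, and \<open>l + N = \<i> d\<close> is orthogonal to \<open>d\<close>.
\<close>

lemma energy_conservation:
  assumes t: "0 \<le> t"
  shows "half_energy q (l t) = half_energy q (l 0)"
proof -
  have "((\<lambda>t. half_energy q (l t)) has_real_derivative 0) (at t within {0..})" if t: "0 \<le> t" for t
  proof -
    have "((\<lambda>t. dirichlet_energy (l t) - 2 / q * potential t) has_real_derivative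
        - 2 * (LINT z|hemi. l t z \<bullet> d t z) - 2 / q * (q * (LINT z|hemi. N t z \<bullet> d t z)))
        (at t within {0..})"
      by (intro DERIV_diff DERIV_cmult dirichlet_derivative potential_derivative t)
    also have "- 2 * (LINT z|hemi. l t z \<bullet> d t z) - 2 / q * (q * (LINT z|hemi. N t z \<bullet> d t z))
        = - 2 * (LINT z|hemi. l t z \<bullet> d t z + N t z \<bullet> d t z)"
      using q integrable_inner_sq[OF l_sq[OF t] d_sq[OF t]] integrable_inner_sq[OF N_sq[OF t] d_sq[OF t]]
      by simp
    also have "(LINT z|hemi. l t z \<bullet> d t z + N t z \<bullet> d t z) = 0"
      by (rule integral_eq_zero_AE)
        (use equation[OF t] in eventually_elim, simp flip: inner_add_left, metis imaginary_inner_self)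
    finally show ?thesis
      by (simp add: half_energy_def potential_def)
  qed
  then have "\<exists>c. \<forall>x\<in>{0..}. half_energy q (l x) = c"
    by (intro has_field_derivative_zero_constant) auto
  then show ?thesis
    using t by fastforce
qed

text \<open>
  A negative energy would make the nonnegative weighted mass strictly concave with second
  derivative at most \<open>4 E < 0\<close> for all times.
\<close>

theorem half_energy_nonneg: "0 \<le> half_energy q (l 0)"
proof (rule ccontr)
  assume "\<not> ?thesis"
  then have neg: "half_energy q (l 0) < 0" by simp
  define E where "E = half_energy q (l 0)"
  have mom: "momentum t \<le> momentum 0 + 2 * E * t" if "0 \<le> t" for t
  proof -
    obtain D where D: "\<And>t. 0 \<le> t \<Longrightarrow> (momentum has_real_derivative D t) (at t within {0..})"
      "\<And>t. 0 \<le> t \<Longrightarrow> D t \<le> 2 * E"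
    proof -
      have "\<forall>t\<in>{0..}. \<exists>D. (momentum has_real_derivative D) (at t within {0..}) \<and> D \<le> 2 * E"
        using momentum_derivative energy_conservation unfolding E_def by (metis atLeast_iff)
      then show thesis
        using that by (metis atLeast_iff)
    qed
    have "momentum t - 2 * E * t \<le> momentum 0 - 2 * E * 0"
      by (rule nonpos_derivative_imp_le[where f' = "\<lambda>t. D t - 2 * E"])
        (use D that in \<open>auto intro!: derivative_eq_intros\<close>)
    then show ?thesis by simp
  qed
  have mom': "2 * momentum t - 2 * momentum 0 - 4 * E * t \<le> 0" if "0 \<le> t" for t
    using mom[OF that] by simp
  have J: "virial_mass t \<le> virial_mass 0 + 2 * momentum 0 * t + 2 * E * t\<^sup>2" if t: "0 \<le> t" for t
  proof -
    have "virial_mass t - 2 * momentum 0 * t - 2 * E * t\<^sup>2 \<le> virial_mass 0 - 2 * momentum 0 * 0 - 2 * E * 0\<^sup>2"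
      by (rule nonpos_derivative_imp_le[where f' = "\<lambda>t. 2 * momentum t - 2 * momentum 0 - 4 * E * t"])
        (rule derivative_eq_intros virial_mass_derivative mom' t | assumption | simp)+
    then show ?thesis by simp
  qed
  have nonneg: "0 \<le> virial_mass t" for t
    unfolding virial_mass_def using virial_weight_bounds by (intro Bochner_Integration.integral_nonneg) auto
  \<comment> \<open>a time at which the quadratic upper bound for the weighted mass is negative\<close>
  define C t where "C = virial_mass 0 + 2 * \<bar>momentum 0\<bar>" and "t = 1 + C / (- 2 * E)"
  have C: "0 \<le> C"
    using nonneg by (simp add: C_def)
  then have t: "1 \<le> t"
    using neg divide_nonneg_pos[of C "- 2 * E"] unfolding t_def E_def by simp
  have "0 \<le> virial_mass t"
    by (rule nonneg)
  also have "\<dots> \<le> virial_mass 0 + 2 * momentum 0 * t + 2 * E * t\<^sup>2"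
    using t by (intro J) simp
  also have "\<dots> \<le> virial_mass 0 * t + 2 * \<bar>momentum 0\<bar> * t + 2 * E * t\<^sup>2"
  proof -
    have "momentum 0 * t \<le> \<bar>momentum 0\<bar> * t"
      using t by (intro mult_right_mono) auto
    moreover have "virial_mass 0 * 1 \<le> virial_mass 0 * t"
      using t nonneg[of 0] by (intro mult_left_mono) auto
    ultimately show ?thesis by linarith
  qed
  also have "\<dots> = t * (C + 2 * E * t)"
    by (simp add: C_def algebra_simps power2_eq_square)
  also have "C + 2 * E * t = 2 * E"
    using neg unfolding t_def E_def[symmetric] by (simp add: field_simps)
  also have "t * (2 * E) < 0"
    using t neg by (simp add: E_def mult_pos_neg)
  finally show False by simp
qed

end


section \<open>Testing against continuous functions\<close>

text \<open>
  Indicators of closed sets are limits of continuous functions of the distance; the closed sets are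
  stable under intersection and generate the Borel sets.
\<close>

lemma tested_zero_on_borel:
  fixes v :: "'a::metric_space \<Rightarrow> complex"
  assumes id: "(\<lambda>x. x) \<in> borel_measurable M" and v: "integrable M v"
    and test: "\<And>\<phi> :: 'a \<Rightarrow> real. continuous_on UNIV \<phi> \<Longrightarrow> bounded (range \<phi>) \<Longrightarrow> (LINT x|M. \<phi> x *\<^sub>R v x) = 0"
    and A: "A \<in> sets borel"
  shows "(LINT x|M. indicat_real A x *\<^sub>R v x) = 0"
proof -
  have meas: "indicat_real B \<in> borel_measurable M" if "B \<in> sets borel" for B :: "'a set"
    using measurable_compose[OF id borel_measurable_indicator[OF that]] .
  have int: "integrable M (\<lambda>x. indicat_real B x *\<^sub>R v x)" if B: "B \<in> sets borel" for B
  proof (rule Bochner_Integration.integrable_bound[OF v])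
    note [measurable] = meas[OF B] borel_measurable_integrable[OF v]
    show "(\<lambda>x. indicat_real B x *\<^sub>R v x) \<in> borel_measurable M"
      by measurable
  qed (auto split: split_indicator)
  have total: "(LINT x|M. v x) = 0"
    using test[of "\<lambda>_. 1"] by simp
  have stable: "Int_stable (Collect closed :: 'a set set)" "Collect closed \<subseteq> Pow (UNIV :: 'a set)"
    by (auto simp: Int_stable_def)
  have "A \<in> sigma_sets UNIV (Collect closed)"
    using A by (simp add: borel_eq_closed)
  then show ?thesis
  proof (induction rule: sigma_sets_induct_disjoint[OF stable, consumes 1, case_names basic empty compl union])
    case (basic C)
    then have C: "closed C" by simp
    show ?case
    proof (cases "C = {}")
      case False
      define \<phi> where "\<phi> n x = max 0 (1 - real n * infdist x C)" for n x
      have cont: "continuous_on UNIV (\<phi> n)" for n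
        unfolding \<phi>_def by (intro continuous_intros continuous_on_infdist)
      have bd: "0 \<le> \<phi> n x" "\<phi> n x \<le> 1" for n x
        using infdist_nonneg[of x C] by (auto simp: \<phi>_def)
      have lim: "(\<lambda>n. \<phi> n x) \<longlonglongrightarrow> indicat_real C x" for x
      proof (cases "x \<in> C")
        case True
        then show ?thesis by (simp add: \<phi>_def)
      next
        case x: False
        then have pos: "0 < infdist x C"
          using infdist_pos_not_in_closed[OF C False] by simp
        then obtain n0 where n0: "1 < real n0 * infdist x C"
          using reals_Archimedean3 by blast
        have "\<phi> n x = 0" if "n0 \<le> n" for n
        proof -
          have "real n0 * infdist x C \<le> real n * infdist x C"
            using that pos by (intro mult_right_mono) auto
          with n0 show ?thesis by (simp add: \<phi>_def)
        qed
        then have "\<forall>\<^sub>F n in sequentially. \<phi> n x = indicat_real C x"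
          using x by (auto simp: eventually_sequentially)
        then show ?thesis by (rule tendsto_eventually)
      qed
      have "(\<lambda>n. LINT x|M. \<phi> n x *\<^sub>R v x) \<longlonglongrightarrow> (LINT x|M. indicat_real C x *\<^sub>R v x)"
      proof (rule integral_dominated_convergence[where w = "\<lambda>x. norm (v x)"])
        have [measurable]: "\<phi> n \<in> borel_measurable M" for n
          using measurable_compose[OF id borel_measurable_continuous_onI[OF cont]] .
        note [measurable] = borel_measurable_integrable[OF v] meas[OF borel_closed[OF C]]
        show "(\<lambda>x. indicat_real C x *\<^sub>R v x) \<in> borel_measurable M" "(\<lambda>x. \<phi> n x *\<^sub>R v x) \<in> borel_measurable M" for n
          by measurable
        show "AE x in M. (\<lambda>n. \<phi> n x *\<^sub>R v x) \<longlonglongrightarrow> indicat_real C x *\<^sub>R v x"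
          by (intro AE_I2 tendsto_scaleR lim tendsto_const)
        show "AE x in M. norm (\<phi> n x *\<^sub>R v x) \<le> norm (v x)" for n
          using bd by (intro AE_I2) (simp add: mult_left_le_one_le)
      qed (use v in simp)
      moreover have "(LINT x|M. \<phi> n x *\<^sub>R v x) = 0" for n
        using bd by (intro test cont) (auto simp: bounded_iff intro!: exI[of _ 1])
      ultimately show ?thesis
        by (simp add: LIMSEQ_const_iff)
    qed simp
  next
    case empty
    then show ?case by simp
  next
    case (compl B)
    then have B: "B \<in> sets borel" by (simp add: borel_eq_closed)
    have "(LINT x|M. indicat_real (UNIV - B) x *\<^sub>R v x) = (LINT x|M. v x - indicat_real B x *\<^sub>R v x)"
      by (rule Bochner_Integration.integral_cong) (auto simp: indicator_def)
    also have "\<dots> = 0"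
      using int[OF B] v total compl by simp
    finally show ?case .
  next
    case (union B)
    then have B: "\<And>i. B i \<in> sets borel" by (auto simp: borel_eq_closed)
    then have U: "(\<Union>i. B i) \<in> sets borel" by auto
    have "(\<lambda>n. LINT x|M. indicat_real (\<Union>i<n. B i) x *\<^sub>R v x) \<longlonglongrightarrow> (LINT x|M. indicat_real (\<Union>i. B i) x *\<^sub>R v x)"
    proof (rule integral_dominated_convergence[where w = "\<lambda>x. norm (v x)"])
      show "(\<lambda>x. indicat_real (\<Union>i. B i) x *\<^sub>R v x) \<in> borel_measurable M"
        "(\<lambda>x. indicat_real (\<Union>i<n. B i) x *\<^sub>R v x) \<in> borel_measurable M" for n
        using int[OF U] int[of "\<Union>i<n. B i"] B by auto
      show "AE x in M. (\<lambda>n. indicat_real (\<Union>i<n. B i) x *\<^sub>R v x) \<longlonglongrightarrow> indicat_real (\<Union>i. B i) x *\<^sub>R v x"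
        by (intro AE_I2 tendsto_scaleR LIMSEQ_indicator_UN tendsto_const)
      show "AE x in M. norm (indicat_real (\<Union>i<n. B i) x *\<^sub>R v x) \<le> norm (v x)" for n
        by (intro AE_I2) (auto split: split_indicator)
    qed (use v in simp)
    moreover have "(LINT x|M. indicat_real (\<Union>i<n. B i) x *\<^sub>R v x) = 0" for n
    proof -
      have "indicat_real (\<Union>i<n. B i) x = (\<Sum>i<n. indicat_real (B i) x)" for x
        using indicator_UN_disjoint[of "{..<n}" B x] union(1)
        by (simp add: disjoint_family_on_def)
      then have "(LINT x|M. indicat_real (\<Union>i<n. B i) x *\<^sub>R v x) = (LINT x|M. (\<Sum>i<n. indicat_real (B i) x *\<^sub>R v x))"
        by (simp only: scaleR_sum_left)
      also have "\<dots> = (\<Sum>i<n. LINT x|M. indicat_real (B i) x *\<^sub>R v x)"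
        by (rule Bochner_Integration.integral_sum) (rule int[OF B])
      finally have "(LINT x|M. indicat_real (\<Union>i<n. B i) x *\<^sub>R v x) = (\<Sum>i<n. LINT x|M. indicat_real (B i) x *\<^sub>R v x)" .
      then show ?thesis
        using union by simp
    qed
    ultimately show ?case
      by (simp add: LIMSEQ_const_iff)
  qed
qed

text \<open>
  Integrate over the set where a real functional of \<open>v\<close> is positive. The hypothesis on measurable sets
  covers both a Borel measure and the restriction of one to a Borel set.
\<close>

lemma tested_zero_imp_AE_zero:
  fixes v :: "'a::metric_space \<Rightarrow> complex"
  assumes id: "(\<lambda>x. x) \<in> borel_measurable M" and v: "integrable M v"
    and sets: "\<And>B. B \<in> sets M \<Longrightarrow> \<exists>A\<in>sets borel. B = A \<inter> space M"
    and test: "\<And>\<phi> :: 'a \<Rightarrow> real. continuous_on UNIV \<phi> \<Longrightarrow> bounded (range \<phi>) \<Longrightarrow> (LINT x|M. \<phi> x *\<^sub>R v x) = 0"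
  shows "AE x in M. v x = 0"
proof -
  have part: "AE x in M. f (v x) \<le> 0" if f: "bounded_linear f" for f :: "complex \<Rightarrow> real"
  proof -
    have fv: "integrable M (\<lambda>x. f (v x))"
      using v by (rule integrable_bounded_linear[OF f])
    note [measurable] = borel_measurable_integrable[OF fv]
    have "{x \<in> space M. 0 < f (v x)} \<in> sets M"
      by measurable
    then obtain A where A: "A \<in> sets borel" "{x \<in> space M. 0 < f (v x)} = A \<inter> space M"
      using sets by meson
    have int: "integrable M (\<lambda>x. indicat_real A x *\<^sub>R v x)"
    proof (rule Bochner_Integration.integrable_bound[OF v])
      note [measurable] = measurable_compose[OF id borel_measurable_indicator[OF A(1)]]
        borel_measurable_integrable[OF v]
      show "(\<lambda>x. indicat_real A x *\<^sub>R v x) \<in> borel_measurable M"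
        by measurable
    qed (auto split: split_indicator)
    interpret f: bounded_linear f by (rule f)
    have mem: "x \<in> A \<longleftrightarrow> 0 < f (v x)" if "x \<in> space M" for x
      using A(2) that by blast
    have pos: "0 \<le> f (indicat_real A x *\<^sub>R v x)" if "x \<in> space M" for x
      using mem[OF that] by (cases "x \<in> A") (auto simp: f.zero intro: less_imp_le)
    have "(LINT x|M. f (indicat_real A x *\<^sub>R v x)) = 0"
      using integral_bounded_linear[OF f int] tested_zero_on_borel[OF id v test A(1)] f.zero by simp
    then have "AE x in M. f (indicat_real A x *\<^sub>R v x) = 0"
      using integral_nonneg_eq_0_iff_AE[OF integrable_bounded_linear[OF f int]] pos by auto
    then show ?thesis
      using AE_space
    proof eventually_elim
      case (elim x)
      then show ?case
        using mem[OF elim(2)] by (cases "x \<in> A") auto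
    qed
  qed
  have "AE x in M. Re (v x) \<le> 0" "AE x in M. Im (v x) \<le> 0"
    "AE x in M. - Re (v x) \<le> 0" "AE x in M. - Im (v x) \<le> 0"
    by (rule part[of Re] part[of Im] part[of "\<lambda>z. - Re z"] part[of "\<lambda>z. - Im z"],
        intro bounded_linear_Re bounded_linear_Im bounded_linear_minus)+
  then show ?thesis
    by eventually_elim (simp add: complex_eq_iff)
qed

lemma tested_zero_on_interval:
  fixes v :: "real \<Rightarrow> complex"
  assumes v: "integrable (interval_lebesgue a b) v"
    and test: "\<And>\<phi> :: real \<Rightarrow> real. continuous_on UNIV \<phi> \<Longrightarrow> (LINT x|interval_lebesgue a b. \<phi> x *\<^sub>R v x) = 0"
  shows "AE x in interval_lebesgue a b. v x = 0"
proof (rule tested_zero_imp_AE_zero[OF _ v])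
  show "(\<lambda>x. x) \<in> borel_measurable (interval_lebesgue a b)"
    by (intro borel_measurable_interval_continuous continuous_on_id)
  show "\<exists>A\<in>sets borel. B = A \<inter> space (interval_lebesgue a b)" if "B \<in> sets (interval_lebesgue a b)" for B
    using that by (auto simp: sets_restrict_space space_restrict_space)
qed (rule test)

section \<open>Weak derivatives on an interval\<close>

lemma antiderivative_exists:
  fixes f :: "real \<Rightarrow> real"
  assumes f: "continuous_on UNIV f"
  obtains F where "\<And>x. (F has_real_derivative f x) (at x)"
proof
  fix x :: real
  let ?a = "min 0 x - 1" and ?b = "max 0 x + 1"
  have "((\<lambda>u. LBINT y=ereal 0..ereal u. f y) has_vector_derivative f x) (at x within {?a..?b})"
    by (rule interval_integral_FTC2) (auto intro: continuous_on_subset[OF f])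
  moreover have "at x within {?a..?b} = at x"
    by (rule at_within_interior) (auto simp: interior_atLeastAtMost_real)
  ultimately show "((\<lambda>u. LBINT y=ereal 0..ereal u. f y) has_real_derivative f x) (at x)"
    by (simp add: has_real_derivative_iff_has_vector_derivative)
qed

text \<open>
  The test functions are not required to vanish at the ends, so the weak derivative also encodes
  that the boundary values of \<open>G\<close> are zero. For the proof, an arbitrary continuous function is written
  as the derivative of a test function.
\<close>

lemma weak_derivative_interval:
  fixes g g' :: "real \<Rightarrow> complex"
  assumes ab: "a < b" and g: "integrable (interval_lebesgue a b) g" and g': "integrable (interval_lebesgue a b) g'"
    and weak: "\<And>q q'. (\<And>x. (q has_real_derivative q' x) (at x)) \<Longrightarrow> continuous_on UNIV q' \<Longrightarrow>
      (LINT x|interval_lebesgue a b. q' x *\<^sub>R g x) = - (LINT x|interval_lebesgue a b. q x *\<^sub>R g' x)"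
  obtains G where "abs_cont a b G g'" "G a = 0" "G b = 0" "AE x in interval_lebesgue a b. g x = G x"
proof -
  let ?I = "interval_lebesgue a b"
  define G where "G x = (LINT y|?I. indicat_real {..x} y *\<^sub>R g' y)" for x
  have Ga: "G a = 0"
  proof -
    have "AE y in ?I. indicat_real {..a} y *\<^sub>R g' y = 0"
      using AE_interval_lebesgue_neq[of a a b] AE_space[of ?I]
      by eventually_elim (auto simp: indicator_def space_restrict_space)
    then show ?thesis
      unfolding G_def by (rule integral_eq_zero_AE)
  qed
  have G: "abs_cont a b G g'"
    unfolding abs_cont_def using g' Ga by (simp add: G_def)
  have "(LINT x|?I. g' x) = 0"
    using weak[of "\<lambda>_. 1" "\<lambda>_. 0"] by (auto simp: continuous_on_const)
  then have Gb: "G b = 0"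
    using abs_cont_integral[OF G] ab Ga by simp
  have Gint: "integrable ?I G"
    by (intro sq_integrable_imp_integrable sq_integrable_continuous abs_cont_continuous_on[OF G])
  have scal: "integrable ?I (\<lambda>x. \<xi> x *\<^sub>R w x)" if \<xi>: "continuous_on UNIV \<xi>" and w: "integrable ?I w"
    for \<xi> :: "real \<Rightarrow> real" and w :: "real \<Rightarrow> complex"
  proof -
    have "bounded (\<xi> ` {a..b})"
      by (intro compact_imp_bounded compact_continuous_image continuous_on_subset[OF \<xi>]) auto
    then obtain B where B: "\<And>x. x \<in> {a..b} \<Longrightarrow> \<bar>\<xi> x\<bar> \<le> B"
      unfolding bounded_iff real_norm_def by blast
    note [measurable] = borel_measurable_interval_continuous[OF continuous_on_subset[OF \<xi> subset_UNIV]]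
      borel_measurable_integrable[OF w]
    show ?thesis
    proof (rule Bochner_Integration.integrable_bound)
      show "integrable ?I (\<lambda>x. B * norm (w x))"
        using w by simp
      show "AE x in ?I. norm (\<xi> x *\<^sub>R w x) \<le> norm (B * norm (w x))"
      proof (rule AE_I2)
        fix x assume "x \<in> space ?I"
        then have "\<bar>\<xi> x\<bar> * norm (w x) \<le> B * norm (w x)"
          by (intro mult_right_mono B) (auto simp: space_restrict_space)
        then show "norm (\<xi> x *\<^sub>R w x) \<le> norm (B * norm (w x))"
          by simp
      qed
    qed measurable
  qed
  have "AE x in ?I. g x - G x = 0"
  proof (rule tested_zero_on_interval)
    show "integrable ?I (\<lambda>x. g x - G x)"
      using g Gint by simp
    fix \<xi> :: "real \<Rightarrow> real" assume \<xi>: "continuous_on UNIV \<xi>"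
    obtain q where q: "\<And>x. (q has_real_derivative \<xi> x) (at x)"
      using antiderivative_exists[OF \<xi>] by blast
    have qcont: "continuous_on UNIV q"
      using q by (meson DERIV_isCont continuous_at_imp_continuous_on)
    have "abs_cont a b q \<xi>"
      by (rule abs_contI_C1)
        (use q in \<open>auto simp: has_real_derivative_iff_has_vector_derivative intro: continuous_on_subset[OF \<xi>]\<close>)
    from abs_cont_product[OF bounded_bilinear_scaleR this G]
    have "q b *\<^sub>R G b - q a *\<^sub>R G a = (LINT x|?I. q x *\<^sub>R g' x) + (LINT x|?I. \<xi> x *\<^sub>R G x)"
      by (rule abs_cont_integral_split(2)) (use ab scal[OF qcont g'] in auto)
    then have "(LINT x|?I. \<xi> x *\<^sub>R G x) = (LINT x|?I. \<xi> x *\<^sub>R g x)"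
      using weak[OF q \<xi>] Ga Gb by (simp add: add_eq_0_iff)
    then show "(LINT x|?I. \<xi> x *\<^sub>R (g x - G x)) = 0"
      using scal[OF \<xi> g] scal[OF \<xi> Gint] by (simp add: scaleR_diff_right)
  qed
  then have "AE x in ?I. g x = G x"
    by simp
  with G Ga Gb show thesis
    by (rule that)
qed


section \<open>Radial functions in the height coordinate\<close>

lemma AE_lborel_uminus:
  assumes "AE x in lborel. P (x :: real)"
  shows "AE x in lborel. P (- x)"
proof -
  have "AE x in distr lborel borel (uminus :: real \<Rightarrow> real). P x"
    using assms unfolding lborel_distr_uminus .
  then show ?thesis
    by (rule AE_distrD[rotated]) simp
qed

lemma AE_interval_uminus:
  assumes "AE x in interval_lebesgue (- a) a. P x"
  shows "AE x in interval_lebesgue (- a) a. P (- x)"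
proof -
  have "AE x in lborel. x \<in> {- a..a} \<longrightarrow> P x"
    using assms by (simp add: AE_restrict_space_iff)
  from AE_lborel_uminus[OF this] show ?thesis
    by (auto simp: AE_restrict_space_iff elim: eventually_mono)
qed

lemma AE_interval_subset:
  assumes "AE x in interval_lebesgue a b. P x" "a \<le> c" "d \<le> b"
  shows "AE x in interval_lebesgue c d. P x"
  using assms by (auto simp: AE_restrict_space_iff elim: eventually_mono)

lemma AE_interval_obtain:
  assumes "AE x in interval_lebesgue a b. P x" "a \<le> c" "c < d" "d \<le> b"
  obtains x where "x \<in> {c<..<d}" "P x"
proof -
  have "AE x in lborel. x \<in> {a..b} \<longrightarrow> P x"
    using assms(1) by (simp add: AE_restrict_space_iff)
  have "\<exists>x\<in>{c<..<d}. P x"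
  proof (rule ccontr)
    assume "\<not> ?thesis"
    then have "AE x in lborel. x \<notin> {c<..<d}"
      using \<open>AE x in lborel. x \<in> {a..b} \<longrightarrow> P x\<close> assms by (auto elim!: eventually_mono)
    then have "emeasure lborel {c<..<d} = 0"
      by (subst (asm) AE_iff_measurable[of "{c<..<d}"]) auto
    with assms(3) show False by simp
  qed
  then show thesis using that by blast
qed

lemma AE_zero_imp_zero:
  fixes f :: "real \<Rightarrow> 'a::real_normed_vector"
  assumes f: "continuous_on {a<..<b} f" and ae: "AE x in interval_lebesgue a b. f x = 0" and x: "x \<in> {a<..<b}"
  shows "f x = 0"
proof (rule ccontr)
  assume "f x \<noteq> 0"
  have op: "open (f -` (- {0}) \<inter> {a<..<b})"
    using f by (subst (asm) continuous_on_open_vimage) auto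
  have "x \<in> f -` (- {0}) \<inter> {a<..<b}"
    using x \<open>f x \<noteq> 0\<close> by simp
  then obtain e where e: "0 < e" "ball x e \<subseteq> f -` (- {0}) \<inter> {a<..<b}"
    using openE[OF op] by blast
  have sub: "{x<..<x + e} \<subseteq> ball x e"
    by (auto simp: dist_real_def)
  have "x + e \<le> b"
  proof (rule ccontr)
    assume "\<not> x + e \<le> b"
    then have "b \<in> {x<..<x + e}" using x by auto
    with sub e(2) have "b \<in> {a<..<b}" by blast
    then show False by simp
  qed
  then obtain y where "y \<in> {x<..<x + e}" "f y = 0"
    using AE_interval_obtain[OF ae, of x "x + e"] x e(1) by auto
  with sub e(2) show False by blast
qed

lemma integral_interval_restrict:
  fixes f :: "real \<Rightarrow> 'b::euclidean_space"
  assumes "a \<le> c" "d \<le> b"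
  shows "(LINT x|interval_lebesgue c d. f x) = (LINT x|interval_lebesgue a b. indicat_real {c..d} x *\<^sub>R f x)"
proof -
  have "(LINT x|interval_lebesgue a b. indicat_real {c..d} x *\<^sub>R f x) =
      (LINT x|lborel. indicat_real {a..b} x *\<^sub>R indicat_real {c..d} x *\<^sub>R f x)"
    by (simp add: integral_restrict_space)
  also have "\<dots> = (LINT x|lborel. indicat_real {c..d} x *\<^sub>R f x)"
    using assms by (intro Bochner_Integration.integral_cong refl) (auto simp: indicator_def)
  finally show ?thesis
    by (simp add: integral_restrict_space)
qed

lemma integrable_interval_restrict:
  fixes f :: "real \<Rightarrow> 'b::euclidean_space"
  assumes "integrable (interval_lebesgue a b) f" "a \<le> c" "d \<le> b"
  shows "integrable (interval_lebesgue c d) f"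
proof -
  have "set_integrable lborel {a..b} f"
    using assms(1) by (simp add: integrable_restrict_space set_integrable_def)
  then have "set_integrable lborel {c..d} f"
    by (rule set_integrable_subset) (use assms in auto)
  then show ?thesis
    by (simp add: integrable_restrict_space set_integrable_def)
qed

lemma sq_integrable_interval_restrict:
  fixes f :: "real \<Rightarrow> complex"
  assumes "sq_integrable (interval_lebesgue a b) f" "a \<le> c" "d \<le> b"
  shows "sq_integrable (interval_lebesgue c d) f"
  using integrable_interval_restrict[OF sq_integrable_imp_integrable[OF assms(1)] assms(2,3)]
    integrable_interval_restrict[OF sq_integrable_square[OF assms(1)] assms(2,3)]
  by (auto simp: sq_integrable_def)

lemma l2norm_interval_restrict:
  fixes f :: "real \<Rightarrow> complex"
  assumes "sq_integrable (interval_lebesgue a b) f" "a \<le> c" "d \<le> b"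
  shows "l2norm (interval_lebesgue c d) f \<le> l2norm (interval_lebesgue a b) f"
proof -
  have "(LINT x|interval_lebesgue c d. (norm (f x))\<^sup>2) = (LINT x|interval_lebesgue a b. indicat_real {c..d} x *\<^sub>R (norm (f x))\<^sup>2)"
    by (rule integral_interval_restrict) (use assms in auto)
  also have "\<dots> \<le> (LINT x|interval_lebesgue a b. (norm (f x))\<^sup>2)"
    using integrable_interval_indicator[OF sq_integrable_square[OF assms(1)], of "{c..d}"] sq_integrable_square[OF assms(1)]
    by (intro integral_mono) (auto split: split_indicator)
  finally show ?thesis
    by (simp add: l2norm_def)
qed

lemma integral_even:
  fixes f :: "real \<Rightarrow> real"
  assumes f: "integrable (interval_lebesgue (- 1) 1) f" and even: "AE x in interval_lebesgue (- 1) 1. f (- x) = f x"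
  shows "(LINT x|interval_lebesgue (- 1) 1. f x) = 2 * (LINT x|hemi. f x)"
proof -
  have set_int: "set_integrable lborel {- 1..1} f"
    using f by (simp add: integrable_restrict_space set_integrable_def)
  have pos: "set_integrable lborel {0..1} f" and neg: "set_integrable lborel {- 1..0} f"
    by (rule set_integrable_subset[OF set_int]; simp)+
  have meas[measurable]: "(\<lambda>x. indicat_real {0..1} x *\<^sub>R f x) \<in> borel_measurable lborel"
    "(\<lambda>x. indicat_real {- 1..0} x *\<^sub>R f x) \<in> borel_measurable lborel"
    using pos neg unfolding set_integrable_def by auto
  have ae: "AE x in lborel. x \<in> {- 1..1} \<longrightarrow> f (- x) = f x"
    using even by (simp add: AE_restrict_space_iff)
  have "(LINT x|interval_lebesgue (- 1) 1. f x) = (LINT x|lborel. indicat_real {- 1..1} x *\<^sub>R f x)"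
    by (simp add: integral_restrict_space)
  also have "\<dots> = (LINT x|lborel. indicat_real {- 1..0} x *\<^sub>R f x + indicat_real {0..1} x *\<^sub>R f x)"
  proof (rule integral_cong_AE)
    show "AE x in lborel. indicat_real {- 1..1} x *\<^sub>R f x = indicat_real {- 1..0} x *\<^sub>R f x + indicat_real {0..1} x *\<^sub>R f x"
      using AE_lborel_singleton[of 0] by eventually_elim (auto simp: indicator_def)
    show "(\<lambda>x. indicat_real {- 1..1} x *\<^sub>R f x) \<in> borel_measurable lborel"
      using set_int unfolding set_integrable_def by (rule borel_measurable_integrable)
  qed measurable
  also have "\<dots> = (LINT x|lborel. indicat_real {- 1..0} x *\<^sub>R f x) + (LINT x|lborel. indicat_real {0..1} x *\<^sub>R f x)"
    using pos neg by (simp add: set_integrable_def)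
  also have "(LINT x|lborel. indicat_real {- 1..0} x *\<^sub>R f x) = (LINT x|lborel. indicat_real {- 1..0} (- x) *\<^sub>R f (- x))"
    using lborel_integral_real_affine[of "-1" "\<lambda>x. indicat_real {- 1..0} x *\<^sub>R f x" 0] by simp
  also have "\<dots> = (LINT x|lborel. indicat_real {0..1} x *\<^sub>R f x)"
  proof (rule integral_cong_AE)
    show "AE x in lborel. indicat_real {- 1..0} (- x) *\<^sub>R f (- x) = indicat_real {0..1} x *\<^sub>R f x"
      using ae by eventually_elim (auto simp: indicator_def)
    show "(\<lambda>x. indicat_real {- 1..0} (- x) *\<^sub>R f (- x)) \<in> borel_measurable lborel"
      by (rule measurable_compose[OF _ meas(2)]) simp
  qed (rule meas)
  finally show ?thesis
    by (simp add: integral_restrict_space)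
qed

lemma abs_cont_cong_AE:
  fixes f :: "real \<Rightarrow> 'b::euclidean_space"
  assumes F: "abs_cont a b F f" and f': "f' \<in> borel_measurable (interval_lebesgue a b)"
    and ae: "AE x in interval_lebesgue a b. f x = f' x"
  shows "abs_cont a b F f'"
  unfolding abs_cont_def
proof (intro conjI ballI)
  note f = abs_cont_integrable[OF F]
  show f'i: "integrable (interval_lebesgue a b) f'"
    using f integrable_cong_AE[OF borel_measurable_integrable[OF f] f' ae] by simp
  fix x assume "x \<in> {a..b}"
  have "(LINT y|interval_lebesgue a b. indicat_real {..x} y *\<^sub>R f y) =
      (LINT y|interval_lebesgue a b. indicat_real {..x} y *\<^sub>R f' y)"
    by (rule integral_cong_AE)
      (use ae in \<open>auto intro!: borel_measurable_integrable integrable_interval_indicator f f'i elim!: eventually_mono\<close>)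
  with abs_contD[OF F \<open>x \<in> {a..b}\<close>]
  show "F x = F a + (LINT y|interval_lebesgue a b. indicat_real {..x} y *\<^sub>R f' y)" by simp
qed

abbreviation meridian :: "real measure" where
  "meridian \<equiv> interval_lebesgue (- 1) 1"

text \<open>
  The circle averages of a radial function \<open>h\<close>, of the third component \<open>k\<close> of its weak gradient and of
  its Laplacian \<open>l\<close>, as functions of the height. The two weak identities say that \<open>k = (1 - z\<^sup>2) h'\<close> and
  \<open>l = k'\<close>, and that \<open>(1 - z\<^sup>2) h\<close> and \<open>k\<close> vanish at both poles.
\<close>

locale weak_radial =
  fixes h k l :: "real \<Rightarrow> complex"
  assumes h_sq: "sq_integrable meridian h"
    and k_sq: "sq_integrable meridian k"
    and l_sq: "sq_integrable meridian l"
    and weak_gradient: "\<And>q q'. (\<And>x. (q has_real_derivative q' x) (at x)) \<Longrightarrow> continuous_on UNIV q' \<Longrightarrow>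
      (LINT z|meridian. ((1 - z\<^sup>2) * q' z) *\<^sub>R h z) =
        - (LINT z|meridian. q z *\<^sub>R k z) + (LINT z|meridian. (2 * z * q z) *\<^sub>R h z)"
    and weak_laplacian: "\<And>q q'. (\<And>x. (q has_real_derivative q' x) (at x)) \<Longrightarrow> continuous_on UNIV q' \<Longrightarrow>
      (LINT z|meridian. q' z *\<^sub>R k z) = - (LINT z|meridian. q z *\<^sub>R l z)"
    and odd: "AE z in meridian. h (- z) = - h z"
begin

lemma unit_l_sq: "sq_integrable hemi l"
  by (rule sq_integrable_interval_restrict[OF l_sq]) auto

lemma flux_representative:
  obtains K where "abs_cont (- 1) 1 K l" "K 1 = 0" "AE z in meridian. k z = K z"
    "\<And>z. z \<in> {0..1} \<Longrightarrow> K z = flux l z"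
proof -
  note kint = sq_integrable_imp_integrable[OF k_sq] and lint = sq_integrable_imp_integrable[OF l_sq]
  obtain K where K: "abs_cont (- 1) 1 K l" "K 1 = 0" "AE z in meridian. k z = K z"
    using weak_derivative_interval[OF _ kint lint weak_laplacian] by auto
  have "K z = flux l z" if z: "z \<in> {0..1}" for z
  proof -
    have "(LINT y|meridian. l y) = (LINT y|meridian. indicat_real {..z} y *\<^sub>R l y + indicat_real {z<..} y *\<^sub>R l y)"
      by (rule Bochner_Integration.integral_cong) (auto simp: indicator_def)
    also have "\<dots> = (LINT y|meridian. indicat_real {..z} y *\<^sub>R l y) + (LINT y|meridian. indicat_real {z<..} y *\<^sub>R l y)"
      using integrable_interval_indicator[OF lint] by simp
    finally have "K z = K 1 - (LINT y|meridian. indicat_real {z<..} y *\<^sub>R l y)"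
      using abs_contD[OF K(1), of z] abs_cont_integral[OF K(1)] z by (simp add: algebra_simps)
    also have "(LINT y|meridian. indicat_real {z<..} y *\<^sub>R l y) =
        (LINT y|meridian. indicat_real {0..1} y *\<^sub>R (indicat_real {z<..} y *\<^sub>R l y))"
      by (rule Bochner_Integration.integral_cong) (use z in \<open>auto simp: indicator_def space_restrict_space\<close>)
    also have "\<dots> = (LINT y|hemi. indicat_real {z<..} y *\<^sub>R l y)"
      by (rule integral_interval_restrict[symmetric]) auto
    finally show ?thesis
      using K(2) by (simp add: flux_def)
  qed
  with K show thesis using that by blast
qed

text \<open>
  The first weak identity determines the derivative of \<open>P = (1 - z\<^sup>2) h\<close>. Away from the poles \<open>P\<close> can be
  divided by \<open>1 - z\<^sup>2\<close>, and the second one makes the resulting derivative of \<open>h\<close> continuous.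
\<close>

lemma profile_representative:
  obtains K H where "abs_cont (- 1) 1 K l" "AE z in meridian. k z = K z" "\<And>z. z \<in> {0..1} \<Longrightarrow> K z = flux l z"
    "AE z in meridian. h z = H z" "continuous_on {- 1<..<1} H"
    "\<And>z. z \<in> {- 1<..<1} \<Longrightarrow> (H has_vector_derivative (K z /\<^sub>R (1 - z\<^sup>2))) (at z)"
proof -
  obtain K where K: "abs_cont (- 1) 1 K l" "K 1 = 0" "AE z in meridian. k z = K z"
    "\<And>z. z \<in> {0..1} \<Longrightarrow> K z = flux l z"
    using flux_representative by blast
  note kint = sq_integrable_imp_integrable[OF k_sq] and hint = sq_integrable_imp_integrable[OF h_sq]
  have cont_int: "integrable meridian (\<lambda>z. r z *\<^sub>R w z)"
    if r: "continuous_on {- 1..1} r" and w: "sq_integrable meridian w" for r :: "real \<Rightarrow> real" and w :: "real \<Rightarrow> complex"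
  proof -
    have "bounded (r ` {- 1..1})"
      by (intro compact_imp_bounded compact_continuous_image r compact_Icc)
    then obtain B where B: "\<And>z. z \<in> {- 1..1} \<Longrightarrow> \<bar>r z\<bar> \<le> B"
      unfolding bounded_iff real_norm_def by blast
    note [measurable] = borel_measurable_interval_continuous[OF r] sq_integrable_measurable[OF w]
    have "sq_integrable meridian (\<lambda>z. r z *\<^sub>R w z)"
    proof (rule sq_integrable_bound[OF w])
      show "AE z in meridian. norm (r z *\<^sub>R w z) \<le> B * norm (w z)"
        using B by (intro AE_I2) (auto simp: space_restrict_space intro!: mult_right_mono)
    qed measurable
    then show ?thesis by (rule sq_integrable_imp_integrable)
  qed
  have Pint: "integrable meridian (\<lambda>z. (1 - z\<^sup>2) *\<^sub>R h z)" "integrable meridian (\<lambda>z. k z - (2 * z) *\<^sub>R h z)"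
    by (intro cont_int h_sq continuous_intros Bochner_Integration.integrable_diff kint)+
  obtain P where P: "abs_cont (- 1) 1 P (\<lambda>z. k z - (2 * z) *\<^sub>R h z)"
    "AE z in meridian. (1 - z\<^sup>2) *\<^sub>R h z = P z"
  proof (rule weak_derivative_interval[OF _ Pint])
    fix q q' :: "real \<Rightarrow> real"
    assume q: "\<And>x. (q has_real_derivative q' x) (at x)" "continuous_on UNIV q'"
    have qc: "continuous_on {- 1..1} q"
      using q(1) by (meson DERIV_isCont continuous_at_imp_continuous_on)
    have "(LINT z|meridian. q z *\<^sub>R (k z - (2 * z) *\<^sub>R h z)) =
        (LINT z|meridian. q z *\<^sub>R k z - (2 * z * q z) *\<^sub>R h z)"
      by (simp add: scaleR_diff_right mult.commute)
    also have "\<dots> = (LINT z|meridian. q z *\<^sub>R k z) - (LINT z|meridian. (2 * z * q z) *\<^sub>R h z)"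
      by (intro Bochner_Integration.integral_diff cont_int k_sq h_sq continuous_intros qc)
    finally show "(LINT z|meridian. q' z *\<^sub>R (1 - z\<^sup>2) *\<^sub>R h z) =
        - (LINT z|meridian. q z *\<^sub>R (k z - (2 * z) *\<^sub>R h z))"
      using weak_gradient[OF q] by (simp add: mult.commute)
  qed auto
  define H where "H z = P z /\<^sub>R (1 - z\<^sup>2)" for z
  have pos: "0 < 1 - z\<^sup>2" if "z \<in> {- 1<..<1}" for z :: real
    using that by (simp add: abs_square_less_1 abs_less_iff)
  have Pc: "continuous_on {- 1<..<1} P"
    using abs_cont_continuous_on[OF P(1)] by (rule continuous_on_subset) auto
  have Kc: "continuous_on {- 1<..<1} K"
    using abs_cont_continuous_on[OF K(1)] by (rule continuous_on_subset) auto
  have Hc: "continuous_on {- 1<..<1} H"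
    unfolding H_def using pos by (intro continuous_intros Pc) fastforce
  have hH: "AE z in meridian. h z = H z"
    using P(2) AE_space[of meridian] AE_interval_lebesgue_neq[of "-1" "-1" 1] AE_interval_lebesgue_neq[of 1 "-1" 1]
  proof eventually_elim
    case (elim z)
    then have "0 < 1 - z\<^sup>2"
      by (intro pos) (auto simp: space_restrict_space)
    then show ?case
      using elim(1)[symmetric] by (simp add: H_def)
  qed
  have P': "abs_cont (- 1) 1 P (\<lambda>z. K z - (2 * z) *\<^sub>R H z)"
  proof (rule abs_cont_cong_AE[OF P(1)])
    show "AE z in meridian. k z - (2 * z) *\<^sub>R h z = K z - (2 * z) *\<^sub>R H z"
      using K(3) hH by eventually_elim simp
    have [measurable]: "H \<in> borel_measurable meridian"
    proof -
      note [measurable] = borel_measurable_interval_continuous[OF abs_cont_continuous_on[OF P(1)]]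
      have [measurable]: "(\<lambda>z. 1 - z\<^sup>2) \<in> borel_measurable meridian"
        by (intro borel_measurable_interval_continuous continuous_intros)
      show ?thesis unfolding H_def by measurable
    qed
    note [measurable] = borel_measurable_interval_continuous[OF abs_cont_continuous_on[OF K(1)]]
    have [measurable]: "(\<lambda>z. 2 * z) \<in> borel_measurable meridian"
      by (intro borel_measurable_interval_continuous continuous_intros)
    show "(\<lambda>z. K z - (2 * z) *\<^sub>R H z) \<in> borel_measurable meridian"
      by measurable
  qed
  have "(H has_vector_derivative (K z /\<^sub>R (1 - z\<^sup>2))) (at z)" if z: "z \<in> {- 1<..<1}" for z
  proof -
    have Pd: "(P has_vector_derivative (K z - (2 * z) *\<^sub>R H z)) (at z)"
      by (rule abs_cont_derivative[OF P' z]) (intro continuous_intros Kc Hc)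
    have inv: "((\<lambda>z. inverse (1 - z\<^sup>2)) has_real_derivative (2 * z * (inverse (1 - z\<^sup>2))\<^sup>2)) (at z)"
      using pos[OF z] by (auto intro!: derivative_eq_intros simp: power2_eq_square)
    have "(H has_vector_derivative (inverse (1 - z\<^sup>2) *\<^sub>R (K z - (2 * z) *\<^sub>R H z)
        + (2 * z * (inverse (1 - z\<^sup>2))\<^sup>2) *\<^sub>R P z)) (at z)"
      unfolding H_def by (rule has_vector_derivative_scaleR[OF inv Pd[unfolded H_def]])
    also have "inverse (1 - z\<^sup>2) *\<^sub>R (K z - (2 * z) *\<^sub>R H z) + (2 * z * (inverse (1 - z\<^sup>2))\<^sup>2) *\<^sub>R P z = K z /\<^sub>R (1 - z\<^sup>2)"
      by (simp add: H_def scaleR_diff_right power2_eq_square ac_simps)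
    finally show ?thesis .
  qed
  with K hH Hc show thesis
    using that by blast
qed

text \<open>
  The continuous representative \<open>H\<close> of \<open>h\<close> is odd, so it vanishes at 0 and is the integral of its
  derivative from there; the derivative of an odd function is even.
\<close>

lemma
  shows h_eq_profile: "AE z in hemi. h z = profile l z"
    and k_even: "AE z in meridian. k (- z) = k z"
    and k_eq_flux: "AE z in hemi. k z = flux l z"
proof -
  obtain K H where K: "abs_cont (- 1) 1 K l" "AE z in meridian. k z = K z" "\<And>z. z \<in> {0..1} \<Longrightarrow> K z = flux l z"
    and H: "AE z in meridian. h z = H z" "continuous_on {- 1<..<1} H"
    and dH: "\<And>z. z \<in> {- 1<..<1} \<Longrightarrow> (H has_vector_derivative (K z /\<^sub>R (1 - z\<^sup>2))) (at z)"
    using profile_representative by blast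
  have Hm: "continuous_on {- 1<..<1} (\<lambda>z. H (- z))"
    by (rule continuous_on_compose2[OF H(2)]) (auto intro!: continuous_intros)
  have "AE z in meridian. H (- z) + H z = 0"
    using H(1) AE_interval_uminus[OF H(1)] odd by eventually_elim (metis add.left_inverse)
  then have Hodd: "H (- z) + H z = 0" if "z \<in> {- 1<..<1}" for z
    using AE_zero_imp_zero[of "- 1" 1 "\<lambda>z. H (- z) + H z"] that continuous_on_add[OF Hm H(2)] by blast
  then have Hneg: "H (- z) = - H z" if "z \<in> {- 1<..<1}" for z
    using that by (simp add: eq_neg_iff_add_eq_0)
  have H0: "H 0 = 0"
  proof -
    have "(2 :: real) *\<^sub>R H 0 = 0"
      using Hodd[of 0] by (simp add: scaleR_2)
    then show ?thesis by simp
  qed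
  have Keven: "K (- z) = K z" if z: "z \<in> {- 1<..<1}" for z
  proof -
    have mz: "- z \<in> {- 1<..<1}" using z by auto
    have "((H \<circ> uminus) has_vector_derivative ((- 1) *\<^sub>R (K (- z) /\<^sub>R (1 - (- z)\<^sup>2)))) (at z)"
      by (rule vector_diff_chain_at) (use dH[OF mz] in \<open>auto intro!: derivative_eq_intros\<close>)
    then have "((\<lambda>w. - (H \<circ> uminus) w) has_vector_derivative - ((- 1) *\<^sub>R (K (- z) /\<^sub>R (1 - (- z)\<^sup>2)))) (at z)"
      by (rule has_vector_derivative_minus)
    then have "(H has_vector_derivative - ((- 1) *\<^sub>R (K (- z) /\<^sub>R (1 - (- z)\<^sup>2)))) (at z)"
      by (rule has_vector_derivative_transform_within_open[of _ _ _ "{- 1<..<1}"])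
        (use z Hneg in auto)
    from vector_derivative_unique_at[OF this dH[OF z]] show ?thesis
      using z by (auto simp: abs_square_eq_1 abs_if split: if_splits)
  qed
  have inner: "AE z in meridian. z \<in> {- 1<..<1}"
    using AE_space[of meridian] AE_interval_lebesgue_neq[of "-1" "-1" 1] AE_interval_lebesgue_neq[of 1 "-1" 1]
    by eventually_elim (auto simp: space_restrict_space)
  show "AE z in meridian. k (- z) = k z"
    using K(2) AE_interval_uminus[OF K(2)] inner by eventually_elim (simp add: Keven)
  have "AE z in hemi. k z = K z"
    by (rule AE_interval_subset[OF K(2)]) auto
  then show "AE z in hemi. k z = flux l z"
    using AE_space[of hemi] by eventually_elim (simp add: K(3))
  have eq: "H z = profile l z" if z: "z \<in> {0..<1}" for z
  proof -
    have 1: "((\<lambda>z. K z /\<^sub>R (1 - z\<^sup>2)) has_integral (H z - H 0)) {0..z}"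
      by (rule fundamental_theorem_of_calculus_interior)
        (use z dH in \<open>auto intro: continuous_on_subset[OF H(2)]\<close>)
    have pdc: "continuous_on {0<..<1} (profile_deriv l)"
      unfolding profile_deriv_def
    proof (intro continuous_intros ballI)
      show "continuous_on {0<..<1} (flux l)"
        using abs_cont_continuous_flux[OF unit_l_sq] by (rule continuous_on_subset) auto
      show "1 - z\<^sup>2 \<noteq> 0" if "z \<in> {0<..<1}" for z :: real
        using one_minus_square_pos[of z] that by auto
    qed
    have 2: "(profile_deriv l has_integral (profile l z - profile l 0)) {0..z}"
      by (rule fundamental_theorem_of_calculus_interior)
        (use z in \<open>auto intro: continuous_on_subset[OF continuous_on_profile[OF unit_l_sq]]
          abs_cont_derivative[OF abs_cont_profile[OF unit_l_sq] _ pdc]\<close>)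
    have "((\<lambda>z. K z /\<^sub>R (1 - z\<^sup>2)) has_integral (profile l z - profile l 0)) {0..z}"
      by (rule has_integral_eq[OF _ 2]) (use z K(3) in \<open>auto simp: profile_deriv_def\<close>)
    from has_integral_unique[OF 1 this] show ?thesis
      by (simp add: H0)
  qed
  have "AE z in hemi. h z = H z"
    by (rule AE_interval_subset[OF H(1)]) auto
  then show "AE z in hemi. h z = profile l z"
    using AE_space[of hemi] AE_interval_lebesgue_neq[of 1 0 1]
    by eventually_elim (simp add: eq)
qed

lemma gradient_energy_eq:
  assumes int: "integrable meridian (\<lambda>z. (norm (k z))\<^sup>2 / (1 - z\<^sup>2))"
  shows "(LINT z|meridian. (norm (k z))\<^sup>2 / (1 - z\<^sup>2)) = 2 * dirichlet_energy l"
proof -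
  have "(LINT z|meridian. (norm (k z))\<^sup>2 / (1 - z\<^sup>2)) = 2 * (LINT z|hemi. (norm (k z))\<^sup>2 / (1 - z\<^sup>2))"
    by (rule integral_even[OF int]) (use k_even in eventually_elim, simp)
  also have "(LINT z|hemi. (norm (k z))\<^sup>2 / (1 - z\<^sup>2)) = dirichlet_energy l"
    unfolding dirichlet_energy_def
  proof (rule integral_cong_AE)
    show "(\<lambda>z. (norm (k z))\<^sup>2 / (1 - z\<^sup>2)) \<in> borel_measurable hemi"
      using integrable_interval_restrict[OF int, of 0 1] by (intro borel_measurable_integrable) auto
    show "(\<lambda>z. flux l z \<bullet> profile_deriv l z) \<in> borel_measurable hemi"
      using green_identity(1)[OF unit_l_sq unit_l_sq] by (rule borel_measurable_integrable)
    show "AE z in hemi. (norm (k z))\<^sup>2 / (1 - z\<^sup>2) = flux l z \<bullet> profile_deriv l z"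
      using k_eq_flux by eventually_elim (simp add: profile_deriv_def power2_norm_eq_inner divide_inverse_commute)
  qed
  finally show ?thesis .
qed

lemma power_integral_eq:
  assumes int: "integrable meridian (\<lambda>z. norm (h z) powr q)"
  shows "(LINT z|meridian. norm (h z) powr q) = 2 * (LINT z|hemi. norm (profile l z) powr q)"
proof -
  have "(LINT z|meridian. norm (h z) powr q) = 2 * (LINT z|hemi. norm (h z) powr q)"
    by (rule integral_even[OF int]) (use odd in eventually_elim, simp)
  also have "(LINT z|hemi. norm (h z) powr q) = (LINT z|hemi. norm (profile l z) powr q)"
  proof (rule integral_cong_AE)
    show "(\<lambda>z. norm (h z) powr q) \<in> borel_measurable hemi"
      using integrable_interval_restrict[OF int, of 0 1] by (intro borel_measurable_integrable) auto
    note [measurable] = borel_measurable_interval_continuous[OF continuous_on_profile[OF unit_l_sq]]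
    show "(\<lambda>z. norm (profile l z) powr q) \<in> borel_measurable hemi"
      by measurable
    show "AE z in hemi. norm (h z) powr q = norm (profile l z) powr q"
      using h_eq_profile by eventually_elim simp
  qed
  finally show ?thesis .
qed

end


section \<open>The sphere in height and longitude coordinates\<close>

text \<open>
  A parallel is a circle of latitude; its measure is in the longitude \<open>\<theta>\<close>.
\<close>

abbreviation parallel :: "real measure" where
  "parallel \<equiv> interval_lebesgue 0 (2 * pi)"

definition sphere_point :: "real \<Rightarrow> real \<Rightarrow> real^3" where
  "sphere_point z \<theta> = vector [sqrt (1 - z\<^sup>2) * cos \<theta>, sqrt (1 - z\<^sup>2) * sin \<theta>, z]"

lemma continuous_on_vector3:
  fixes f g h :: "'a::topological_space \<Rightarrow> real"
  assumes "continuous_on S f" "continuous_on S g" "continuous_on S h"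
  shows "continuous_on S (\<lambda>x. vector [f x, g x, h x] :: real^3)"
proof -
  have "(\<lambda>x. vector [f x, g x, h x] :: real^3) = (\<lambda>x. \<chi> i. if i = 1 then f x else if i = 2 then g x else h x)"
    by (auto simp: vec_eq_iff forall_3)
  moreover have "continuous_on S (\<lambda>x. if i = 1 then f x else if i = 2 then g x else h x)" for i :: 3
    using assms by (cases "i = 1"; cases "i = 2") auto
  ultimately show ?thesis
    by (simp only: continuous_on_vec_lambda)
qed

lemma continuous_on_sphere_point: "continuous_on UNIV (\<lambda>p. sphere_point (fst p) (snd p))"
  unfolding sphere_point_def by (intro continuous_on_vector3 continuous_intros)

lemma sphere_point_component [simp]: "sphere_point z \<theta> $ 3 = z"
  by (simp add: sphere_point_def)

lemma north_pole_inner: "north_pole \<bullet> x = x $ 3"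
  by (simp add: north_pole_def inner_vec_def sum_3)

lemma sphere_point_norm: "\<bar>z\<bar> \<le> 1 \<Longrightarrow> sphere_point z \<theta> \<bullet> sphere_point z \<theta> = 1"
  by (simp add: sphere_point_def inner_vec_def sum_3 power_mult_distrib abs_square_le_1
      flip: power2_eq_square distrib_left add.assoc)

lemma measurable_sphere_point_borel:
  "(\<lambda>p. sphere_point (fst p) (snd p)) \<in> borel_measurable borel"
  by (rule borel_measurable_continuous_onI[OF continuous_on_sphere_point])

lemma measurable_sphere_point [measurable]:
  "(\<lambda>p. sphere_point (fst p) (snd p)) \<in> borel_measurable (meridian \<Otimes>\<^sub>M parallel)"
proof -
  have id: "(\<lambda>x. x) \<in> borel_measurable (interval_lebesgue a b)" for a b
    by (intro borel_measurable_interval_continuous continuous_on_id)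
  have "(\<lambda>p. (fst p, snd p)) \<in> measurable (meridian \<Otimes>\<^sub>M parallel) (borel \<Otimes>\<^sub>M borel)"
    by (intro measurable_Pair measurable_compose[OF measurable_fst id] measurable_compose[OF measurable_snd id])
  then show ?thesis
    using measurable_compose[OF _ measurable_sphere_point_borel, of _ "meridian \<Otimes>\<^sub>M parallel"]
    by (simp add: borel_prod)
qed

interpretation sphere: pair_sigma_finite meridian parallel
proof -
  interpret h: finite_measure meridian by (rule finite_interval_lebesgue)
  interpret c: finite_measure parallel by (rule finite_interval_lebesgue)
  show "pair_sigma_finite meridian parallel" ..
qed

text \<open>
  The substitution rule asks for an increasing function, here \<open>- cos\<close>, followed by a reflection.
\<close>

lemma nn_integral_cos_substitution:
  fixes G :: "real \<Rightarrow> ennreal"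
  assumes [measurable]: "G \<in> borel_measurable borel" and fin: "\<And>z. G z < top"
  shows "(\<integral>\<^sup>+r. G (cos r) * ennreal (sin r) * indicator {0..pi} r \<partial>lborel) = (\<integral>\<^sup>+z. G z * indicator {- 1..1} z \<partial>lborel)"
proof -
  define F where "F x = enn2real (G (- x))" for x
  have [measurable]: "F \<in> borel_measurable borel"
    unfolding F_def by measurable
  have GF: "G z = ennreal (F (- z))" for z
    using fin[of z] by (simp add: F_def)
  have "(\<integral>\<^sup>+z. G z * indicator {- 1..1} z \<partial>lborel) = (\<integral>\<^sup>+z. G z * indicator {- 1..1} z \<partial>distr lborel borel uminus)"
    by (simp only: lborel_distr_uminus)
  also have "\<dots> = (\<integral>\<^sup>+z. ennreal (F z) * indicator {- cos 0..- cos pi} z \<partial>lborel)"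
    by (subst nn_integral_distr) (auto simp: GF indicator_def intro!: nn_integral_cong)
  also have "\<dots> = (\<integral>\<^sup>+z. ennreal (F z * indicator {- cos 0..- cos pi} z) \<partial>lborel)"
    by (auto intro!: nn_integral_cong simp: indicator_def)
  also have "\<dots> = (\<integral>\<^sup>+r. ennreal (F (- cos r) * sin r * indicator {0..pi} r) \<partial>lborel)"
  proof (rule nn_integral_substitution)
    show "set_borel_measurable borel {- cos 0..- cos pi} F"
      unfolding set_borel_measurable_def by measurable
    show "((\<lambda>r. - cos r) has_real_derivative sin x) (at x)" for x
      by (auto intro!: derivative_eq_intros)
  qed (auto intro!: continuous_intros sin_ge_zero)
  also have "\<dots> = (\<integral>\<^sup>+r. G (cos r) * ennreal (sin r) * indicator {0..pi} r \<partial>lborel)"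
  proof (rule nn_integral_cong)
    fix r :: real
    have "0 \<le> F (- cos r)"
      by (simp add: F_def)
    then show "ennreal (F (- cos r) * sin r * indicator {0..pi} r) = G (cos r) * ennreal (sin r) * indicator {0..pi} r"
      using GF[of "cos r"] sin_ge_zero[of r] by (cases "r \<in> {0..pi}") (auto simp: ennreal_mult)
  qed
  finally show ?thesis ..
qed

lemma polar_point_eq:
  assumes "r \<in> {0..pi}"
  shows "vector [sin r * cos \<theta>, sin r * sin \<theta>, cos r] = sphere_point (cos r) \<theta>"
proof -
  have "sqrt (1 - (cos r)\<^sup>2) = sin r"
    using assms sin_ge_zero[of r] by (simp add: sin_squared_eq[symmetric])
  then show ?thesis
    by (simp add: sphere_point_def)
qed

text \<open>
  Archimedes: the projection to the axis preserves area, since \<open>sin r dr\<close> becomes \<open>dz\<close> for \<open>z = cos r\<close>.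
\<close>

lemma sphere_area_eq:
  "sphere_area = distr (meridian \<Otimes>\<^sub>M parallel) borel (\<lambda>p. sphere_point (fst p) (snd p))"
proof (rule measure_eqI)
  show "sets sphere_area = sets (distr (meridian \<Otimes>\<^sub>M parallel) borel (\<lambda>p. sphere_point (fst p) (snd p)))"
    by (simp add: sphere_area_def)
  fix A assume "A \<in> sets sphere_area"
  then have A[measurable]: "A \<in> sets borel"
    by (simp add: sphere_area_def)
  let ?\<Psi> = "\<lambda>(r, \<theta>). vector [sin r * cos \<theta>, sin r * sin \<theta>, cos r] :: real^3"
  have \<Psi>: "?\<Psi> \<in> borel_measurable borel"
    unfolding case_prod_beta
    by (intro borel_measurable_continuous_onI continuous_on_vector3 continuous_intros)
  then have \<Psi>'[measurable]: "?\<Psi> \<in> borel_measurable (lborel \<Otimes>\<^sub>M lborel)"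
    by (simp add: lborel_prod)
  have sp[measurable]: "(\<lambda>p. sphere_point (fst p) (snd p)) \<in> borel_measurable (lborel \<Otimes>\<^sub>M lborel)"
    using measurable_sphere_point_borel by (simp add: lborel_prod)
  define G where "G z = (\<integral>\<^sup>+\<theta>. indicator A (sphere_point z \<theta>) * indicator {0..2 * pi} \<theta> \<partial>lborel)" for z
  have G[measurable]: "G \<in> borel_measurable borel"
  proof -
    have "(\<lambda>p. indicator A (sphere_point (fst p) (snd p)) * indicator {0..2 * pi} (snd p) :: ennreal) \<in> borel_measurable (lborel \<Otimes>\<^sub>M lborel)"
      by measurable
    from lborel.borel_measurable_nn_integral_fst[OF this]
    have "(\<lambda>z. \<integral>\<^sup>+\<theta>. indicator A (sphere_point z \<theta>) * indicator {0..2 * pi} \<theta> \<partial>lborel) \<in> borel_measurable borel"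
      by simp
    then show ?thesis
      unfolding G_def[abs_def] .
  qed
  have Gfin: "G z < top" for z
  proof -
    have "G z \<le> (\<integral>\<^sup>+\<theta>. indicator {0..2 * pi} \<theta> \<partial>lborel)"
      unfolding G_def by (rule nn_integral_mono) (auto simp: indicator_def)
    also have "\<dots> < top"
      by simp
    finally show ?thesis .
  qed
  define dens where "dens = (\<lambda>p :: real \<times> real. ennreal (indicat_real ({0..pi} \<times> {0..2 * pi}) p * sin (fst p)))"
  have dens[measurable]: "dens \<in> borel_measurable (lborel \<Otimes>\<^sub>M lborel)"
    unfolding dens_def by measurable
  have "emeasure sphere_area A = (\<integral>\<^sup>+p. indicator A p \<partial>sphere_area)"
    by (simp add: sphere_area_def)
  also have "\<dots> = (\<integral>\<^sup>+p. dens p * indicator A (?\<Psi> p) \<partial>(lborel \<Otimes>\<^sub>M lborel))"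
    unfolding sphere_area_def dens_def[symmetric] lborel_prod[symmetric]
    by (subst nn_integral_distr, simp, simp, subst nn_integral_density) simp_all
  also have "\<dots> = (\<integral>\<^sup>+r. \<integral>\<^sup>+\<theta>. dens (r, \<theta>) * indicator A (?\<Psi> (r, \<theta>)) \<partial>lborel \<partial>lborel)"
    by (rule lborel.nn_integral_fst[symmetric]) measurable
  also have "\<dots> = (\<integral>\<^sup>+r. G (cos r) * ennreal (sin r) * indicator {0..pi} r \<partial>lborel)"
  proof (rule nn_integral_cong)
    fix r :: real
    show "(\<integral>\<^sup>+\<theta>. dens (r, \<theta>) * indicator A (?\<Psi> (r, \<theta>)) \<partial>lborel) = G (cos r) * ennreal (sin r) * indicator {0..pi} r"
    proof (cases "r \<in> {0..pi}")
      case True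
      have "(\<integral>\<^sup>+\<theta>. dens (r, \<theta>) * indicator A (?\<Psi> (r, \<theta>)) \<partial>lborel) =
          (\<integral>\<^sup>+\<theta>. ennreal (sin r) * (indicator A (sphere_point (cos r) \<theta>) * indicator {0..2 * pi} \<theta>) \<partial>lborel)"
        using True by (intro nn_integral_cong) (auto simp: dens_def polar_point_eq indicator_def)
      also have "\<dots> = ennreal (sin r) * G (cos r)"
      proof -
        have "(\<lambda>\<theta>. indicator A (sphere_point (cos r) \<theta>) * indicator {0..2 * pi} \<theta> :: ennreal) \<in> borel_measurable lborel"
          using measurable_compose[OF measurable_Pair1'[of "cos r" lborel lborel] sp] by simp
        then show ?thesis
          unfolding G_def by (rule nn_integral_cmult)
      qed
      finally show ?thesis
        using True by (simp add: mult.commute)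
    qed (auto simp: dens_def indicator_def)
  qed
  also have "\<dots> = (\<integral>\<^sup>+z. G z * indicator {- 1..1} z \<partial>lborel)"
    by (rule nn_integral_cos_substitution[OF G Gfin])
  also have "\<dots> = (\<integral>\<^sup>+z. G z \<partial>meridian)"
    by (simp add: nn_integral_restrict_space)
  also have "\<dots> = (\<integral>\<^sup>+z. \<integral>\<^sup>+\<theta>. indicator A (sphere_point z \<theta>) \<partial>parallel \<partial>meridian)"
    by (simp add: nn_integral_restrict_space G_def)
  also have "\<dots> = (\<integral>\<^sup>+p. indicator A (sphere_point (fst p) (snd p)) \<partial>(meridian \<Otimes>\<^sub>M parallel))"
    using sphere.M2.nn_integral_fst[of "\<lambda>p. indicator A (sphere_point (fst p) (snd p))"] by simp
  also have "\<dots> = (\<integral>\<^sup>+x. indicator A x \<partial>distr (meridian \<Otimes>\<^sub>M parallel) borel (\<lambda>p. sphere_point (fst p) (snd p)))"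
    by (subst nn_integral_distr) simp_all
  finally show "emeasure sphere_area A = emeasure (distr (meridian \<Otimes>\<^sub>M parallel) borel (\<lambda>p. sphere_point (fst p) (snd p))) A"
    by simp
qed

lemma sets_sphere_area [measurable_cong, simp]: "sets sphere_area = sets borel"
  by (simp add: sphere_area_def)

lemma space_sphere_area [simp]: "space sphere_area = UNIV"
  by (simp add: sphere_area_def)

lemma finite_sphere_area: "finite_measure sphere_area"
proof -
  interpret h: finite_measure meridian by (rule finite_interval_lebesgue)
  interpret c: finite_measure parallel by (rule finite_interval_lebesgue)
  interpret p: finite_measure "meridian \<Otimes>\<^sub>M parallel"
    by (rule finite_measure_pair_measure) unfold_locales
  show ?thesis
    unfolding sphere_area_eq by (rule p.finite_measure_distr) measurable
qed

lemma AE_sphereD: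
  assumes "AE x in sphere_area. P x"
  shows "AE z in meridian. AE \<theta> in parallel. P (sphere_point z \<theta>)"
proof -
  have "AE p in meridian \<Otimes>\<^sub>M parallel. P (sphere_point (fst p) (snd p))"
    using assms unfolding sphere_area_eq by (rule AE_distrD[OF measurable_sphere_point])
  from sphere.AE_pair[OF this] show ?thesis by simp
qed

lemma AE_sphere_norm: "AE x in sphere_area. norm x = 1"
proof -
  have "AE p in meridian \<Otimes>\<^sub>M parallel. norm (sphere_point (fst p) (snd p)) = 1"
    by (rule AE_I2) (auto simp: space_pair_measure space_restrict_space norm_eq_1 abs_le_iff intro!: sphere_point_norm)
  then show ?thesis
    unfolding sphere_area_eq by (subst AE_distr_iff) auto
qed


section \<open>Averaging over circles of latitude\<close>

definition circle_average :: "(real^3 \<Rightarrow> complex) \<Rightarrow> real \<Rightarrow> complex" where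
  "circle_average u z = (LINT \<theta>|parallel. u (sphere_point z \<theta>)) /\<^sub>R (2 * pi)"

lemma measure_circle: "measure parallel (space parallel) = 2 * pi"
  by (simp add: measure_restrict_space space_restrict_space)

lemma measurable_on_coordinates [measurable (raw)]:
  "u \<in> borel_measurable sphere_area \<Longrightarrow>
    (\<lambda>p. u (sphere_point (fst p) (snd p))) \<in> borel_measurable (meridian \<Otimes>\<^sub>M parallel)"
  by (rule measurable_compose[OF measurable_sphere_point]) (simp cong: measurable_cong_sets)

lemma measurable_on_circle:
  assumes "u \<in> borel_measurable sphere_area" "z \<in> {- 1..1}"
  shows "(\<lambda>\<theta>. u (sphere_point z \<theta>)) \<in> borel_measurable parallel"
  using measurable_compose[OF measurable_Pair1' measurable_on_coordinates[OF assms(1)], of z] assms(2)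
  by (simp add: space_restrict_space)

lemma integral_sphere:
  fixes u :: "real^3 \<Rightarrow> 'b::{banach, second_countable_topology}"
  assumes u: "integrable sphere_area u"
  shows "AE z in meridian. integrable parallel (\<lambda>\<theta>. u (sphere_point z \<theta>))"
    and "integrable meridian (\<lambda>z. LINT \<theta>|parallel. u (sphere_point z \<theta>))"
    and "(LINT x|sphere_area. u x) = (LINT z|meridian. LINT \<theta>|parallel. u (sphere_point z \<theta>))"
proof -
  have um: "u \<in> borel_measurable borel"
    using borel_measurable_integrable[OF u] by (simp cong: measurable_cong_sets)
  have int: "integrable (meridian \<Otimes>\<^sub>M parallel) (\<lambda>p. u (sphere_point (fst p) (snd p)))"
    using u um unfolding sphere_area_eq by (subst (asm) integrable_distr_eq) auto
  show "AE z in meridian. integrable parallel (\<lambda>\<theta>. u (sphere_point z \<theta>))"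
    using sphere.AE_integrable_fst'[OF int] by simp
  show "integrable meridian (\<lambda>z. LINT \<theta>|parallel. u (sphere_point z \<theta>))"
    using sphere.integrable_fst'[OF int] by simp
  show "(LINT x|sphere_area. u x) = (LINT z|meridian. LINT \<theta>|parallel. u (sphere_point z \<theta>))"
    using sphere.integral_fst'[OF int] um unfolding sphere_area_eq
    by (subst integral_distr) auto
qed

lemma borel_measurable_circle_average:
  assumes "u \<in> borel_measurable sphere_area"
  shows "circle_average u \<in> borel_measurable meridian"
proof -
  note [measurable] = measurable_on_coordinates[OF assms]
  have "(\<lambda>z. LINT \<theta>|parallel. u (sphere_point (fst (z, \<theta>)) (snd (z, \<theta>)))) \<in> borel_measurable meridian"
    by (rule sphere.M2.borel_measurable_lebesgue_integral) (simp add: case_prod_beta measurable_on_coordinates[OF assms])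
  then show ?thesis
    unfolding circle_average_def[abs_def] by simp
qed

lemma integral_weighted_average:
  assumes "integrable sphere_area (\<lambda>x. r (x $ 3) *\<^sub>R u x)"
  shows "(LINT x|sphere_area. r (x $ 3) *\<^sub>R u x) = (2 * pi) *\<^sub>R (LINT z|meridian. r z *\<^sub>R circle_average u z)"
proof -
  have "(LINT x|sphere_area. r (x $ 3) *\<^sub>R u x) =
      (LINT z|meridian. LINT \<theta>|parallel. r z *\<^sub>R u (sphere_point z \<theta>))"
    using integral_sphere(3)[OF assms] by simp
  also have "\<dots> = (LINT z|meridian. (2 * pi) *\<^sub>R (r z *\<^sub>R circle_average u z))"
    by (intro Bochner_Integration.integral_cong refl)
      (simp only: integral_scaleR_right circle_average_def, simp add: ac_simps)
  finally show ?thesis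
    by (simp only: integral_scaleR_right)
qed

lemma circle_average_cong_AE:
  assumes "AE x in sphere_area. u x = v x" "u \<in> borel_measurable sphere_area" "v \<in> borel_measurable sphere_area"
  shows "AE z in meridian. circle_average u z = circle_average v z"
  using AE_sphereD[OF assms(1)] AE_space[of meridian]
proof eventually_elim
  case (elim z)
  then have "z \<in> {- 1..1}" by (simp add: space_restrict_space)
  then have "(LINT \<theta>|parallel. u (sphere_point z \<theta>)) = (LINT \<theta>|parallel. v (sphere_point z \<theta>))"
    by (intro integral_cong_AE measurable_on_circle assms elim(1))
  then show ?case by (simp add: circle_average_def)
qed

lemma circle_average_cmult: "circle_average (\<lambda>x. c * u x) z = c * circle_average u z"
  by (simp add: circle_average_def)

lemma circle_average_scaleR: "circle_average (\<lambda>x. c *\<^sub>R u x) z = c *\<^sub>R circle_average u z"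
  by (simp add: circle_average_def scaleR_left_commute del: scaleR_conv_of_real)

lemma circle_average_diff:
  assumes "integrable sphere_area u" "integrable sphere_area v"
  shows "AE z in meridian. circle_average (\<lambda>x. u x - v x) z = circle_average u z - circle_average v z"
  using integral_sphere(1)[OF assms(1)] integral_sphere(1)[OF assms(2)]
  by eventually_elim (simp add: circle_average_def scaleR_diff_right)

text \<open>
  Cauchy-Schwarz on each circle of latitude. The weight is 1 for \<open>L\<^sup>2\<close> bounds and \<open>1 / (1 - z\<^sup>2)\<close> for the
  Dirichlet energy.
\<close>

lemma circle_average_square_le:
  assumes w0: "\<And>z. 0 \<le> w z"
    and wm: "w \<in> borel_measurable meridian"
    and int: "integrable sphere_area (\<lambda>x. w (x $ 3) * (norm (u x))\<^sup>2)"
    and usq: "sq_integrable sphere_area u"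
  shows "integrable meridian (\<lambda>z. w z * (norm (circle_average u z))\<^sup>2)"
    and "2 * pi * (LINT z|meridian. w z * (norm (circle_average u z))\<^sup>2) \<le> (LINT x|sphere_area. w (x $ 3) * (norm (u x))\<^sup>2)"
proof -
  note u = sq_integrable_measurable[OF usq]
  note I = integral_sphere[OF int, unfolded sphere_point_component]
  note [measurable] = borel_measurable_circle_average[OF u] wm
  have le: "AE z in meridian. w z * (norm (circle_average u z))\<^sup>2
      \<le> (LINT \<theta>|parallel. w z * (norm (u (sphere_point z \<theta>)))\<^sup>2) / (2 * pi)"
    using integral_sphere(1)[OF sq_integrable_square[OF usq]] AE_space[of meridian]
  proof eventually_elim
    case (elim z)
    have m: "(\<lambda>\<theta>. u (sphere_point z \<theta>)) \<in> borel_measurable parallel"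
      using elim by (intro measurable_on_circle u) (simp add: space_restrict_space)
    with elim have sq: "sq_integrable parallel (\<lambda>\<theta>. u (sphere_point z \<theta>))"
      by (simp add: sq_integrable_def)
    have one: "sq_integrable parallel (\<lambda>_. 1 :: real)"
      by (rule sq_integrable_continuous) simp
    have one_norm: "l2norm parallel (\<lambda>_. 1 :: real) = sqrt (2 * pi)"
      using measure_circle by (simp add: l2norm_def)
    let ?S = "LINT \<theta>|parallel. (norm (u (sphere_point z \<theta>)))\<^sup>2"
    have "norm (LINT \<theta>|parallel. u (sphere_point z \<theta>)) \<le> (LINT \<theta>|parallel. norm (u (sphere_point z \<theta>)))"
      by (rule integral_norm_bound)
    also have "\<dots> \<le> sqrt (2 * pi) * sqrt ?S"
      using integral_Cauchy_Schwarz[OF one sq_integrable_norm[OF sq]] one_norm by (simp add: l2norm_def)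
    finally have "(norm (LINT \<theta>|parallel. u (sphere_point z \<theta>)))\<^sup>2 \<le> (sqrt (2 * pi) * sqrt ?S)\<^sup>2"
      by (intro power_mono) auto
    also have "\<dots> = 2 * pi * ?S"
      by (simp add: power_mult_distrib)
    finally have "(norm (LINT \<theta>|parallel. u (sphere_point z \<theta>)))\<^sup>2 / (2 * pi)\<^sup>2 \<le> 2 * pi * ?S / (2 * pi)\<^sup>2"
      by (rule divide_right_mono) simp
    moreover have "norm (circle_average u z) = norm (LINT \<theta>|parallel. u (sphere_point z \<theta>)) / (2 * pi)"
    proof -
      have "\<bar>inverse (2 * pi)\<bar> = inverse (2 * pi)"
        by simp
      then show ?thesis
        unfolding circle_average_def norm_scaleR divide_inverse by (simp only: mult.commute)
    qed
    ultimately have "(norm (circle_average u z))\<^sup>2 \<le> 2 * pi * ?S / (2 * pi)\<^sup>2"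
      by (simp only: power_divide)
    also have "\<dots> = ?S / (2 * pi)"
      by (simp add: power2_eq_square)
    finally have "w z * (norm (circle_average u z))\<^sup>2 \<le> w z * (?S / (2 * pi))"
      by (rule mult_left_mono) (rule w0)
    then show ?case by simp
  qed
  show avg: "integrable meridian (\<lambda>z. w z * (norm (circle_average u z))\<^sup>2)"
  proof (rule Bochner_Integration.integrable_bound)
    show "integrable meridian (\<lambda>z. (LINT \<theta>|parallel. w z * (norm (u (sphere_point z \<theta>)))\<^sup>2) / (2 * pi))"
      using I(2) by simp
    show "AE z in meridian. norm (w z * (norm (circle_average u z))\<^sup>2)
        \<le> norm ((LINT \<theta>|parallel. w z * (norm (u (sphere_point z \<theta>)))\<^sup>2) / (2 * pi))"
      using le by eventually_elim (use w0 in \<open>auto simp: abs_mult intro: order_trans[OF _ abs_ge_self]\<close>)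
  qed measurable
  have "(LINT z|meridian. w z * (norm (circle_average u z))\<^sup>2) \<le>
      (LINT z|meridian. (LINT \<theta>|parallel. w z * (norm (u (sphere_point z \<theta>)))\<^sup>2) / (2 * pi))"
    using I(2) by (intro integral_mono_AE avg le) simp
  also have "\<dots> = (LINT x|sphere_area. w (x $ 3) * (norm (u x))\<^sup>2) / (2 * pi)"
    using I(3) by simp
  finally show "2 * pi * (LINT z|meridian. w z * (norm (circle_average u z))\<^sup>2) \<le> (LINT x|sphere_area. w (x $ 3) * (norm (u x))\<^sup>2)"
    by (simp add: field_simps)
qed

lemma sq_integrable_circle_average:
  assumes "sq_integrable sphere_area u"
  shows "sq_integrable meridian (circle_average u)"
    and "l2norm meridian (circle_average u) \<le> l2norm sphere_area u"
proof -
  note u = sq_integrable_measurable[OF assms]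
  note avg = circle_average_square_le[of "\<lambda>_. 1" u, simplified, OF sq_integrable_square[OF assms] assms]
  show "sq_integrable meridian (circle_average u)"
    using avg(1) borel_measurable_circle_average[OF u] by (simp add: sq_integrable_def)
  have "1 * (LINT z|meridian. (norm (circle_average u z))\<^sup>2) \<le> 2 * pi * (LINT z|meridian. (norm (circle_average u z))\<^sup>2)"
    using pi_gt3 by (intro mult_right_mono) auto
  with avg(2) show "l2norm meridian (circle_average u) \<le> l2norm sphere_area u"
    unfolding l2norm_def by (intro real_sqrt_le_mono) simp
qed

lemma radial_circle_average:
  assumes u: "AE x in sphere_area. u x = f (x $ 3)" and um: "u \<in> borel_measurable sphere_area"
  shows "AE z in meridian. circle_average u z = f z \<and>
    (AE \<theta> in parallel. u (sphere_point z \<theta>) = circle_average u z)"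
  using AE_sphereD[OF u] AE_space[of meridian]
proof eventually_elim
  case (elim z)
  then have z: "z \<in> {- 1..1}" by (simp add: space_restrict_space)
  have "(LINT \<theta>|parallel. u (sphere_point z \<theta>)) = (LINT \<theta>|parallel. f z)"
    using elim(1) by (intro integral_cong_AE measurable_on_circle um z) auto
  then have "circle_average u z = f z"
    using measure_circle by (simp add: circle_average_def)
  with elim(1) show ?case by simp
qed


section \<open>Weak derivatives on the sphere\<close>

lemma Lspace_2: "u \<in> Lspace 2 \<longleftrightarrow> sq_integrable sphere_area u"
  by (simp add: Lspace_def sq_integrable_def)

lemma Lnorm_2: "Lnorm 2 u = l2norm sphere_area u"
  by (simp add: Lnorm_def l2norm_def powr_half_sqrt)

definition C1_gradient :: "(real^3 \<Rightarrow> real) \<Rightarrow> (real^3 \<Rightarrow> real^3) \<Rightarrow> bool" where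
  "C1_gradient \<phi> g \<longleftrightarrow> (\<forall>x. GDERIV \<phi> x :> g x) \<and> continuous_on UNIV g"

lemma C1_gradient_continuous:
  assumes "C1_gradient \<phi> g"
  shows "continuous_on UNIV \<phi>"
  using assms unfolding C1_gradient_def gderiv_def
  by (meson continuous_at_imp_continuous_on has_derivative_continuous)

lemma C1_gradient_const: "C1_gradient (\<lambda>_. c) (\<lambda>_. 0)"
  by (simp add: C1_gradient_def GDERIV_const)

lemma C1_gradient_add:
  "C1_gradient \<phi> g \<Longrightarrow> C1_gradient \<psi> h \<Longrightarrow> C1_gradient (\<lambda>x. \<phi> x + \<psi> x) (\<lambda>x. g x + h x)"
  by (auto simp: C1_gradient_def intro!: GDERIV_add continuous_intros)

lemma C1_gradient_mult:
  assumes "C1_gradient \<phi> g" "C1_gradient \<psi> h"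
  shows "C1_gradient (\<lambda>x. \<phi> x * \<psi> x) (\<lambda>x. \<phi> x *\<^sub>R h x + \<psi> x *\<^sub>R g x)"
  using assms C1_gradient_continuous[OF assms(1)] C1_gradient_continuous[OF assms(2)]
  by (auto simp: C1_gradient_def intro!: GDERIV_mult continuous_intros)

lemma C1_gradient_inner: "C1_gradient (\<lambda>x. x \<bullet> a) (\<lambda>_. a)"
  unfolding C1_gradient_def gderiv_def
  by (auto intro!: derivative_eq_intros simp: inner_commute)

lemma C1_gradient_component: "C1_gradient (\<lambda>x. x $ i) (\<lambda>_. axis i 1)"
  using C1_gradient_inner[of "axis i 1"] by (simp add: inner_axis)

lemma C1_gradient_height:
  assumes "\<And>z. (q has_real_derivative q' z) (at z)" "continuous_on UNIV q'"
  shows "C1_gradient (\<lambda>x. q (x $ 3)) (\<lambda>x. q' (x $ 3) *\<^sub>R axis 3 1)"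
  unfolding C1_gradient_def
proof (intro conjI allI)
  have "((\<lambda>x :: real^3. x $ 3) has_derivative (\<lambda>h. h $ 3)) (at x)" for x
    by (rule bounded_linear_imp_has_derivative) (rule bounded_linear_vec_nth)
  moreover have "(q has_derivative (\<lambda>h. q' z * h)) (at z)" for z
    using assms(1)[of z] by (simp add: has_field_derivative_def)
  ultimately have "((\<lambda>x :: real^3. q (x $ 3)) has_derivative (\<lambda>h. q' (x $ 3) * (h $ 3))) (at x)" for x
    using has_derivative_compose by blast
  then show "GDERIV (\<lambda>x. q (x $ 3)) x :> q' (x $ 3) *\<^sub>R axis 3 1" for x :: "real^3"
    by (simp add: gderiv_def inner_axis mult.commute)
  show "continuous_on UNIV (\<lambda>x :: real^3. q' (x $ 3) *\<^sub>R axis 3 (1 :: real))"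
    by (intro continuous_intros continuous_on_compose2[OF assms(2)]) auto
qed

lemma bounded_on_sphere:
  fixes r :: "real^3 \<Rightarrow> real"
  assumes "continuous_on UNIV r"
  obtains B where "AE x in sphere_area. \<bar>r x\<bar> \<le> B"
proof -
  have "bounded (r ` sphere 0 1)"
    by (intro compact_imp_bounded compact_continuous_image continuous_on_subset[OF assms]) auto
  then obtain B where "\<And>x. x \<in> sphere 0 1 \<Longrightarrow> \<bar>r x\<bar> \<le> B"
    unfolding bounded_iff real_norm_def by blast
  then have "AE x in sphere_area. \<bar>r x\<bar> \<le> B"
    using AE_sphere_norm by (auto elim!: eventually_mono)
  then show thesis by (rule that)
qed

lemma sq_integrable_continuous_mult:
  fixes v :: "real^3 \<Rightarrow> complex"
  assumes r: "continuous_on UNIV r" and v: "sq_integrable sphere_area v"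
  shows "sq_integrable sphere_area (\<lambda>x. r x *\<^sub>R v x)"
proof -
  obtain B where B: "AE x in sphere_area. \<bar>r x\<bar> \<le> B"
    using bounded_on_sphere[OF r] by blast
  have [measurable]: "r \<in> borel_measurable sphere_area"
    using borel_measurable_continuous_onI[OF r] by (simp cong: measurable_cong_sets)
  note [measurable] = sq_integrable_measurable[OF v]
  show ?thesis
  proof (rule sq_integrable_bound[OF v])
    show "AE x in sphere_area. norm (r x *\<^sub>R v x) \<le> B * norm (v x)"
      using B by eventually_elim (simp add: mult_right_mono)
  qed measurable
qed

lemmas integrable_sphere_sq = integrable_sq_integrable[OF finite_sphere_area]
lemmas integrable_continuous_mult = integrable_sphere_sq[OF sq_integrable_continuous_mult]

text \<open>
  By the Stone-Weierstrass theorem \<open>C\<^sup>1\<close> functions are uniformly dense in the continuous functions on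
  the sphere. It follows that weak derivatives are unique almost everywhere.
\<close>

lemma C1_test_imp_AE_zero:
  fixes v :: "real^3 \<Rightarrow> complex"
  assumes v: "sq_integrable sphere_area v"
    and test: "\<And>\<phi> g. C1_gradient \<phi> g \<Longrightarrow> (LINT x|sphere_area. \<phi> x *\<^sub>R v x) = 0"
  shows "AE x in sphere_area. v x = 0"
proof (rule tested_zero_imp_AE_zero[OF _ integrable_sphere_sq[OF v]])
  show "(\<lambda>x. x) \<in> borel_measurable sphere_area"
    by (simp cong: measurable_cong_sets)
  show "\<exists>A\<in>sets borel. B = A \<inter> space sphere_area" if "B \<in> sets sphere_area" for B
    using that by auto
  fix \<phi> :: "real^3 \<Rightarrow> real" assume \<phi>: "continuous_on UNIV \<phi>"
  define R where "R = {\<psi>. \<exists>g. C1_gradient \<psi> g}"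
  interpret function_ring_on R "sphere 0 1"
  proof
    show "continuous_on (sphere 0 1) f" if "f \<in> R" for f
      using that continuous_on_subset[OF C1_gradient_continuous] unfolding R_def by blast
    show "(\<lambda>x. f x + g x) \<in> R" "(\<lambda>x. f x * g x) \<in> R" if "f \<in> R" "g \<in> R" for f g
      using that C1_gradient_add C1_gradient_mult unfolding R_def by blast+
    show "(\<lambda>_. c) \<in> R" for c
      using C1_gradient_const unfolding R_def by blast
    show "\<exists>f\<in>R. f x \<noteq> f y" if "x \<noteq> y" for x y
    proof -
      from that obtain i where "x $ i \<noteq> y $ i"
        by (auto simp: vec_eq_iff)
      moreover have "(\<lambda>x. x $ i) \<in> R"
        unfolding R_def mem_Collect_eq by (rule exI, rule C1_gradient_component)
      ultimately show ?thesis
        by (intro bexI[of _ "\<lambda>x. x $ i"])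
    qed
  qed auto
  have "norm (LINT x|sphere_area. \<phi> x *\<^sub>R v x) \<le> e * (LINT x|sphere_area. norm (v x))" if e: "0 < e" for e
  proof -
    obtain \<psi> where \<psi>: "\<psi> \<in> R" "\<And>x. x \<in> sphere 0 1 \<Longrightarrow> \<bar>\<phi> x - \<psi> x\<bar> < e"
      using Stone_Weierstrass_basic[OF continuous_on_subset[OF \<phi> subset_UNIV] e] by blast
    then have \<psi>c: "continuous_on UNIV \<psi>" and zero: "(LINT x|sphere_area. \<psi> x *\<^sub>R v x) = 0"
      using C1_gradient_continuous test unfolding R_def by blast+
    have int: "integrable sphere_area (\<lambda>x. \<phi> x *\<^sub>R v x)" "integrable sphere_area (\<lambda>x. \<psi> x *\<^sub>R v x)"
      by (intro integrable_continuous_mult \<phi> \<psi>c v)+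
    have "(LINT x|sphere_area. \<phi> x *\<^sub>R v x) = (LINT x|sphere_area. (\<phi> x - \<psi> x) *\<^sub>R v x)"
      using int zero by (simp add: scaleR_diff_left)
    also have "norm \<dots> \<le> (LINT x|sphere_area. norm ((\<phi> x - \<psi> x) *\<^sub>R v x))"
      by (rule integral_norm_bound)
    also have "\<dots> \<le> (LINT x|sphere_area. e * norm (v x))"
    proof (rule integral_mono_AE)
      show "AE x in sphere_area. norm ((\<phi> x - \<psi> x) *\<^sub>R v x) \<le> e * norm (v x)"
        using AE_sphere_norm
      proof eventually_elim
        case (elim x)
        then have "\<bar>\<phi> x - \<psi> x\<bar> \<le> e"
          using \<psi>(2)[of x] by simp
        then show ?case by (simp add: mult_right_mono)
      qed
      show "integrable sphere_area (\<lambda>x. norm ((\<phi> x - \<psi> x) *\<^sub>R v x))"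
        using int by (simp add: scaleR_diff_left)
      show "integrable sphere_area (\<lambda>x. e * norm (v x))"
        using integrable_sphere_sq[OF v] by simp
    qed
    finally show ?thesis by simp
  qed
  note bound = this
  have "norm (LINT x|sphere_area. \<phi> x *\<^sub>R v x) \<le> 0"
  proof (rule field_le_epsilon)
    fix e :: real assume e: "0 < e"
    define V where "V = (LINT x|sphere_area. norm (v x))"
    have V: "0 \<le> V"
      by (simp add: V_def)
    have pos: "0 < e / (V + 1)"
      using e V by simp
    have "norm (LINT x|sphere_area. \<phi> x *\<^sub>R v x) \<le> e / (V + 1) * V"
      using bound[OF pos] unfolding V_def .
    also have "\<dots> \<le> e"
      using e V by (simp add: field_simps)
    finally show "norm (LINT x|sphere_area. \<phi> x *\<^sub>R v x) \<le> 0 + e"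
      by simp
  qed
  then show "(LINT x|sphere_area. \<phi> x *\<^sub>R v x) = 0"
    by simp
qed

lemma weak_tderivD:
  assumes "weak_tderiv i u v" "C1_gradient \<phi> g"
  shows "(LINT x|sphere_area. (g x $ i - (g x \<bullet> x) * x $ i) *\<^sub>R u x) =
    - (LINT x|sphere_area. \<phi> x *\<^sub>R v x) + (LINT x|sphere_area. (2 * x $ i * \<phi> x) *\<^sub>R u x)"
  using assms unfolding weak_tderiv_def C1_gradient_def by blast

lemma weak_tderivI:
  assumes "\<And>\<phi> g. C1_gradient \<phi> g \<Longrightarrow> (LINT x|sphere_area. (g x $ i - (g x \<bullet> x) * x $ i) *\<^sub>R u x) =
    - (LINT x|sphere_area. \<phi> x *\<^sub>R v x) + (LINT x|sphere_area. (2 * x $ i * \<phi> x) *\<^sub>R u x)"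
  shows "weak_tderiv i u v"
  using assms unfolding weak_tderiv_def C1_gradient_def by blast

lemma weak_tderiv_unique:
  assumes "weak_tderiv i u v" "weak_tderiv i u v'" "sq_integrable sphere_area v" "sq_integrable sphere_area v'"
  shows "AE x in sphere_area. v x = v' x"
proof -
  have "AE x in sphere_area. v x - v' x = 0"
  proof (rule C1_test_imp_AE_zero)
    show "sq_integrable sphere_area (\<lambda>x. v x - v' x)"
      by (intro sq_integrable_diff assms)
    fix \<phi> g assume \<phi>: "C1_gradient \<phi> g"
    note int = integrable_continuous_mult[OF C1_gradient_continuous[OF \<phi>]]
    have "(LINT x|sphere_area. \<phi> x *\<^sub>R v x) = (LINT x|sphere_area. \<phi> x *\<^sub>R v' x)"
      using weak_tderivD[OF assms(1) \<phi>] weak_tderivD[OF assms(2) \<phi>] by simp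
    then show "(LINT x|sphere_area. \<phi> x *\<^sub>R (v x - v' x)) = 0"
      using int[OF assms(3)] int[OF assms(4)] by (simp add: scaleR_diff_right)
  qed
  then show ?thesis by simp
qed

lemma weak_tderiv_diff:
  assumes "weak_tderiv i u v" "weak_tderiv i u' v'"
    and u: "sq_integrable sphere_area u" and u': "sq_integrable sphere_area u'"
    and v: "sq_integrable sphere_area v" and v': "sq_integrable sphere_area v'"
  shows "weak_tderiv i (\<lambda>x. u x - u' x) (\<lambda>x. v x - v' x)"
proof (rule weak_tderivI)
  fix \<phi> g assume \<phi>: "C1_gradient \<phi> g"
  then have g: "continuous_on UNIV g" by (simp add: C1_gradient_def)
  note \<phi>c = C1_gradient_continuous[OF \<phi>]
  have c1: "continuous_on UNIV (\<lambda>x. g x $ i - (g x \<bullet> x) * x $ i)"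
    and c2: "continuous_on UNIV (\<lambda>x. 2 * x $ i * \<phi> x)"
    by (intro continuous_intros g \<phi>c)+
  have "(LINT x|sphere_area. r x *\<^sub>R (w x - w' x)) =
      (LINT x|sphere_area. r x *\<^sub>R w x) - (LINT x|sphere_area. r x *\<^sub>R w' x)"
    if "continuous_on UNIV r" "sq_integrable sphere_area w" "sq_integrable sphere_area w'" for r and w w' :: "real^3 \<Rightarrow> complex"
    using integrable_continuous_mult[OF that(1,2)] integrable_continuous_mult[OF that(1,3)]
    by (simp add: scaleR_diff_right)
  note sub = this[OF c1 u u'] this[OF \<phi>c v v'] this[OF c2 u u']
  show "(LINT x|sphere_area. (g x $ i - (g x \<bullet> x) * x $ i) *\<^sub>R (u x - u' x)) =
    - (LINT x|sphere_area. \<phi> x *\<^sub>R (v x - v' x)) + (LINT x|sphere_area. (2 * x $ i * \<phi> x) *\<^sub>R (u x - u' x))"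
    unfolding sub weak_tderivD[OF assms(1) \<phi>] weak_tderivD[OF assms(2) \<phi>]
    by (simp only: minus_diff_eq add_diff_add diff_conv_add_uminus minus_add_distrib minus_minus ac_simps)
qed

text \<open>
  The class of weak derivatives of a function depends on it only up to null sets. Hence \<open>tderiv\<close>,
  being chosen from this class, takes literally the same value on functions that agree almost
  everywhere.
\<close>

lemma weak_tderiv_cong:
  assumes "AE x in sphere_area. u x = u' x" and u: "u \<in> borel_measurable sphere_area" and u': "u' \<in> borel_measurable sphere_area"
  shows "weak_tderiv i u v \<longleftrightarrow> weak_tderiv i u' v"
proof -
  have eq: "(LINT x|sphere_area. r x *\<^sub>R u x) = (LINT x|sphere_area. r x *\<^sub>R u' x)" if "continuous_on UNIV r" for r
  proof (rule integral_cong_AE)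
    have [measurable]: "r \<in> borel_measurable sphere_area"
      using borel_measurable_continuous_onI[OF that] by (simp cong: measurable_cong_sets)
    note [measurable] = u u'
    show "(\<lambda>x. r x *\<^sub>R u x) \<in> borel_measurable sphere_area" "(\<lambda>x. r x *\<^sub>R u' x) \<in> borel_measurable sphere_area"
      by measurable
    show "AE x in sphere_area. r x *\<^sub>R u x = r x *\<^sub>R u' x"
      using assms(1) by eventually_elim simp
  qed
  have eqs: "(LINT x|sphere_area. (g x $ i - (g x \<bullet> x) * x $ i) *\<^sub>R u x) = (LINT x|sphere_area. (g x $ i - (g x \<bullet> x) * x $ i) *\<^sub>R u' x)"
    "(LINT x|sphere_area. (2 * x $ i * \<phi> x) *\<^sub>R u x) = (LINT x|sphere_area. (2 * x $ i * \<phi> x) *\<^sub>R u' x)"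
    if "C1_gradient \<phi> g" for \<phi> g
    using that C1_gradient_continuous[OF that]
    by (auto simp: C1_gradient_def intro!: eq continuous_intros)
  show ?thesis
  proof
    assume w: "weak_tderiv i u v"
    show "weak_tderiv i u' v"
    proof (rule weak_tderivI)
      fix \<phi> g assume \<phi>: "C1_gradient \<phi> g"
      from weak_tderivD[OF w \<phi>] show "(LINT x|sphere_area. (g x $ i - (g x \<bullet> x) * x $ i) *\<^sub>R u' x) =
          - (LINT x|sphere_area. \<phi> x *\<^sub>R v x) + (LINT x|sphere_area. (2 * x $ i * \<phi> x) *\<^sub>R u' x)"
        unfolding eqs[OF \<phi>] .
    qed
  next
    assume w: "weak_tderiv i u' v"
    show "weak_tderiv i u v"
    proof (rule weak_tderivI)
      fix \<phi> g assume \<phi>: "C1_gradient \<phi> g"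
      from weak_tderivD[OF w \<phi>] show "(LINT x|sphere_area. (g x $ i - (g x \<bullet> x) * x $ i) *\<^sub>R u x) =
          - (LINT x|sphere_area. \<phi> x *\<^sub>R v x) + (LINT x|sphere_area. (2 * x $ i * \<phi> x) *\<^sub>R u x)"
        unfolding eqs[OF \<phi>] .
    qed
  qed
qed

lemma tderiv_cong:
  assumes "AE x in sphere_area. u x = u' x" "u \<in> borel_measurable sphere_area" "u' \<in> borel_measurable sphere_area"
  shows "tderiv i u = tderiv i u'"
  unfolding tderiv_def weak_tderiv_cong[OF assms] ..

lemma tderiv_weak:
  assumes "\<exists>v \<in> Lspace 2. weak_tderiv i u v"
  shows "sq_integrable sphere_area (tderiv i u)" "weak_tderiv i u (tderiv i u)"
proof -
  have "\<exists>v. v \<in> Lspace 2 \<and> weak_tderiv i u v"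
    using assms by blast
  from someI_ex[OF this] have "tderiv i u \<in> Lspace 2 \<and> weak_tderiv i u (tderiv i u)"
    unfolding tderiv_def .
  then show "sq_integrable sphere_area (tderiv i u)" "weak_tderiv i u (tderiv i u)"
    by (simp_all add: Lspace_2)
qed

lemma sobolev_1D:
  assumes "u \<in> sobolev 1"
  shows "sq_integrable sphere_area u" "sq_integrable sphere_area (tderiv i u)" "weak_tderiv i u (tderiv i u)"
  using assms tderiv_weak by (auto simp: Lspace_2)

lemma sobolev_2D:
  assumes "u \<in> sobolev 2"
  shows "u \<in> sobolev 1" "tderiv i u \<in> sobolev 1"
  using assms by (auto simp: numeral_2_eq_2)

lemma tderiv_diff:
  assumes "u \<in> sobolev 1" "u' \<in> sobolev 1"
  shows "sq_integrable sphere_area (tderiv i (\<lambda>x. u x - u' x))"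
    and "AE x in sphere_area. tderiv i (\<lambda>x. u x - u' x) x = tderiv i u x - tderiv i u' x"
proof -
  note U = sobolev_1D[OF assms(1)] and U' = sobolev_1D[OF assms(2)]
  have d: "sq_integrable sphere_area (\<lambda>x. tderiv i u x - tderiv i u' x)"
    by (intro sq_integrable_diff U U')
  note w = weak_tderiv_diff[OF U(3) U'(3) U(1) U'(1) U(2) U'(2)]
  have "\<exists>v\<in>Lspace 2. weak_tderiv i (\<lambda>x. u x - u' x) v"
    by (rule bexI[where x = "\<lambda>x. tderiv i u x - tderiv i u' x"], rule w) (simp add: Lspace_2 d)
  note t = tderiv_weak[OF this]
  show "sq_integrable sphere_area (tderiv i (\<lambda>x. u x - u' x))"
    by (rule t(1))
  show "AE x in sphere_area. tderiv i (\<lambda>x. u x - u' x) x = tderiv i u x - tderiv i u' x"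
    by (rule weak_tderiv_unique[OF t(2) w t(1) d])
qed

lemma tderiv_tderiv_diff:
  assumes "u \<in> sobolev 2" "u' \<in> sobolev 2"
  shows "sq_integrable sphere_area (tderiv j (tderiv i (\<lambda>x. u x - u' x)))"
    and "AE x in sphere_area. tderiv j (tderiv i (\<lambda>x. u x - u' x)) x = tderiv j (tderiv i u) x - tderiv j (tderiv i u') x"
proof -
  note U = sobolev_2D[OF assms(1)] and U' = sobolev_2D[OF assms(2)]
  have "tderiv j (tderiv i (\<lambda>x. u x - u' x)) = tderiv j (\<lambda>x. tderiv i u x - tderiv i u' x)"
    by (intro tderiv_cong tderiv_diff sq_integrable_measurable sq_integrable_diff sobolev_1D(2) U U')
  then show "sq_integrable sphere_area (tderiv j (tderiv i (\<lambda>x. u x - u' x)))"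
    "AE x in sphere_area. tderiv j (tderiv i (\<lambda>x. u x - u' x)) x = tderiv j (tderiv i u) x - tderiv j (tderiv i u') x"
    using tderiv_diff[OF U(2) U'(2)] by simp_all
qed

lemma sq_integrable_laplace:
  assumes "u \<in> sobolev 2"
  shows "sq_integrable sphere_area (laplace_beltrami u)"
  unfolding laplace_beltrami_def[abs_def] sum_3
  by (intro sq_integrable_add sobolev_1D(2) sobolev_2D(2) assms)

text \<open>
  The Sobolev norm of a difference is built from derivatives of the difference, while the flow needs
  the difference of the Laplacians; by uniqueness of weak derivatives these agree.
\<close>

lemma laplace_diff_norm_le:
  assumes u: "u \<in> sobolev 2" and u': "u' \<in> sobolev 2"
  shows "l2norm sphere_area (\<lambda>x. laplace_beltrami u x - laplace_beltrami u' x) \<le>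
    sqrt 3 * sobolev_norm 2 (\<lambda>x. u x - u' x)"
proof -
  let ?d = "\<lambda>x. u x - u' x"
  let ?w = "\<lambda>i. tderiv i (tderiv i ?d)"
  have w: "sq_integrable sphere_area (?w i)" for i
    by (rule tderiv_tderiv_diff[OF u u'])
  have W: "sq_integrable sphere_area (\<lambda>x. \<Sum>i\<in>UNIV. ?w i x)"
    unfolding sum_3 by (intro sq_integrable_add w)
  have ae: "AE x in sphere_area. laplace_beltrami u x - laplace_beltrami u' x = (\<Sum>i\<in>UNIV. ?w i x)"
    using tderiv_tderiv_diff(2)[OF u u', of 1 1] tderiv_tderiv_diff(2)[OF u u', of 2 2] tderiv_tderiv_diff(2)[OF u u', of 3 3]
    by eventually_elim (simp add: laplace_beltrami_def sum_3)
  have eq: "l2norm sphere_area (\<lambda>x. laplace_beltrami u x - laplace_beltrami u' x) = l2norm sphere_area (\<lambda>x. \<Sum>i\<in>UNIV. ?w i x)"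
    by (intro l2norm_cong_AE ae sq_integrable_measurable W sq_integrable_diff sq_integrable_laplace u u')
  have "(l2norm sphere_area (\<lambda>x. \<Sum>i\<in>UNIV. ?w i x))\<^sup>2 \<le> (LINT x|sphere_area. 3 * (\<Sum>i\<in>UNIV. (norm (?w i x))\<^sup>2))"
    unfolding l2norm_power2
  proof (rule integral_mono)
    show "integrable sphere_area (\<lambda>x. (norm (\<Sum>i\<in>UNIV. ?w i x))\<^sup>2)"
      by (rule sq_integrable_square[OF W])
    show "integrable sphere_area (\<lambda>x. 3 * (\<Sum>i\<in>UNIV. (norm (?w i x))\<^sup>2))"
      using sq_integrable_square[OF w] by simp
    fix x
    have "(norm (\<Sum>i\<in>UNIV. ?w i x))\<^sup>2 \<le> (\<Sum>i\<in>UNIV. norm (?w i x))\<^sup>2"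
      by (intro power_mono norm_sum) simp
    also have "\<dots> \<le> 3 * (\<Sum>i\<in>UNIV. (norm (?w i x))\<^sup>2)"
      using sum_squared_le_sum_of_squares[of "\<lambda>i. norm (?w i x)" "UNIV :: 3 set"] by (simp add: mult.commute)
    finally show "(norm (\<Sum>i\<in>UNIV. ?w i x))\<^sup>2 \<le> 3 * (\<Sum>i\<in>UNIV. (norm (?w i x))\<^sup>2)" .
  qed
  also have "\<dots> = 3 * (\<Sum>i\<in>UNIV. (l2norm sphere_area (?w i))\<^sup>2)"
    using sq_integrable_square[OF w] by (simp add: l2norm_power2)
  also have "\<dots> \<le> 3 * sobolev_sqnorm 2 ?d"
  proof -
    have "(l2norm sphere_area (?w i))\<^sup>2 \<le> sobolev_sqnorm 1 (tderiv i ?d)" for i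
    proof -
      have "(l2norm sphere_area (?w i))\<^sup>2 \<le> (\<Sum>j\<in>UNIV. (l2norm sphere_area (tderiv j (tderiv i ?d)))\<^sup>2)"
        by (rule member_le_sum) auto
      then show ?thesis by (simp add: Lnorm_2 add_increasing)
    qed
    then have "(\<Sum>i\<in>UNIV. (l2norm sphere_area (?w i))\<^sup>2) \<le> (\<Sum>i\<in>UNIV. sobolev_sqnorm 1 (tderiv i ?d))"
      by (intro sum_mono)
    also have "\<dots> \<le> sobolev_sqnorm 2 ?d"
      by (simp add: numeral_2_eq_2)
    finally show ?thesis by simp
  qed
  finally have "l2norm sphere_area (\<lambda>x. \<Sum>i\<in>UNIV. ?w i x) \<le> sqrt (3 * sobolev_sqnorm 2 ?d)"
    by (intro real_le_rsqrt)
  then show ?thesis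
    unfolding eq by (simp add: sobolev_norm_def real_sqrt_mult)
qed


section \<open>Gradient and Laplacian of radial functions\<close>

lemma sum_integral_scaleR:
  fixes r :: "3 \<Rightarrow> real^3 \<Rightarrow> real" and v :: "3 \<Rightarrow> real^3 \<Rightarrow> complex"
  assumes "\<And>i. continuous_on UNIV (r i)" "\<And>i. sq_integrable sphere_area (v i)"
  shows "(\<Sum>i\<in>UNIV. LINT x|sphere_area. r i x *\<^sub>R v i x) = (LINT x|sphere_area. (\<Sum>i\<in>UNIV. r i x *\<^sub>R v i x))"
    and "integrable sphere_area (\<lambda>x. \<Sum>i\<in>UNIV. r i x *\<^sub>R v i x)"
proof -
  note int = integrable_continuous_mult[OF assms]
  show "(\<Sum>i\<in>UNIV. LINT x|sphere_area. r i x *\<^sub>R v i x) = (LINT x|sphere_area. (\<Sum>i\<in>UNIV. r i x *\<^sub>R v i x))"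
    by (rule Bochner_Integration.integral_sum[symmetric]) (rule int)
  show "integrable sphere_area (\<lambda>x. \<Sum>i\<in>UNIV. r i x *\<^sub>R v i x)"
    by (rule Bochner_Integration.integrable_sum) (rule int)
qed

text \<open>
  Test the \<open>i\<close>-th weak derivative with \<open>\<phi> x\<^sub>i\<close> and sum over \<open>i\<close>. On the unit sphere
  \<open>\<Sum>\<^sub>i D\<^sub>i (\<phi> x\<^sub>i) = 2 \<phi>\<close>, which is cancelled by the curvature term.
\<close>

lemma gradient_tangential:
  assumes u: "u \<in> sobolev 1"
  shows "AE x in sphere_area. (\<Sum>i\<in>UNIV. x $ i *\<^sub>R tderiv i u x) = 0"
proof (rule C1_test_imp_AE_zero)
  note U = sobolev_1D[OF u]
  show "sq_integrable sphere_area (\<lambda>x. \<Sum>i\<in>UNIV. x $ i *\<^sub>R tderiv i u x)"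
    unfolding sum_3 by (intro sq_integrable_add sq_integrable_continuous_mult U continuous_intros)
  fix \<phi> g assume \<phi>: "C1_gradient \<phi> g"
  then have g: "continuous_on UNIV g" by (simp add: C1_gradient_def)
  note \<phi>c = C1_gradient_continuous[OF \<phi>]
  define G where "G i x = \<phi> x *\<^sub>R axis i 1 + x $ i *\<^sub>R g x" for i :: 3 and x :: "real^3"
  have Gc: "continuous_on UNIV (G i)" for i
    unfolding G_def by (intro continuous_intros g \<phi>c)
  define r where "r i x = G i x $ i - (G i x \<bullet> x) * x $ i" for i :: 3 and x :: "real^3"
  have rc: "continuous_on UNIV (r i)" for i
    unfolding r_def by (intro continuous_intros Gc)
  have weak: "(LINT x|sphere_area. r i x *\<^sub>R u x) =
      - (LINT x|sphere_area. (\<phi> x * x $ i) *\<^sub>R tderiv i u x) + (LINT x|sphere_area. (2 * x $ i * (\<phi> x * x $ i)) *\<^sub>R u x)" for i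
    using weak_tderivD[OF U(3) C1_gradient_mult[OF \<phi> C1_gradient_component]]
    unfolding r_def G_def .
  have c: "continuous_on UNIV (\<lambda>x. \<phi> x * x $ i)" "continuous_on UNIV (\<lambda>x. 2 * x $ i * (\<phi> x * x $ i))" for i :: 3
    by (intro continuous_intros \<phi>c)+
  have "(\<Sum>i\<in>UNIV. LINT x|sphere_area. r i x *\<^sub>R u x) =
      - (\<Sum>i\<in>UNIV. LINT x|sphere_area. (\<phi> x * x $ i) *\<^sub>R tderiv i u x)
      + (\<Sum>i\<in>UNIV. LINT x|sphere_area. (2 * x $ i * (\<phi> x * x $ i)) *\<^sub>R u x)"
    unfolding weak sum.distrib sum_negf ..
  then have eq: "(LINT x|sphere_area. (\<Sum>i\<in>UNIV. r i x *\<^sub>R u x)) =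
      - (LINT x|sphere_area. (\<Sum>i\<in>UNIV. (\<phi> x * x $ i) *\<^sub>R tderiv i u x))
      + (LINT x|sphere_area. (\<Sum>i\<in>UNIV. (2 * x $ i * (\<phi> x * x $ i)) *\<^sub>R u x))"
    unfolding sum_integral_scaleR(1)[OF rc U(1)] sum_integral_scaleR(1)[OF c(1) U(2)]
      sum_integral_scaleR(1)[OF c(2) U(1)] .
  have "(LINT x|sphere_area. (\<Sum>i\<in>UNIV. r i x *\<^sub>R u x)) = (LINT x|sphere_area. (\<Sum>i\<in>UNIV. (2 * x $ i * (\<phi> x * x $ i)) *\<^sub>R u x))"
  proof (rule integral_cong_AE)
    show "AE x in sphere_area. (\<Sum>i\<in>UNIV. r i x *\<^sub>R u x) = (\<Sum>i\<in>UNIV. (2 * x $ i * (\<phi> x * x $ i)) *\<^sub>R u x)"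
      using AE_sphere_norm
    proof eventually_elim
      case (elim x)
      then have one: "x $ 1 * x $ 1 + x $ 2 * x $ 2 + x $ 3 * x $ 3 = 1"
        by (simp add: norm_eq_1 inner_vec_def sum_3)
      define s where "s = g x \<bullet> x"
      have s: "s = g x $ 1 * x $ 1 + g x $ 2 * x $ 2 + g x $ 3 * x $ 3"
        by (simp add: s_def inner_vec_def sum_3)
      have ri: "r i x = \<phi> x + x $ i * g x $ i - (\<phi> x + s) * (x $ i * x $ i)" for i
        by (simp add: r_def G_def inner_add_left inner_axis' s_def algebra_simps)
      have "(\<Sum>i\<in>UNIV. r i x) = 3 * \<phi> x + s - (\<phi> x + s) * (x $ 1 * x $ 1 + x $ 2 * x $ 2 + x $ 3 * x $ 3)"
        unfolding sum_3 ri by (subst (3) s) (simp add: algebra_simps)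
      also have "\<dots> = 2 * \<phi> x"
        unfolding one by simp
      also have "\<dots> = 2 * \<phi> x * (x $ 1 * x $ 1 + x $ 2 * x $ 2 + x $ 3 * x $ 3)"
        unfolding one by simp
      also have "\<dots> = (\<Sum>i\<in>UNIV. 2 * x $ i * (\<phi> x * x $ i))"
        unfolding sum_3 by (simp add: algebra_simps)
      finally show ?case
        by (simp only: scaleR_sum_left[symmetric])
    qed
  qed (intro borel_measurable_integrable sum_integral_scaleR(2) rc c U)+
  with eq have "(LINT x|sphere_area. (\<Sum>i\<in>UNIV. (\<phi> x * x $ i) *\<^sub>R tderiv i u x)) = 0"
    by simp
  then show "(LINT x|sphere_area. \<phi> x *\<^sub>R (\<Sum>i\<in>UNIV. x $ i *\<^sub>R tderiv i u x)) = 0"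
    by (simp only: scaleR_sum_right scaleR_scaleR)
qed

lemma weak_gradient_height:
  assumes u: "u \<in> sobolev 1" and q: "\<And>z. (q has_real_derivative q' z) (at z)" "continuous_on UNIV q'"
  shows "(LINT z|meridian. ((1 - z\<^sup>2) * q' z) *\<^sub>R circle_average u z) =
    - (LINT z|meridian. q z *\<^sub>R circle_average (tderiv 3 u) z)
    + (LINT z|meridian. (2 * z * q z) *\<^sub>R circle_average u z)"
proof -
  note U = sobolev_1D[OF u]
  note C1 = C1_gradient_height[OF q]
  have qc: "continuous_on UNIV q"
    using q(1) by (meson DERIV_isCont continuous_at_imp_continuous_on)
  have c: "continuous_on UNIV (\<lambda>x :: real^3. (1 - (x $ 3)\<^sup>2) * q' (x $ 3))"
    "continuous_on UNIV (\<lambda>x :: real^3. q (x $ 3))" "continuous_on UNIV (\<lambda>x :: real^3. 2 * x $ 3 * q (x $ 3))"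
    by (intro continuous_intros continuous_on_compose2[OF q(2)] continuous_on_compose2[OF qc]; simp)+
  have "(LINT x|sphere_area. ((1 - (x $ 3)\<^sup>2) * q' (x $ 3)) *\<^sub>R u x) =
      - (LINT x|sphere_area. q (x $ 3) *\<^sub>R tderiv 3 u x) + (LINT x|sphere_area. (2 * x $ 3 * q (x $ 3)) *\<^sub>R u x)"
    using weak_tderivD[OF U(3) C1, of 3] by (simp add: inner_axis' power2_eq_square algebra_simps)
  then have "(2 * pi) *\<^sub>R (LINT z|meridian. ((1 - z\<^sup>2) * q' z) *\<^sub>R circle_average u z) =
    (2 * pi) *\<^sub>R (- (LINT z|meridian. q z *\<^sub>R circle_average (tderiv 3 u) z)
    + (LINT z|meridian. (2 * z * q z) *\<^sub>R circle_average u z))"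
    using integral_weighted_average[OF integrable_continuous_mult[OF c(1) U(1)]]
      integral_weighted_average[OF integrable_continuous_mult[OF c(2) U(2)]]
      integral_weighted_average[OF integrable_continuous_mult[OF c(3) U(1)]]
    by (simp only: scaleR_add_right scaleR_minus_right)
  then show ?thesis
    by (simp only: scaleR_cancel_left) simp
qed

text \<open>
  Test the weak derivatives of the gradient \<open>v\<close> with a function \<open>q\<close> of the height. Since
  \<open>D\<^sub>i q = q' (\<delta>\<^sub>i\<^sub>3 - x\<^sub>3 x\<^sub>i)\<close> and \<open>v\<close> is tangential, only \<open>q' v\<^sub>3\<close> remains.
\<close>

lemma weak_laplacian_height:
  assumes u: "u \<in> sobolev 2" and q: "\<And>z. (q has_real_derivative q' z) (at z)" "continuous_on UNIV q'"
  shows "(LINT z|meridian. q' z *\<^sub>R circle_average (tderiv 3 u) z) =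
    - (LINT z|meridian. q z *\<^sub>R circle_average (laplace_beltrami u) z)"
proof -
  note U = sobolev_1D[OF sobolev_2D(1)[OF u]] and V = sobolev_1D[OF sobolev_2D(2)[OF u]]
  note C1 = C1_gradient_height[OF q]
  have qc: "continuous_on UNIV q"
    using q(1) by (meson DERIV_isCont continuous_at_imp_continuous_on)
  have c: "continuous_on UNIV (\<lambda>x :: real^3. q' (x $ 3))" "continuous_on UNIV (\<lambda>x :: real^3. q (x $ 3))"
    by (intro continuous_intros continuous_on_compose2[OF q(2)] continuous_on_compose2[OF qc]; simp)+
  define r where "r i x = (q' (x $ 3) *\<^sub>R axis 3 1) $ i - (q' (x $ 3) *\<^sub>R axis 3 1 \<bullet> x) * x $ i" for i :: 3 and x :: "real^3"
  have rc: "continuous_on UNIV (r i)" for i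
    unfolding r_def by (intro continuous_intros c)
  have ri: "r i x = (if i = 3 then q' (x $ 3) else 0) - q' (x $ 3) * x $ 3 * x $ i" for i x
    unfolding r_def by (simp add: inner_axis') (simp add: axis_def)
  have c2: "continuous_on UNIV (\<lambda>x :: real^3. 2 * x $ i * q (x $ 3))" for i
    by (intro continuous_intros c)
  have "(\<Sum>i\<in>UNIV. LINT x|sphere_area. r i x *\<^sub>R tderiv i u x) =
      - (\<Sum>i\<in>UNIV. LINT x|sphere_area. q (x $ 3) *\<^sub>R tderiv i (tderiv i u) x)
      + (\<Sum>i\<in>UNIV. LINT x|sphere_area. (2 * x $ i * q (x $ 3)) *\<^sub>R tderiv i u x)"
    unfolding r_def weak_tderivD[OF V(3) C1] sum.distrib sum_negf ..
  then have eq: "(LINT x|sphere_area. (\<Sum>i\<in>UNIV. r i x *\<^sub>R tderiv i u x)) =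
      - (LINT x|sphere_area. (\<Sum>i\<in>UNIV. q (x $ 3) *\<^sub>R tderiv i (tderiv i u) x))
      + (LINT x|sphere_area. (\<Sum>i\<in>UNIV. (2 * x $ i * q (x $ 3)) *\<^sub>R tderiv i u x))"
    unfolding sum_integral_scaleR(1)[OF rc U(2)] sum_integral_scaleR(1)[OF c(2) V(2)]
      sum_integral_scaleR(1)[OF c2 U(2)] .
  note tan = gradient_tangential[OF sobolev_2D(1)[OF u]]
  have "(LINT x|sphere_area. (\<Sum>i\<in>UNIV. (2 * x $ i * q (x $ 3)) *\<^sub>R tderiv i u x)) = 0"
  proof (rule integral_eq_zero_AE)
    show "AE x in sphere_area. (\<Sum>i\<in>UNIV. (2 * x $ i * q (x $ 3)) *\<^sub>R tderiv i u x) = 0"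
      using tan
    proof eventually_elim
      case (elim x)
      have "(\<Sum>i\<in>UNIV. (2 * x $ i * q (x $ 3)) *\<^sub>R tderiv i u x) = (2 * q (x $ 3)) *\<^sub>R (\<Sum>i\<in>UNIV. x $ i *\<^sub>R tderiv i u x)"
        by (simp add: scaleR_sum_right ac_simps)
      with elim show ?case by simp
    qed
  qed
  moreover have "(LINT x|sphere_area. (\<Sum>i\<in>UNIV. r i x *\<^sub>R tderiv i u x)) = (LINT x|sphere_area. q' (x $ 3) *\<^sub>R tderiv 3 u x)"
  proof (rule integral_cong_AE)
    show "AE x in sphere_area. (\<Sum>i\<in>UNIV. r i x *\<^sub>R tderiv i u x) = q' (x $ 3) *\<^sub>R tderiv 3 u x"
      using tan
    proof eventually_elim
      case (elim x)
      have "(\<Sum>i\<in>UNIV. r i x *\<^sub>R tderiv i u x) =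
          q' (x $ 3) *\<^sub>R tderiv 3 u x - (q' (x $ 3) * x $ 3) *\<^sub>R (\<Sum>i\<in>UNIV. x $ i *\<^sub>R tderiv i u x)"
        by (simp add: sum_3 ri algebra_simps)
      with elim show ?case by simp
    qed
    show "(\<lambda>x. \<Sum>i\<in>UNIV. r i x *\<^sub>R tderiv i u x) \<in> borel_measurable sphere_area"
      by (intro borel_measurable_integrable sum_integral_scaleR(2) rc U)
    show "(\<lambda>x. q' (x $ 3) *\<^sub>R tderiv 3 u x) \<in> borel_measurable sphere_area"
      by (intro borel_measurable_integrable integrable_continuous_mult c U)
  qed
  moreover have "(LINT x|sphere_area. (\<Sum>i\<in>UNIV. q (x $ 3) *\<^sub>R tderiv i (tderiv i u) x)) =
      (LINT x|sphere_area. q (x $ 3) *\<^sub>R laplace_beltrami u x)"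
    by (simp only: laplace_beltrami_def scaleR_sum_right)
  ultimately have "(LINT x|sphere_area. q' (x $ 3) *\<^sub>R tderiv 3 u x) = - (LINT x|sphere_area. q (x $ 3) *\<^sub>R laplace_beltrami u x)"
    using eq by simp
  then have "(2 * pi) *\<^sub>R (LINT z|meridian. q' z *\<^sub>R circle_average (tderiv 3 u) z) =
    (2 * pi) *\<^sub>R (- (LINT z|meridian. q z *\<^sub>R circle_average (laplace_beltrami u) z))"
    using integral_weighted_average[OF integrable_continuous_mult[OF c(1) U(2)]]
      integral_weighted_average[OF integrable_continuous_mult[OF c(2) sq_integrable_laplace[OF u]]]
    by (simp only: scaleR_minus_right)
  then show ?thesis
    by (simp only: scaleR_cancel_left) simp
qed

lemma radial_antisymmetricE:
  assumes "radial_antisymmetric u"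
  obtains f where "AE x in sphere_area. u x = f (x $ 3)" "\<And>z. z \<in> {- 1..1} \<Longrightarrow> f (- z) = - f z"
proof -
  obtain f where f: "AE x in sphere_area. u x = f (geodesic_dist north_pole x)"
    "\<And>r. r \<in> {0..pi} \<Longrightarrow> f (pi - r) = - f r"
    using assms unfolding radial_antisymmetric_def by blast
  show thesis
  proof (rule that[of "\<lambda>z. f (arccos z)"])
    show "AE x in sphere_area. u x = f (arccos (x $ 3))"
      using f(1) by (simp add: geodesic_dist_def north_pole_inner)
    show "f (arccos (- z)) = - f (arccos z)" if "z \<in> {- 1..1}" for z
      using f(2)[of "arccos z"] arccos_lbound[of z] arccos_ubound[of z] arccos_minus[of z] that by simp
  qed
qed

lemma weak_radial_average:
  assumes u: "u \<in> sobolev 2" and anti: "radial_antisymmetric u"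
  shows "weak_radial (circle_average u) (circle_average (tderiv 3 u)) (circle_average (laplace_beltrami u))"
proof
  note U = sobolev_1D[OF sobolev_2D(1)[OF u]]
  show "sq_integrable meridian (circle_average u)" "sq_integrable meridian (circle_average (tderiv 3 u))"
    "sq_integrable meridian (circle_average (laplace_beltrami u))"
    by (intro sq_integrable_circle_average U sq_integrable_laplace u)+
  obtain f where f: "AE x in sphere_area. u x = f (x $ 3)" "\<And>z. z \<in> {- 1..1} \<Longrightarrow> f (- z) = - f z"
    using radial_antisymmetricE[OF anti] by blast
  have "AE z in meridian. circle_average u z = f z"
    using radial_circle_average[OF f(1) sq_integrable_measurable[OF U(1)]] by eventually_elim simp
  from this AE_interval_uminus[OF this] AE_space[of meridian]
  show "AE z in meridian. circle_average u (- z) = - circle_average u z"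
    by eventually_elim (simp add: f(2) space_restrict_space)
qed (rule weak_gradient_height weak_laplacian_height sobolev_2D(1) u | assumption)+

lemma constant_on_circles:
  assumes u: "radial_antisymmetric u" "u \<in> borel_measurable sphere_area"
  shows "AE z in meridian. AE \<theta> in parallel. u (sphere_point z \<theta>) = circle_average u z"
proof -
  obtain f where f: "AE x in sphere_area. u x = f (x $ 3)"
    using radial_antisymmetricE[OF u(1)] by blast
  from radial_circle_average[OF this u(2)] show ?thesis
    by eventually_elim (erule conjunct2)
qed

lemma circle_average_power_nl:
  assumes u: "radial_antisymmetric u" "u \<in> borel_measurable sphere_area" and m: "(\<lambda>x. power_nl q (u x)) \<in> borel_measurable sphere_area"
  shows "AE z in meridian. circle_average (\<lambda>x. power_nl q (u x)) z = power_nl q (circle_average u z)"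
  using constant_on_circles[OF u] AE_space[of meridian]
proof eventually_elim
  case (elim z)
  then have z: "z \<in> {- 1..1}" by (simp add: space_restrict_space)
  have "(LINT \<theta>|parallel. power_nl q (u (sphere_point z \<theta>))) = (LINT \<theta>|parallel. power_nl q (circle_average u z))"
  proof (rule integral_cong_AE)
    show "AE \<theta> in parallel. power_nl q (u (sphere_point z \<theta>)) = power_nl q (circle_average u z)"
      using elim(1) by eventually_elim simp
  qed (use measurable_on_circle[OF m z] in auto)
  then show ?case
    using measure_circle by (simp add: circle_average_def)
qed

lemma integral_power_radial:
  assumes u: "radial_antisymmetric u" "u \<in> borel_measurable sphere_area"
    and int: "integrable sphere_area (\<lambda>x. norm (u x) powr q)"
  shows "integrable meridian (\<lambda>z. norm (circle_average u z) powr q)"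
    and "(LINT x|sphere_area. norm (u x) powr q) = 2 * pi * (LINT z|meridian. norm (circle_average u z) powr q)"
proof -
  note I = integral_sphere[OF int]
  note [measurable] = borel_measurable_circle_average[OF u(2)]
  have ae: "AE z in meridian. (LINT \<theta>|parallel. norm (u (sphere_point z \<theta>)) powr q) =
      2 * pi * norm (circle_average u z) powr q"
    using constant_on_circles[OF u] AE_space[of meridian]
  proof eventually_elim
    case (elim z)
    then have z: "z \<in> {- 1..1}" by (simp add: space_restrict_space)
    note [measurable] = measurable_on_circle[OF u(2) z]
    have "(LINT \<theta>|parallel. norm (u (sphere_point z \<theta>)) powr q) = (LINT \<theta>|parallel. norm (circle_average u z) powr q)"
    proof (rule integral_cong_AE)
      show "AE \<theta> in parallel. norm (u (sphere_point z \<theta>)) powr q = norm (circle_average u z) powr q"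
        using elim(1) by eventually_elim simp
    qed measurable
    then show ?case
      using measure_circle by simp
  qed
  have "integrable meridian (\<lambda>z. 2 * pi * norm (circle_average u z) powr q)"
    using integrable_cong_AE[OF borel_measurable_integrable[OF I(2)] _ ae] I(2) by simp
  then show "integrable meridian (\<lambda>z. norm (circle_average u z) powr q)"
    by simp
  have "(LINT x|sphere_area. norm (u x) powr q) = (LINT z|meridian. 2 * pi * norm (circle_average u z) powr q)"
    unfolding I(3) by (rule integral_cong_AE[OF borel_measurable_integrable[OF I(2)] _ ae]) simp
  then show "(LINT x|sphere_area. norm (u x) powr q) = 2 * pi * (LINT z|meridian. norm (circle_average u z) powr q)"
    by simp
qed

lemma gradient_norm_eq: "(norm (gradient u x))\<^sup>2 = (\<Sum>i\<in>UNIV. (norm (tderiv i u x))\<^sup>2)"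
  by (simp add: gradient_def norm_vec_def L2_set_def sum_nonneg)

text \<open>
  The vertical field projected to the tangent plane has norm \<open>\<surd>(1 - x\<^sub>3\<^sup>2)\<close>.
\<close>

lemma tangent_vertical_bound:
  fixes v1 v2 v3 :: complex and x1 x2 x3 :: real
  assumes x: "x1\<^sup>2 + x2\<^sup>2 + x3\<^sup>2 = 1" and tan: "x1 *\<^sub>R v1 + x2 *\<^sub>R v2 + x3 *\<^sub>R v3 = 0"
  shows "(norm v3)\<^sup>2 \<le> (1 - x3\<^sup>2) * ((norm v1)\<^sup>2 + (norm v2)\<^sup>2 + (norm v3)\<^sup>2)"
proof -
  have "x3 *\<^sub>R v3 = - (x1 *\<^sub>R v1 + x2 *\<^sub>R v2)"
    using tan by (simp only: add_eq_0_iff)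
  then have "norm (x3 *\<^sub>R v3) = norm (x1 *\<^sub>R v1 + x2 *\<^sub>R v2)"
    by (simp only: norm_minus_cancel)
  also have "\<dots> \<le> \<bar>x1\<bar> * norm v1 + \<bar>x2\<bar> * norm v2"
    using norm_triangle_ineq[of "x1 *\<^sub>R v1" "x2 *\<^sub>R v2"] by simp
  finally have "norm (x3 *\<^sub>R v3) \<le> \<bar>x1\<bar> * norm v1 + \<bar>x2\<bar> * norm v2" .
  then have "(norm (x3 *\<^sub>R v3))\<^sup>2 \<le> (\<bar>x1\<bar> * norm v1 + \<bar>x2\<bar> * norm v2)\<^sup>2"
    by (intro power_mono) auto
  also have "\<dots> \<le> (x1\<^sup>2 + x2\<^sup>2) * ((norm v1)\<^sup>2 + (norm v2)\<^sup>2)"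
  proof -
    have "(\<bar>x1\<bar>\<^sup>2 + \<bar>x2\<bar>\<^sup>2) * ((norm v1)\<^sup>2 + (norm v2)\<^sup>2) - (\<bar>x1\<bar> * norm v1 + \<bar>x2\<bar> * norm v2)\<^sup>2 =
        (\<bar>x1\<bar> * norm v2 - \<bar>x2\<bar> * norm v1)\<^sup>2"
      by (simp only: power2_eq_square) (simp only: algebra_simps)
    then have "0 \<le> (\<bar>x1\<bar>\<^sup>2 + \<bar>x2\<bar>\<^sup>2) * ((norm v1)\<^sup>2 + (norm v2)\<^sup>2) - (\<bar>x1\<bar> * norm v1 + \<bar>x2\<bar> * norm v2)\<^sup>2"
      by simp
    then show ?thesis by (simp only: power2_abs)
  qed
  also have "x1\<^sup>2 + x2\<^sup>2 = 1 - x3\<^sup>2"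
    using x by simp
  finally have "x3\<^sup>2 * (norm v3)\<^sup>2 \<le> (1 - x3\<^sup>2) * ((norm v1)\<^sup>2 + (norm v2)\<^sup>2)"
    by (simp add: power_mult_distrib)
  then show ?thesis
    by (simp add: algebra_simps)
qed

text \<open>
  Only the part of the gradient along the meridians enters the left-hand side. An inequality is
  enough for the purpose, and it spares the computation of the horizontal components of the weak
  gradient.
\<close>

lemma gradient_energy_ge:
  assumes u: "u \<in> sobolev 2" and anti: "radial_antisymmetric u"
  shows "4 * pi * dirichlet_energy (circle_average (laplace_beltrami u)) \<le> (LINT x|sphere_area. (norm (gradient u x))\<^sup>2)"
proof -
  interpret weak_radial "circle_average u" "circle_average (tderiv 3 u)" "circle_average (laplace_beltrami u)"
    by (rule weak_radial_average[OF u anti])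
  note U = sobolev_1D[OF sobolev_2D(1)[OF u]]
  \<comment> \<open>the absolute value makes the weight nonnegative everywhere; at the poles it is \<open>1 / 0 = 0\<close>\<close>
  define w :: "real \<Rightarrow> real" where "w z = 1 / \<bar>1 - z\<^sup>2\<bar>" for z
  have wm: "w \<in> borel_measurable meridian"
  proof -
    have [measurable]: "(\<lambda>z :: real. 1 - z\<^sup>2) \<in> borel_measurable meridian"
      by (intro borel_measurable_interval_continuous continuous_intros)
    show ?thesis unfolding w_def by measurable
  qed
  have gint: "integrable sphere_area (\<lambda>x. (norm (gradient u x))\<^sup>2)"
    unfolding gradient_norm_eq using sq_integrable_square[OF U(2)] by simp
  have le: "AE x in sphere_area. w (x $ 3) * (norm (tderiv 3 u x))\<^sup>2 \<le> (norm (gradient u x))\<^sup>2"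
    using AE_sphere_norm gradient_tangential[OF sobolev_2D(1)[OF u]]
  proof eventually_elim
    case (elim x)
    have one: "(x $ 1)\<^sup>2 + (x $ 2)\<^sup>2 + (x $ 3)\<^sup>2 = 1"
      using elim(1) by (simp add: norm_eq_1 inner_vec_def sum_3 power2_eq_square)
    then have le1: "(x $ 3)\<^sup>2 \<le> 1"
      using zero_le_power2[of "x $ 1"] zero_le_power2[of "x $ 2"] by linarith
    have bound: "(norm (tderiv 3 u x))\<^sup>2 \<le> (1 - (x $ 3)\<^sup>2) * (norm (gradient u x))\<^sup>2"
      unfolding gradient_norm_eq sum_3 using elim(2) by (intro tangent_vertical_bound[OF one]) (simp add: sum_3)
    show ?case
    proof (cases "(x $ 3)\<^sup>2 = 1")
      case False
      with le1 have "0 < 1 - (x $ 3)\<^sup>2" by simp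
      with bound show ?thesis by (simp add: w_def divide_le_eq mult.commute)
    qed (simp add: w_def)
  qed
  have tm: "tderiv 3 u \<in> borel_measurable sphere_area"
    by (rule sq_integrable_measurable[OF U(2)])
  have w3: "(\<lambda>x :: real^3. w (x $ 3)) \<in> borel_measurable sphere_area"
  proof -
    have "(\<lambda>x :: real^3. 1 - (x $ 3)\<^sup>2) \<in> borel_measurable borel"
      by (intro borel_measurable_continuous_onI continuous_intros)
    then have [measurable]: "(\<lambda>x :: real^3. 1 - (x $ 3)\<^sup>2) \<in> borel_measurable sphere_area"
      by (simp cong: measurable_cong_sets)
    show ?thesis unfolding w_def by measurable
  qed
  have wint: "integrable sphere_area (\<lambda>x. w (x $ 3) * (norm (tderiv 3 u x))\<^sup>2)"
  proof (rule Bochner_Integration.integrable_bound[OF gint])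
    note [measurable] = tm w3
    show "(\<lambda>x. w (x $ 3) * (norm (tderiv 3 u x))\<^sup>2) \<in> borel_measurable sphere_area"
      by measurable
    show "AE x in sphere_area. norm (w (x $ 3) * (norm (tderiv 3 u x))\<^sup>2) \<le> norm ((norm (gradient u x))\<^sup>2)"
      using le by eventually_elim (simp add: w_def abs_mult)
  qed
  have w0: "0 \<le> w z" for z
    by (simp add: w_def)
  note avg = circle_average_square_le[OF w0 wm wint U(2)]
  have eq: "w z * (norm (circle_average (tderiv 3 u) z))\<^sup>2 = (norm (circle_average (tderiv 3 u) z))\<^sup>2 / (1 - z\<^sup>2)"
    if "z \<in> space meridian" for z
  proof -
    have "z\<^sup>2 \<le> 1"
      using that by (simp add: abs_square_le_1 abs_le_iff space_restrict_space)
    then show ?thesis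
      by (simp add: w_def)
  qed
  have int: "integrable meridian (\<lambda>z. (norm (circle_average (tderiv 3 u) z))\<^sup>2 / (1 - z\<^sup>2))"
  proof -
    have "integrable meridian (\<lambda>z. w z * (norm (circle_average (tderiv 3 u) z))\<^sup>2) \<longleftrightarrow>
        integrable meridian (\<lambda>z. (norm (circle_average (tderiv 3 u) z))\<^sup>2 / (1 - z\<^sup>2))"
      by (rule Bochner_Integration.integrable_cong[OF refl]) (rule eq)
    then show ?thesis
      using avg(1) by blast
  qed
  have "(LINT z|meridian. w z * (norm (circle_average (tderiv 3 u) z))\<^sup>2) =
      (LINT z|meridian. (norm (circle_average (tderiv 3 u) z))\<^sup>2 / (1 - z\<^sup>2))"
    by (rule Bochner_Integration.integral_cong[OF refl]) (rule eq)
  then have w_eq: "(LINT z|meridian. w z * (norm (circle_average (tderiv 3 u) z))\<^sup>2) =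
      2 * dirichlet_energy (circle_average (laplace_beltrami u))"
    unfolding gradient_energy_eq[OF int] .
  have "2 * pi * (2 * dirichlet_energy (circle_average (laplace_beltrami u))) =
      2 * pi * (LINT z|meridian. w z * (norm (circle_average (tderiv 3 u) z))\<^sup>2)"
    unfolding w_eq ..
  also have "\<dots> \<le> (LINT x|sphere_area. w (x $ 3) * (norm (tderiv 3 u x))\<^sup>2)"
    by (rule avg(2))
  also have "\<dots> \<le> (LINT x|sphere_area. (norm (gradient u x))\<^sup>2)"
    by (rule integral_mono_AE[OF wint gint le])
  finally show ?thesis by simp
qed

text \<open>
  The factor is \<open>2 \<pi>\<close> for the longitude times 2 for the two hemispheres.
\<close>

lemma energy_ge_half_energy:
  assumes u: "u \<in> sobolev 2" "u \<in> Lspace (p + 1)" and anti: "radial_antisymmetric u"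
  shows "4 * pi * half_energy (p + 1) (circle_average (laplace_beltrami u)) \<le> energy p u"
proof -
  interpret weak_radial "circle_average u" "circle_average (tderiv 3 u)" "circle_average (laplace_beltrami u)"
    by (rule weak_radial_average[OF u(1) anti])
  note U = sobolev_1D[OF sobolev_2D(1)[OF u(1)]]
  have gint: "integrable sphere_area (\<lambda>x. (norm (gradient u x))\<^sup>2)"
    unfolding gradient_norm_eq using sq_integrable_square[OF U(2)] by simp
  have pint: "integrable sphere_area (\<lambda>x. norm (u x) powr (p + 1))"
    using u(2) by (simp add: Lspace_def)
  note P = integral_power_radial[OF anti sq_integrable_measurable[OF U(1)] pint]
  have "energy p u = (LINT x|sphere_area. (norm (gradient u x))\<^sup>2) - 2 / (p + 1) * (LINT x|sphere_area. norm (u x) powr (p + 1))"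
    unfolding energy_def using gint pint by (subst Bochner_Integration.integral_diff) simp_all
  moreover have "(LINT x|sphere_area. norm (u x) powr (p + 1)) =
      4 * pi * (LINT z|hemi. norm (profile (circle_average (laplace_beltrami u)) z) powr (p + 1))"
    unfolding P(2) power_integral_eq[OF P(1)] by simp
  ultimately show ?thesis
    using gradient_energy_ge[OF u(1) anti] by (simp add: half_energy_def algebra_simps)
qed


section \<open>Blow-up\<close>

lemma l2norm_hemisphere_le:
  assumes w: "sq_integrable sphere_area w" and f: "f \<in> borel_measurable hemi"
    and eq: "AE z in hemi. f z = circle_average w z"
  shows "l2norm hemi f \<le> l2norm sphere_area w"
proof -
  note avg = sq_integrable_circle_average[OF w]
  have "l2norm hemi f = l2norm hemi (circle_average w)"
    by (rule l2norm_cong_AE[OF eq f]) (rule sq_integrable_measurable[OF sq_integrable_interval_restrict[OF avg(1)]], auto)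
  also have "\<dots> \<le> l2norm meridian (circle_average w)"
    by (rule l2norm_interval_restrict[OF avg(1)]) auto
  finally show ?thesis
    using avg(2) by linarith
qed

lemma energy_cong:
  assumes "AE x in sphere_area. u x = v x" and u: "u \<in> sobolev 1" and v: "v \<in> borel_measurable sphere_area"
  shows "energy p u = energy p v"
proof -
  note U = sobolev_1D[OF u]
  have t: "tderiv i u = tderiv i v" for i
    by (rule tderiv_cong[OF assms(1) sq_integrable_measurable[OF U(1)] v])
  have g: "gradient u = gradient v"
    unfolding gradient_def t ..
  have [measurable]: "(\<lambda>x. (norm (gradient v x))\<^sup>2) \<in> borel_measurable sphere_area"
    unfolding g[symmetric] gradient_norm_eq using sq_integrable_square[OF U(2)] by simp
  note [measurable] = sq_integrable_measurable[OF U(1)] v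
  show ?thesis
    unfolding energy_def g
  proof (rule integral_cong_AE)
    show "AE x in sphere_area. (norm (gradient v x))\<^sup>2 - 2 / (p + 1) * norm (u x) powr (p + 1) =
        (norm (gradient v x))\<^sup>2 - 2 / (p + 1) * norm (v x) powr (p + 1)"
      using assms(1) by eventually_elim simp
  qed measurable
qed

text \<open>
  Circle averages of the solution, of its Laplacian and of its time derivative form a flow on the
  hemisphere: averaging is linear, does not increase \<open>L\<^sup>2\<close> norms, and commutes with the nonlinearity on
  radial functions.
\<close>

lemma global_solution_radial_flow:
  assumes p: "5 \<le> p" and sol: "nls_solution p u0 \<infinity> u"
    and anti: "\<And>t. 0 \<le> t \<Longrightarrow> radial_antisymmetric (u t)"
  obtains d where "radial_flow (p + 1) (\<lambda>t. circle_average (laplace_beltrami (u t))) d"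
proof -
  have I: "time_interval \<infinity> = {0..}"
    by (auto simp: time_interval_def)
  have reg: "u t \<in> sobolev 2" if "0 \<le> t" for t
    using sol that unfolding nls_solution_def I by auto
  have cont: "((\<lambda>s. sobolev_norm 2 (\<lambda>x. u s x - u t x)) \<longlongrightarrow> 0) (at t within {0..})" if "0 \<le> t" for t
    using sol that unfolding nls_solution_def I continuous_in_norm_def by auto
  obtain u' where C1: "C1_L2 {0..} u u'"
    and pde': "\<forall>t\<in>{0..}. AE x in sphere_area.
      \<i> * u' t x = laplace_beltrami (u t) x + (norm (u t x) powr (p - 1)) *\<^sub>R u t x"
    using sol unfolding nls_solution_def I by blast
  have pde: "AE x in sphere_area.
      \<i> * u' t x = laplace_beltrami (u t) x + (norm (u t x) powr (p - 1)) *\<^sub>R u t x" if "0 \<le> t" for t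
    using bspec[OF pde', of t] that by simp
  have u'_sq: "sq_integrable sphere_area (u' t)" if "0 \<le> t" for t
    using C1 that by (simp add: C1_L2_def Lspace_2)
  have diff: "((\<lambda>s. l2norm sphere_area (\<lambda>x. (u s x - u t x) /\<^sub>R (s - t) - u' t x)) \<longlongrightarrow> 0) (at t within {0..})"
    if "0 \<le> t" for t
    using C1 that unfolding C1_L2_def Lnorm_2 by auto
  note U = sobolev_1D[OF sobolev_2D(1)[OF reg]]
  note Um = sq_integrable_measurable[OF U(1)]
  note L = sq_integrable_laplace[OF reg]
  define l d where "l t = circle_average (laplace_beltrami (u t))" and "d t = circle_average (u' t)" for t
  have l_sq: "sq_integrable hemi (l t)" if "0 \<le> t" for t
    unfolding l_def using sq_integrable_circle_average(1)[OF L[OF that]] sq_integrable_interval_restrict[of "-1" 1 _ 0 1] by auto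
  have d_sq: "sq_integrable hemi (d t)" if "0 \<le> t" for t
    unfolding d_def using sq_integrable_circle_average(1)[OF u'_sq[OF that]] sq_integrable_interval_restrict[of "-1" 1 _ 0 1] by auto
  have prof: "AE z in hemi. circle_average (u t) z = profile (l t) z" if "0 \<le> t" for t
    unfolding l_def by (rule weak_radial.h_eq_profile[OF weak_radial_average[OF reg[OF that] anti[OF that]]])
  have to_unit: "AE z in hemi. P z" if "AE z in meridian. P z" for P
    by (rule AE_interval_subset[OF that]) auto
  have "radial_flow (p + 1) l d"
  proof
    show "6 \<le> p + 1" using p by simp
    fix t :: real assume t: "0 \<le> t"
    show "sq_integrable hemi (l t)" "sq_integrable hemi (d t)"
      by (rule l_sq[OF t] d_sq[OF t])+
    show "AE z in hemi. \<i> * d t z = l t z + power_nl (p + 1) (profile (l t) z)"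
    proof -
      have eq: "AE x in sphere_area. \<i> * u' t x - laplace_beltrami (u t) x = power_nl (p + 1) (u t x)"
        using pde[OF t] by eventually_elim (simp add: power_nl_def)
      have iu': "sq_integrable sphere_area (\<lambda>x. \<i> * u' t x)"
        by (rule sq_integrable_cmult[OF u'_sq[OF t]])
      have Nm: "(\<lambda>x. power_nl (p + 1) (u t x)) \<in> borel_measurable sphere_area"
        unfolding power_nl_def using Um[OF t] by measurable
      have "AE z in meridian. circle_average (\<lambda>x. \<i> * u' t x - laplace_beltrami (u t) x) z =
          circle_average (\<lambda>x. power_nl (p + 1) (u t x)) z"
        by (rule circle_average_cong_AE[OF eq sq_integrable_measurable[OF sq_integrable_diff[OF iu' L[OF t]]] Nm])
      moreover have "AE z in meridian. circle_average (\<lambda>x. \<i> * u' t x - laplace_beltrami (u t) x) z =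
          circle_average (\<lambda>x. \<i> * u' t x) z - l t z"
        unfolding l_def by (rule circle_average_diff[OF integrable_sphere_sq[OF iu'] integrable_sphere_sq[OF L[OF t]]])
      moreover note circle_average_power_nl[OF anti[OF t] Um[OF t] Nm]
      ultimately have "AE z in meridian. \<i> * d t z = l t z + power_nl (p + 1) (circle_average (u t) z)"
        by eventually_elim (simp add: d_def circle_average_cmult diff_eq_eq add.commute)
      from to_unit[OF this] prof[OF t] show ?thesis
        by eventually_elim simp
    qed
    show "((\<lambda>s. l2norm hemi (\<lambda>z. l s z - l t z)) \<longlongrightarrow> 0) (at t within {0..})"
    proof (rule Lim_null_comparison)
      show "((\<lambda>s. sqrt 3 * sobolev_norm 2 (\<lambda>x. u s x - u t x)) \<longlongrightarrow> 0) (at t within {0..})"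
        using tendsto_mult_right_zero[OF cont[OF t]] .
      show "\<forall>\<^sub>F s in at t within {0..}. norm (l2norm hemi (\<lambda>z. l s z - l t z))
          \<le> sqrt 3 * sobolev_norm 2 (\<lambda>x. u s x - u t x)"
        using eventually_within_nonneg
      proof eventually_elim
        case (elim s)
        then have s: "0 \<le> s" by simp
        have "AE z in meridian. circle_average (\<lambda>x. laplace_beltrami (u s) x - laplace_beltrami (u t) x) z = l s z - l t z"
          unfolding l_def by (rule circle_average_diff[OF integrable_sphere_sq[OF L[OF s]] integrable_sphere_sq[OF L[OF t]]])
        from to_unit[OF this]
        have "AE z in hemi. l s z - l t z = circle_average (\<lambda>x. laplace_beltrami (u s) x - laplace_beltrami (u t) x) z"
          by eventually_elim simp
        then have "l2norm hemi (\<lambda>z. l s z - l t z) \<le>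
            l2norm sphere_area (\<lambda>x. laplace_beltrami (u s) x - laplace_beltrami (u t) x)"
          by (intro l2norm_hemisphere_le sq_integrable_diff L s t sq_integrable_measurable l_sq)
        also have "\<dots> \<le> sqrt 3 * sobolev_norm 2 (\<lambda>x. u s x - u t x)"
          by (rule laplace_diff_norm_le[OF reg[OF s] reg[OF t]])
        finally show ?case by simp
      qed
    qed
    show "((\<lambda>s. l2norm hemi (\<lambda>z. (profile (l s) z - profile (l t) z) /\<^sub>R (s - t) - d t z)) \<longlongrightarrow> 0) (at t within {0..})"
    proof (rule Lim_null_comparison[OF _ diff[OF t]])
      show "\<forall>\<^sub>F s in at t within {0..}.
          norm (l2norm hemi (\<lambda>z. (profile (l s) z - profile (l t) z) /\<^sub>R (s - t) - d t z))
          \<le> l2norm sphere_area (\<lambda>x. (u s x - u t x) /\<^sub>R (s - t) - u' t x)"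
        using eventually_within_nonneg
      proof eventually_elim
        case (elim s)
        then have s: "0 \<le> s" by simp
        have ust: "sq_integrable sphere_area (\<lambda>x. (u s x - u t x) /\<^sub>R (s - t))"
          by (intro sq_integrable_scaleR sq_integrable_diff U(1) s t)
        have "AE z in meridian. circle_average (\<lambda>x. (u s x - u t x) /\<^sub>R (s - t) - u' t x) z =
            circle_average (\<lambda>x. (u s x - u t x) /\<^sub>R (s - t)) z - d t z"
          unfolding d_def by (rule circle_average_diff[OF integrable_sphere_sq[OF ust] integrable_sphere_sq[OF u'_sq[OF t]]])
        moreover have "AE z in meridian. circle_average (\<lambda>x. u s x - u t x) z = circle_average (u s) z - circle_average (u t) z"
          by (rule circle_average_diff[OF integrable_sphere_sq[OF U(1)[OF s]] integrable_sphere_sq[OF U(1)[OF t]]])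
        ultimately have "AE z in meridian. circle_average (\<lambda>x. (u s x - u t x) /\<^sub>R (s - t) - u' t x) z =
            (circle_average (u s) z - circle_average (u t) z) /\<^sub>R (s - t) - d t z"
          by eventually_elim (simp only: circle_average_scaleR)
        from to_unit[OF this] prof[OF s] prof[OF t]
        have "AE z in hemi. (profile (l s) z - profile (l t) z) /\<^sub>R (s - t) - d t z =
            circle_average (\<lambda>x. (u s x - u t x) /\<^sub>R (s - t) - u' t x) z"
          by eventually_elim simp
        then have "l2norm hemi (\<lambda>z. (profile (l s) z - profile (l t) z) /\<^sub>R (s - t) - d t z)
          \<le> l2norm sphere_area (\<lambda>x. (u s x - u t x) /\<^sub>R (s - t) - u' t x)"
          by (intro l2norm_hemisphere_le sq_integrable_diff ust u'_sq t sq_integrable_measurable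
              sq_integrable_scaleR sq_integrable_profile l_sq d_sq s)
        then show ?case by simp
      qed
    qed
  qed
  then show thesis
    using that unfolding l_def[abs_def] by blast
qed

theorem theorem2:
  fixes p :: real
    and u0 :: "real^3 \<Rightarrow> complex"
    and u :: "real \<Rightarrow> real^3 \<Rightarrow> complex"
    and T :: ereal
  assumes "p \<ge> 5"
    and "u0 \<in> sobolev 1"
    and "radial_antisymmetric u0"
    and "energy p u0 < 0"
    and "0 < T"
    and "maximal_nls_solution p u0 T u"
    and "\<forall>t\<in>time_interval T. radial_antisymmetric (u t)"
  shows "T < \<infinity>"
proof (rule ccontr)
  assume "\<not> T < \<infinity>"
  then have T: "T = \<infinity>" by simp
  have sol: "nls_solution p u0 \<infinity> u"
    using assms(6) unfolding maximal_nls_solution_def T by blast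
  have anti: "radial_antisymmetric (u t)" if "0 \<le> t" for t
    using assms(7) that unfolding T time_interval_def by simp
  have u_0: "u 0 \<in> sobolev 2" "u 0 \<in> Lspace (p + 1)" "AE x in sphere_area. u 0 x = u0 x"
    using sol unfolding nls_solution_def time_interval_def by auto
  obtain d where flow: "radial_flow (p + 1) (\<lambda>t. circle_average (laplace_beltrami (u t))) d"
    using global_solution_radial_flow[OF assms(1) sol anti] by blast
  have "0 \<le> 4 * pi * half_energy (p + 1) (circle_average (laplace_beltrami (u 0)))"
    using radial_flow.half_energy_nonneg[OF flow] by simp
  also have "\<dots> \<le> energy p (u 0)"
    by (rule energy_ge_half_energy[OF u_0(1,2) anti]) simp
  also have "\<dots> = energy p u0"
    by (rule energy_cong[OF u_0(3) sobolev_2D(1)[OF u_0(1)] sq_integrable_measurable[OF sobolev_1D(1)[OF assms(2)]]])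
  finally show False
    using assms(4) by simp
qed

end
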